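(* Let $\Bbbk$ be an algebraically closed field of characteristic $p>0$ and let $L\in\Bbbk[[x]][\partial]$ be a linear differential operator of order $n$ with regular singularity at $0$ (and shift $0$), acting on $\mathcal{R}$. For each local exponent $\rho\in\Bbbk$ of $L$ let $u_\rho=\mathrm{Id}-S\circ T:\mathcal{F}^\rho_L\to\mathcal{F}^\rho_L$ be the automorphism of the $\rho$-function space $\mathcal{F}^\rho_L$ associated to $\rho$ as described in the context. Then the solutions of the differential equation $Ly=0$ in $\mathcal{R}$ form an $n$-dimensional $\mathcal{C}$-vector space. A basis is given by $$y_{\rho,i}=u_\rho^{-1}(t^\rho z^{i^*}),$$ where $\rho$ varies over the local exponents of $L$ at $0$ and $0\le i<m_\rho$, with $i^*=(i,\lfloor i/p\rfloor,\lfloor i/p^2\rfloor,\ldots)$.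
   Context: $\mathbb{N}=\{0,1,2,\ldots\}$; $\mathbb{N}^{(\mathbb{N})}$ is the set of sequences $\alpha=(\alpha_1,\alpha_2,\ldots)$ of natural numbers with finite support. $z=(z_1,z_2,\ldots)$ are countably many variables, $z^\alpha=\prod_iz_i^{\alpha_i}$, $\Bbbk(z)=\Bbbk(z_1,z_2,\ldots)$, $\Bbbk(z^p)=\Bbbk(z_1^p,z_2^p,\ldots)$, and $\mathbb{F}_p$ is the prime field of $\Bbbk$. The ring $\mathcal{R}=\bigoplus_{\rho\in\Bbbk}t^\rho\,\Bbbk(z)((x))$ is the group algebra of the additive group of $\Bbbk$ over $\Bbbk(z)((x))$, i.e. $(t^\rho f)(t^\sigma g)=t^{\rho+\sigma}fg$, $t^0=1$. Its derivation $\partial$ (extended termwise to Laurent series in $x$) is $\Bbbk$-linear with $\partial x=1$, $\partial t^\rho=\rho\,t^\rho\frac1x$, $\partial z_1=\frac1x$, $\partial z_k=\frac{1}{x\,z_1\cdots z_{k-1}}$ for $k\ge2$. Its field of constants is $\mathcal{C}=\bigoplus_{\sigma\in\mathbb{F}_p}t^\sigma x^{p-\sigma}\Bbbk(z^p)((x^p))$ (in exponents of $x$, $\sigma$ is represented in $\{0,\ldots,p-1\}$). Write $L=\sum_{j=0}^n\sum_{i\ge0}c_{ij}x^i\partial^j$. The shift of $L$ is the minimal $i-j$ with $c_{ij}\ne0$; it is assumed to be $0$ (achieved by multiplying $L$ with a power of $x$), so the initial form is $L_0=\sum_{i=0}^nc_{ii}x^i\partial^i$. $L$ has a regular singularity at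 $0$ if $L_0$ also has order $n$, i.e. $c_{nn}\neq0$. The indicial polynomial is $\chi_L(s)=\sum_ic_{ii}s(s-1)\cdots(s-i+1)\in\Bbbk[s]$; its roots are the local exponents, and $m_\sigma$ is the multiplicity of $\sigma\in\Bbbk$ as a root of $\chi_L$ ($m_\sigma=0$ if $\sigma$ is not a root). For $\rho\in\Bbbk$, $k\in\mathbb{Z}$, $\rho+k$ means $\rho$ plus the image of $k$ in $\mathbb{F}_p$. For a local exponent $\rho$ put $n_\rho(k)=m_\rho+m_{\rho+1}+\cdots+m_{\rho+k}$ and $\mathcal{A}_k=\{\alpha\in\mathbb{N}^{(\mathbb{N})}\mid\alpha_1<n_\rho(k),\ \alpha_{j+1}\le\alpha_j/p\ \text{for all } j\ge1\}$. The $\rho$-function space $\mathcal{F}=\mathcal{F}^\rho_L$ consists of all (possibly infinite) formal sums $t^\rho\sum_{k\ge0}f_kx^k$ with $f_k\in\bigoplus_{\alpha\in\mathcal{A}_k}\Bbbk z^\alpha$, with the $x$-adic topology. Put $e(\alpha)=\overline{\alpha}_1+p\overline{\alpha}_2+p^2\overline{\alpha}_3+\cdots$ with $\overline{\alpha}_i\in\{0,\ldots,p-1\}$, $\overline{\alpha}_i\equiv\alpha_i\bmod p$. Let $\mathcal{H}\subseteq\mathcal{F}$ be topologically spanned by the monomials $t^\rho x^kz^\alpha$ with $\alpha\in\mathcal{A}_k$, $e(\alpha)\ge m_{\rho+k}$. Then $L_0|_{\mathcal{H}}:\mathcal{H}\to\mathcal{F}x$ is bijective; $S:\mathcal{F}x\to\mathcal{F}$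 denotes its inverse composed with the inclusion $\mathcal{H}\subseteq\mathcal{F}$, $T=L_0-L:\mathcal{F}\to\mathcal{F}x$, and $u_\rho=\mathrm{Id}_{\mathcal{F}}-S\circ T$, which is an automorphism of $\mathcal{F}$ with inverse $\sum_{k\ge0}(S\circ T)^k$ and satisfies $L\circ u_\rho^{-1}=L_0$. *)

theory Defs
  imports "HOL-Library.Poly_Mapping" "HOL-Algebra.Algebraic_Closure_Type"
begin

section \<open>The ring R and its derivation\<close>

text \<open>
  The variable written z with index k + 1 on paper has index k here; an exponent sequence
  with finite support is a value of type \<open>nat \<Rightarrow>\<^sub>0 nat\<close>.
\<close>

type_synonym 'k zpoly = "(nat \<Rightarrow>\<^sub>0 nat) \<Rightarrow>\<^sub>0 'k"
type_synonym 'k zfield = "'k zpoly fract"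

text \<open>
  The multiplication of \<open>'k \<Rightarrow>\<^sub>0 'k zfield fls\<close> provided by the library is
  convolution, so this type is the group algebra of the additive group of \<open>'k\<close>, and
  \<open>Poly_Mapping.single \<rho> f\<close> is the element written t to the power rho times f.
\<close>

type_synonym 'k logring = "'k \<Rightarrow>\<^sub>0 'k zfield fls"

definition zconst :: "'k::field \<Rightarrow> 'k zfield" where
  "zconst c = to_fract (Poly_Mapping.single 0 c)"

definition zmonom :: "(nat \<Rightarrow>\<^sub>0 nat) \<Rightarrow> 'k::field zfield" where
  "zmonom \<alpha> = to_fract (Poly_Mapping.single \<alpha> 1)"

definition zvar :: "nat \<Rightarrow> 'k::field zfield" where
  "zvar i = zmonom (Poly_Mapping.single i 1)"

definition partial_zpoly :: "nat \<Rightarrow> 'k::field zpoly \<Rightarrow> 'k zpoly" where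
  "partial_zpoly i P = (\<Sum>\<alpha>\<in>Poly_Mapping.keys P.
     Poly_Mapping.single (\<alpha> - Poly_Mapping.single i 1)
       (of_nat (Poly_Mapping.lookup \<alpha> i) * Poly_Mapping.lookup P \<alpha>))"

text \<open>
  \<open>zderiv\<close> is x times the derivation of R, restricted to the field of rational functions
  in z: the derivation over the ground field sending variable k to the inverse of the
  product of all variables before it.
\<close>

definition zpoly_deriv :: "'k::field zpoly \<Rightarrow> 'k zfield" where
  "zpoly_deriv P = (\<Sum>i\<in>(\<Union>\<alpha>\<in>Poly_Mapping.keys P. Poly_Mapping.keys \<alpha>).
     to_fract (partial_zpoly i P) * inverse (\<Prod>j<i. zvar j))"

definition zderiv :: "'k::field zfield \<Rightarrow> 'k zfield" where
  "zderiv f = (THE d. \<forall>a b. b \<noteq> 0 \<longrightarrow> f = Fract a b \<longrightarrow>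
     d = (zpoly_deriv a * to_fract b - to_fract a * zpoly_deriv b) / (to_fract b)\<^sup>2)"

lemma partial_zpoly_superset:
  assumes "finite A" "Poly_Mapping.keys P \<subseteq> A"
  shows "partial_zpoly i P = (\<Sum>\<alpha>\<in>A. Poly_Mapping.single (\<alpha> - Poly_Mapping.single i 1)
     (of_nat (Poly_Mapping.lookup \<alpha> i) * Poly_Mapping.lookup P \<alpha>))"
  unfolding partial_zpoly_def
  by (rule sum.mono_neutral_left) (use assms in \<open>auto simp: in_keys_iff\<close>)

lemma partial_zpoly_add: "partial_zpoly i (P + Q) = partial_zpoly i P + partial_zpoly i Q"
proof -
  let ?A = "Poly_Mapping.keys P \<union> Poly_Mapping.keys Q"
  have "Poly_Mapping.keys (P + Q) \<subseteq> ?A"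
    by (rule Poly_Mapping.keys_add)
  then show ?thesis
    by (subst (1 2 3) partial_zpoly_superset[of ?A])
       (auto simp: lookup_add algebra_simps single_add sum.distrib)
qed

lemma partial_zpoly_single:
  "partial_zpoly i (Poly_Mapping.single \<alpha> c) =
     Poly_Mapping.single (\<alpha> - Poly_Mapping.single i 1) (of_nat (Poly_Mapping.lookup \<alpha> i) * c)"
  by (subst partial_zpoly_superset[of "{\<alpha>}"]) auto

lemma partial_zpoly_zero [simp]: "partial_zpoly i 0 = 0"
  by (simp add: partial_zpoly_def)

lemma zpoly_induct:
  fixes P :: "'k::field zpoly"
  assumes "\<And>\<alpha> c. S (Poly_Mapping.single \<alpha> c)" "\<And>P Q. S P \<Longrightarrow> S Q \<Longrightarrow> S (P + Q)"
  shows "S P"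
proof -
  have "S (\<Sum>\<alpha>\<in>A. Poly_Mapping.single \<alpha> (Poly_Mapping.lookup P \<alpha>))" if "finite A" for A
    using that
  proof (induction A)
    case empty
    show ?case using assms(1)[of 0 0] by simp
  next
    case (insert \<alpha> A)
    then show ?case by (simp add: assms)
  qed
  moreover have "(\<Sum>\<alpha>\<in>Poly_Mapping.keys P. Poly_Mapping.single \<alpha> (Poly_Mapping.lookup P \<alpha>)) = P"
    by (rule poly_mapping_eqI) (auto simp: lookup_sum lookup_single when_def in_keys_iff)
  ultimately show ?thesis
    using finite_keys by metis
qed

lemma diff_single_add:
  fixes \<alpha> \<beta> :: "nat \<Rightarrow>\<^sub>0 nat"
  assumes "Poly_Mapping.lookup \<alpha> i \<noteq> 0"
  shows "\<alpha> - Poly_Mapping.single i (Suc 0) + \<beta> = \<alpha> + \<beta> - Poly_Mapping.single i (Suc 0)"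
  by (rule poly_mapping_eqI)
     (use assms in \<open>auto simp: lookup_add lookup_minus lookup_single when_def\<close>)

lemma partial_zpoly_mult_single:
  "partial_zpoly i (Poly_Mapping.single \<alpha> c * Poly_Mapping.single \<beta> d) =
     partial_zpoly i (Poly_Mapping.single \<alpha> c) * Poly_Mapping.single \<beta> d +
     Poly_Mapping.single \<alpha> c * partial_zpoly i (Poly_Mapping.single \<beta> d)"
proof -
  let ?s = "Poly_Mapping.single"
  have "?s (\<alpha> - ?s i 1 + \<beta>) (of_nat (Poly_Mapping.lookup \<alpha> i) * c * d) =
        ?s (\<alpha> + \<beta> - ?s i 1) (of_nat (Poly_Mapping.lookup \<alpha> i) * c * d)"
    by (cases "Poly_Mapping.lookup \<alpha> i = 0") (auto simp: diff_single_add)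
  moreover have "?s (\<alpha> + (\<beta> - ?s i 1)) (c * (of_nat (Poly_Mapping.lookup \<beta> i) * d)) =
        ?s (\<alpha> + \<beta> - ?s i 1) (c * (of_nat (Poly_Mapping.lookup \<beta> i) * d))"
    using diff_single_add[of \<beta> i \<alpha>]
    by (cases "Poly_Mapping.lookup \<beta> i = 0") (auto simp: add.commute)
  ultimately show ?thesis
    by (simp add: partial_zpoly_single mult_single lookup_add single_add[symmetric] algebra_simps)
qed

lemma partial_zpoly_mult:
  "partial_zpoly i (P * Q) = partial_zpoly i P * Q + P * partial_zpoly i Q"
proof (induction P rule: zpoly_induct)
  case (1 \<alpha> c)
  show ?case
  proof (induction Q rule: zpoly_induct)
    case (1 \<beta> d)
    show ?case by (rule partial_zpoly_mult_single)
  next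
    case (2 P Q)
    then show ?case by (simp add: partial_zpoly_add algebra_simps)
  qed
next
  case (2 P Q)
  then show ?case by (simp add: partial_zpoly_add algebra_simps)
qed

lemma partial_zpoly_eq_0:
  assumes "i \<notin> (\<Union>\<alpha>\<in>Poly_Mapping.keys P. Poly_Mapping.keys \<alpha>)"
  shows "partial_zpoly i P = 0"
  unfolding partial_zpoly_def
  by (rule sum.neutral) (use assms in \<open>auto simp: in_keys_iff\<close>)

lemma zpoly_deriv_superset:
  assumes "finite A" "(\<Union>\<alpha>\<in>Poly_Mapping.keys P. Poly_Mapping.keys \<alpha>) \<subseteq> A"
  shows "zpoly_deriv P = (\<Sum>i\<in>A. to_fract (partial_zpoly i P) * inverse (\<Prod>j<i. zvar j))"
  unfolding zpoly_deriv_def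
  by (rule sum.mono_neutral_left) (use assms in \<open>auto simp: partial_zpoly_eq_0\<close>)

lemma zpoly_deriv_mult:
  "zpoly_deriv (P * Q) = zpoly_deriv P * to_fract Q + to_fract P * zpoly_deriv Q"
proof -
  define A where "A = (\<Union>\<alpha>\<in>Poly_Mapping.keys P \<union> Poly_Mapping.keys Q \<union> Poly_Mapping.keys (P * Q).
    Poly_Mapping.keys \<alpha>)"
  have A: "finite A" "(\<Union>\<alpha>\<in>Poly_Mapping.keys P. Poly_Mapping.keys \<alpha>) \<subseteq> A"
    "(\<Union>\<alpha>\<in>Poly_Mapping.keys Q. Poly_Mapping.keys \<alpha>) \<subseteq> A"
    "(\<Union>\<alpha>\<in>Poly_Mapping.keys (P * Q). Poly_Mapping.keys \<alpha>) \<subseteq> A"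
    by (auto simp: A_def)
  show ?thesis
    unfolding A(2)[THEN zpoly_deriv_superset[OF A(1)]] A(3)[THEN zpoly_deriv_superset[OF A(1)]]
      A(4)[THEN zpoly_deriv_superset[OF A(1)]]
    by (simp add: partial_zpoly_mult algebra_simps sum.distrib sum_distrib_left sum_distrib_right)
qed

text \<open>The quotient rule does not depend on the choice of the fraction.\<close>

lemma zderiv_Fract:
  assumes "b \<noteq> 0"
  shows "zderiv (Fract a b) =
    (zpoly_deriv a * to_fract b - to_fract a * zpoly_deriv b) / (to_fract b)\<^sup>2"
  unfolding zderiv_def
proof (rule the_equality, intro allI impI)
  fix c d :: "'a zpoly"
  assume d: "d \<noteq> 0" and eq: "Fract a b = Fract c d"
  have *: "a * d = c * b"
    using eq assms d by (simp add: eq_fract)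
  let ?D = zpoly_deriv and ?t = to_fract
  have 1: "?t a * ?t d = ?t c * ?t b"
    using * by (metis to_fract_mult)
  have 2: "?D a * ?t d + ?t a * ?D d = ?D c * ?t b + ?t c * ?D b"
    using * by (metis zpoly_deriv_mult)
  have nz: "?t b \<noteq> 0" "?t d \<noteq> 0"
    using assms d by auto
  define q where "q = ?t a / ?t b"
  have q: "?t a = q * ?t b" "?t c = q * ?t d"
    using nz 1 by (auto simp: q_def field_simps)
  have 3: "(?D a - q * ?D b) * ?t d = (?D c - q * ?D d) * ?t b"
    using 2 unfolding q by (simp add: algebra_simps)
  have "(?D a * ?t b - ?t a * ?D b) / (?t b)\<^sup>2 = (?D a - q * ?D b) / ?t b"
    using nz unfolding q by (simp add: power2_eq_square field_simps)
  also have "\<dots> = (?D c - q * ?D d) / ?t d"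
    using 3 nz by (simp add: field_simps)
  also have "\<dots> = (?D c * ?t d - ?t c * ?D d) / (?t d)\<^sup>2"
    using nz unfolding q by (simp add: power2_eq_square field_simps)
  finally show "(?D a * ?t b - ?t a * ?D b) / (?t b)\<^sup>2 = (?D c * ?t d - ?t c * ?D d) / (?t d)\<^sup>2" .
next
  fix d'
  assume "\<forall>c d. d \<noteq> 0 \<longrightarrow> Fract a b = Fract c d \<longrightarrow>
    d' = (zpoly_deriv c * to_fract d - to_fract c * zpoly_deriv d) / (to_fract d)\<^sup>2"
  then show "d' = (zpoly_deriv a * to_fract b - to_fract a * zpoly_deriv b) / (to_fract b)\<^sup>2"
    using assms by blast
qed

lemma zpoly_deriv_const [simp]: "zpoly_deriv (Poly_Mapping.single 0 c) = 0"
  by (subst zpoly_deriv_superset[of "{}"]) auto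

lemma zpoly_deriv_zero [simp]: "zpoly_deriv 0 = 0"
  by (simp add: zpoly_deriv_def)

lemma zpoly_deriv_one [simp]: "zpoly_deriv 1 = 0"
  unfolding single_one[symmetric] by (rule zpoly_deriv_const)

lemma zderiv_to_fract: "zderiv (to_fract P) = zpoly_deriv P"
  by (simp add: to_fract_def zderiv_Fract One_fract_def[symmetric])

lemma zderiv_zconst [simp]: "zderiv (zconst c) = 0"
  by (simp add: zconst_def zderiv_to_fract)

lemma zderiv_zero [simp]: "zderiv 0 = 0"
  using zderiv_to_fract[of 0] by simp

lemma zderiv_one [simp]: "zderiv 1 = 0"
  using zderiv_to_fract[of 1] by simp

lemma zderiv_zvar: "zderiv (zvar i) = inverse (\<Prod>j<i. zvar j)"
  unfolding zvar_def[of i] zmonom_def zderiv_to_fract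
  by (subst zpoly_deriv_superset[of "{i}"]) (auto simp: partial_zpoly_single)

definition laurent_deriv :: "'k::field zfield fls \<Rightarrow> 'k zfield fls" where
  "laurent_deriv f = fls_deriv f + fls_X_inv * Abs_fls (\<lambda>n. zderiv (fls_nth f n))"

definition log_deriv :: "'k::field logring \<Rightarrow> 'k logring" where
  "log_deriv = Poly_Mapping.mapp
     (\<lambda>\<rho> f. laurent_deriv f + fls_const (zconst \<rho>) * fls_X_inv * f)"

lemma laurent_deriv_nth:
  "fls_nth (laurent_deriv f) n = of_int (n + 1) * fls_nth f (n + 1) + zderiv (fls_nth f (n + 1))"
proof -
  obtain N where "\<forall>n<N. fls_nth f n = 0"
    by (rule fls_nth_vanishes_belowE)
  then have "fls_nth (Abs_fls (\<lambda>n. zderiv (fls_nth f n))) m = zderiv (fls_nth f m)" for m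
    by (intro nth_Abs_fls_ex_lower_bound exI[of _ N]) simp
  then show ?thesis
    by (simp add: laurent_deriv_def fls_X_inv_times_conv_shift)
qed

lemma lookup_log_deriv:
  "Poly_Mapping.lookup (log_deriv y) \<rho> = laurent_deriv (Poly_Mapping.lookup y \<rho>) +
     fls_const (zconst \<rho>) * fls_X_inv * Poly_Mapping.lookup y \<rho>"
proof -
  have "laurent_deriv 0 = (0 :: 'a zfield fls)"
    by (rule fls_eqI) (simp add: laurent_deriv_nth)
  then show ?thesis
    by (auto simp: log_deriv_def lookup_mapp when_def in_keys_iff)
qed

lemma log_deriv_single:
  "log_deriv (Poly_Mapping.single \<rho> f) =
     Poly_Mapping.single \<rho> (laurent_deriv f + fls_const (zconst \<rho>) * fls_X_inv * f)"
proof -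
  have "laurent_deriv 0 = (0 :: 'a zfield fls)"
    by (rule fls_eqI) (simp add: laurent_deriv_nth)
  then show ?thesis
    by (intro poly_mapping_eqI) (auto simp: lookup_log_deriv lookup_single when_def)
qed

lemma zconst_zero [simp]: "zconst 0 = 0"
  by (simp add: zconst_def)

lemma laurent_deriv_const: "laurent_deriv (fls_const c) = fls_const (zderiv c) * fls_X_inv"
proof (rule fls_eqI)
  fix n :: int
  show "fls_nth (laurent_deriv (fls_const c)) n = fls_nth (fls_const (zderiv c) * fls_X_inv) n"
    by (cases "n = -1") (simp_all add: laurent_deriv_nth fls_X_inv_times_conv_shift mult.commute[of _ fls_X_inv])
qed

lemma log_deriv_x: "log_deriv (Poly_Mapping.single 0 fls_X) = 1"
proof -
  have "laurent_deriv fls_X = (1 :: 'a zfield fls)"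
    by (rule fls_eqI) (auto simp: laurent_deriv_nth)
  then show ?thesis
    by (simp add: log_deriv_single single_one)
qed

lemma log_deriv_t:
  "log_deriv (Poly_Mapping.single \<rho> 1) = Poly_Mapping.single \<rho> (fls_const (zconst \<rho>) * fls_X_inv)"
  using laurent_deriv_const[of "1 :: 'a zfield"] by (simp add: log_deriv_single)

lemma log_deriv_z:
  "log_deriv (Poly_Mapping.single 0 (fls_const (zvar i))) =
     Poly_Mapping.single 0 (fls_const (inverse (\<Prod>j<i. zvar j)) * fls_X_inv)"
  by (simp add: log_deriv_single laurent_deriv_const zderiv_zvar)

section \<open>The field of constants\<close>

definition zfield_p :: "'k::field zfield set" where
  "zfield_p = {Fract a b | a b. b \<noteq> 0 \<and>
     (\<forall>\<alpha>\<in>Poly_Mapping.keys a \<union> Poly_Mapping.keys b. \<forall>i. CHAR('k) dvd Poly_Mapping.lookup \<alpha> i)}"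

definition laurent_p :: "'k::field zfield fls set" where
  "laurent_p = {f. \<forall>n. fls_nth f n \<in> zfield_p \<and>
     (fls_nth f n \<noteq> 0 \<longrightarrow> int CHAR('k) dvd n)}"

definition constants :: "'k::field logring set" where
  "constants = {y. \<forall>\<rho>\<in>Poly_Mapping.keys y. \<exists>\<sigma><CHAR('k). \<rho> = of_nat \<sigma> \<and>
     (\<exists>g\<in>laurent_p. Poly_Mapping.lookup y \<rho> = fls_X ^ (CHAR('k) - \<sigma>) * g)}"

section \<open>Differential operators\<close>

text \<open>
  The polynomial with coefficients \<open>a\<^sub>j\<close> encodes the operator \<open>\<Sum>j. a\<^sub>j \<partial>\<^sup>j\<close>,
  coefficients on the left; the commutative product of polynomials plays no role, and the
  order of a nonzero operator is the degree.
\<close>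

type_synonym 'k diffop = "'k fps poly"

definition op_coeff :: "'k::field diffop \<Rightarrow> nat \<Rightarrow> nat \<Rightarrow> 'k" where
  "op_coeff L i j = fps_nth (Polynomial.coeff L j) i"

definition emb_series :: "'k::field fps \<Rightarrow> 'k logring" where
  "emb_series a = Poly_Mapping.single 0 (fps_to_fls (Abs_fps (\<lambda>i. zconst (fps_nth a i))))"

definition apply_op :: "'k::field diffop \<Rightarrow> 'k logring \<Rightarrow> 'k logring" where
  "apply_op L y = (\<Sum>j\<le>Polynomial.degree L. emb_series (Polynomial.coeff L j) * (log_deriv ^^ j) y)"

definition solutions :: "'k::field diffop \<Rightarrow> 'k logring set" where
  "solutions L = {y. apply_op L y = 0}"

definition has_shift :: "'k::field diffop \<Rightarrow> int \<Rightarrow> bool" where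
  "has_shift L s \<longleftrightarrow> (\<exists>i j. op_coeff L i j \<noteq> 0 \<and> int i - int j = s) \<and>
     (\<forall>i j. op_coeff L i j \<noteq> 0 \<longrightarrow> s \<le> int i - int j)"

text \<open>The following notions are those for operators of shift 0.\<close>

definition initial_form :: "'k::field diffop \<Rightarrow> 'k diffop" where
  "initial_form L = (\<Sum>i\<le>Polynomial.degree L.
     Polynomial.monom (fps_const (op_coeff L i i) * fps_X ^ i) i)"

definition regular_singular :: "'k::field diffop \<Rightarrow> bool" where
  "regular_singular L \<longleftrightarrow> Polynomial.degree (initial_form L) = Polynomial.degree L"

definition indicial_poly :: "'k::field diffop \<Rightarrow> 'k poly" where
  "indicial_poly L = (\<Sum>i\<le>Polynomial.degree L.
     Polynomial.smult (op_coeff L i i) (\<Prod>j<i. [:- of_nat j, 1:]))"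

definition local_exponents :: "'k::field diffop \<Rightarrow> 'k set" where
  "local_exponents L = {\<rho>. poly (indicial_poly L) \<rho> = 0}"

definition exp_mult :: "'k::field diffop \<Rightarrow> 'k \<Rightarrow> nat" where
  "exp_mult L \<sigma> = Polynomial.order \<sigma> (indicial_poly L)"

section \<open>Function spaces and the automorphism u\<close>

definition exp_count :: "'k::field diffop \<Rightarrow> 'k \<Rightarrow> nat \<Rightarrow> nat" where
  "exp_count L \<rho> k = (\<Sum>i\<le>k. exp_mult L (\<rho> + of_nat i))"

definition exponent_set :: "'k::field diffop \<Rightarrow> 'k \<Rightarrow> nat \<Rightarrow> (nat \<Rightarrow>\<^sub>0 nat) set" where
  "exponent_set L \<rho> k = {\<alpha>. Poly_Mapping.lookup \<alpha> 0 < exp_count L \<rho> k \<and>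
     (\<forall>j. CHAR('k) * Poly_Mapping.lookup \<alpha> (Suc j) \<le> Poly_Mapping.lookup \<alpha> j)}"

definition digit_value :: "nat \<Rightarrow> (nat \<Rightarrow>\<^sub>0 nat) \<Rightarrow> nat" where
  "digit_value p \<alpha> = (\<Sum>i\<in>Poly_Mapping.keys \<alpha>. (Poly_Mapping.lookup \<alpha> i mod p) * p ^ i)"

text \<open>
  All formal sums of scalar multiples of monomials in t, x, z in which the exponent of t is
  \<open>\<rho>\<close> and the exponent of z belongs to \<open>A k\<close> if the exponent of x is k. For finite \<open>A k\<close>
  this is the closed subspace, in the x-adic topology, spanned by these monomials.
\<close>

definition formal_sums :: "'k::field \<Rightarrow> (nat \<Rightarrow> (nat \<Rightarrow>\<^sub>0 nat) set) \<Rightarrow> 'k logring set" where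
  "formal_sums \<rho> A = {Poly_Mapping.single \<rho> (fps_to_fls f) | f.
     \<forall>k. \<exists>P. Poly_Mapping.keys P \<subseteq> A k \<and> fps_nth f k = to_fract P}"

definition function_space :: "'k::field diffop \<Rightarrow> 'k \<Rightarrow> 'k logring set" where
  "function_space L \<rho> = formal_sums \<rho> (exponent_set L \<rho>)"

definition complement_space :: "'k::field diffop \<Rightarrow> 'k \<Rightarrow> 'k logring set" where
  "complement_space L \<rho> = formal_sums \<rho>
     (\<lambda>k. {\<alpha>\<in>exponent_set L \<rho> k. exp_mult L (\<rho> + of_nat k) \<le> digit_value CHAR('k) \<alpha>})"

definition S_map :: "'k::field diffop \<Rightarrow> 'k \<Rightarrow> 'k logring \<Rightarrow> 'k logring" where
  "S_map L \<rho> = inv_into (complement_space L \<rho>) (apply_op (initial_form L))"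

definition T_map :: "'k::field diffop \<Rightarrow> 'k logring \<Rightarrow> 'k logring" where
  "T_map L f = apply_op (initial_form L) f - apply_op L f"

definition u_map :: "'k::field diffop \<Rightarrow> 'k \<Rightarrow> 'k logring \<Rightarrow> 'k logring" where
  "u_map L \<rho> f = f - S_map L \<rho> (T_map L f)"

definition star_exponent :: "nat \<Rightarrow> nat \<Rightarrow> (nat \<Rightarrow>\<^sub>0 nat)" where
  "star_exponent p i = Abs_poly_mapping (\<lambda>j. i div p ^ j)"

lemma lookup_star_exponent:
  assumes "p > 1"
  shows "Poly_Mapping.lookup (star_exponent p i) j = i div p ^ j"
proof -
  have "j \<le> i" if "i div p ^ j \<noteq> 0" for j
  proof (rule ccontr)
    assume "\<not> j \<le> i"
    have "j < p ^ j"
      using assms by (intro power_gt_expt) simp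
    with \<open>\<not> j \<le> i\<close> that show False
      by simp
  qed
  then have "{j. i div p ^ j \<noteq> 0} \<subseteq> {..i}"
    by blast
  then have "finite {j. i div p ^ j \<noteq> 0}"
    by (rule finite_subset) simp
  then show ?thesis
    by (simp add: star_exponent_def)
qed

definition basis_solution :: "'k::field diffop \<Rightarrow> 'k \<Rightarrow> nat \<Rightarrow> 'k logring" where
  "basis_solution L \<rho> i = inv_into (function_space L \<rho>) (u_map L \<rho>)
     (Poly_Mapping.single \<rho> (fls_const (zmonom (star_exponent CHAR('k) i))))"

section \<open>Bases of subspaces of a ring over a subfield\<close>

definition basis_family ::
  "('a, 'b) ring_scheme \<Rightarrow> 'a set \<Rightarrow> 'i set \<Rightarrow> ('i \<Rightarrow> 'a) \<Rightarrow> 'a set \<Rightarrow> bool" where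
  "basis_family R K I y E \<longleftrightarrow> (\<exists>ps. distinct ps \<and> set ps = I \<and>
     ring.independent R K (map y ps) \<and> ring.Span R K (map y ps) = E)"

end

theory Submission
  imports Defs
begin

text \<open>
  On the coefficient of a monomial in t and x, the operator x d/dx acts as \<open>c + \<delta>\<close>,
  where c is the sum of the two exponents and \<open>\<delta>\<close> is \<open>zderiv\<close>. On the field of rational
  functions in z, the derivation \<open>\<delta>\<close> is a single infinite Jordan block over its field of
  constants: the monomials with exponents \<open>i\<^sup>*\<close> form a basis, and \<open>\<delta>\<close> is triangular in
  it because it lowers the digit value by one up to terms of smaller digit value. Hence the
  kernel of the indicial polynomial in \<open>c + \<delta>\<close> is spanned by the first m of these monomials,
  where m is the multiplicity of c as a local exponent.

  A constant of R is a series in monomials \<open>t\<^sup>\<tau> x\<^sup>N\<close> with \<open>\<tau> = - N\<close> in the ground field.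
  The lowest term of a solution with exponent \<open>\<tau>\<close> of t, of order N in x, is therefore a unique
  combination of the initial terms \<open>t\<^sup>\<rho> z\<^sup>i\<^sup>*\<close> with \<open>\<rho> = \<tau> + N\<close>, and subtracting
  constant multiples of the basis solutions raises the order. Successive approximation shows
  that they generate, and comparison of lowest terms that they are independent.
\<close>

text \<open>The p-th power of a logarithm is a constant, so the powers of one logarithm yield a
  Jordan block of size p only. But the values c = \<rho> + k in the ground field recur every p
  orders, so resonances can keep raising the nilpotency degree needed. Each further variable
  continues the block where the previous ones end: with indices from 0, \<delta> sends z_0^p z_1 to
  z_0^(p-1). The price is denominators, since \<delta> z_j is the inverse of z_0 ... z_(j-1). The
  divisibility chain in \<open>exponent_set\<close> cancels them, so the solutions can be
  constructed with polynomials in z, whereas kernels have to be known in the whole rational function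
  field. Digit values link the two: z^\<alpha> is a constant times the monomial with exponent
  \<open>star_exponent p (digit_value p \<alpha>)\<close>, so the digit value is its position in the
  block, and every fraction can be given a p-th power as denominator. As \<delta> is locally
  nilpotent, a factor of the indicial polynomial that does not vanish at c acts injectively through
  c + \<delta>; only the multiplicity of c is left.\<close>

abbreviation lookup where "lookup \<equiv> Poly_Mapping.lookup"
abbreviation single where "single \<equiv> Poly_Mapping.single"
abbreviation keys where "keys \<equiv> Poly_Mapping.keys"

section \<open>Derivations\<close>

locale derivation =
  fixes D :: "'a::comm_ring_1 \<Rightarrow> 'a"
  assumes add: "D (x + y) = D x + D y"
    and mult: "D (x * y) = D x * y + x * D y"
begin

lemma zero [simp]: "D 0 = 0"
  using add[of 0 0] by simp

lemma one [simp]: "D 1 = 0"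
  using mult[of 1 1] by simp

lemma uminus: "D (- x) = - D x"
  using add[of x "- x"] by (simp add: eq_neg_iff_add_eq_0 add.commute)

lemma sum: "D (sum f A) = (\<Sum>i\<in>A. D (f i))"
  by (induction A rule: infinite_finite_induct) (auto simp: add)

lemma mult_const: "D a = 0 \<Longrightarrow> D (a * x) = a * D x"
  by (simp add: mult)

lemma funpow_zero [simp]: "(D ^^ n) 0 = 0"
  by (induction n) auto

lemma funpow_plus: "(D ^^ n) (x + y) = (D ^^ n) x + (D ^^ n) y"
  by (induction n) (auto simp: add)

lemma funpow_mult_const: "D a = 0 \<Longrightarrow> (D ^^ n) (a * x) = a * (D ^^ n) x"
  by (induction n) (auto simp: mult_const)

lemma funpow_sum: "(D ^^ n) (sum f A) = (\<Sum>i\<in>A. (D ^^ n) (f i))"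
  by (induction A rule: infinite_finite_induct) (auto simp: funpow_plus)

text \<open>The inverse is given by an equation because this must also serve the group algebra,
  which is not a field: t - 1 is nilpotent there.\<close>

lemma inverse_const:
  assumes "D a = 0" "a * b = 1"
  shows "D b = 0"
proof -
  have "a * D b = 0"
    using mult[of a b] assms by simp
  then have "b * a * D b = 0"
    by (simp add: mult.assoc)
  then show ?thesis
    using assms by (simp add: mult.commute)
qed

lemma char_power:
  assumes "CHAR('a) = p" "p > 0"
  shows "D (x ^ p) = 0"
proof -
  have "D (x ^ n) = of_nat n * x ^ (n - 1) * D x" for n
  proof (induction n)
    case (Suc n)
    then show ?case
      by (cases n) (auto simp: mult algebra_simps)
  qed simp
  from this[of p] show ?thesis
    using assms of_nat_CHAR[where 'a = 'a] by simp
qed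

end

text \<open>A Jordan block over the field of constants without its matrix: \<open>v i\<close> is
  killed by the power i + 1 of D but not by the power i, which is all that comparison of leading
  coefficients requires.\<close>

locale triangular_family = derivation D for D :: "'a::field \<Rightarrow> 'a" +
  fixes v c :: "nat \<Rightarrow> 'a"
  assumes c_nonzero: "c i \<noteq> 0"
    and D_c: "D (c i) = 0"
    and funpow_v: "(D ^^ i) (v i) = c i"
begin

lemma funpow_v_eq_0:
  assumes "i < n"
  shows "(D ^^ n) (v i) = 0"
proof -
  have "(D ^^ Suc i) (v i) = 0"
    by (simp add: funpow_v D_c)
  then have "((D ^^ (n - Suc i)) \<circ> (D ^^ Suc i)) (v i) = 0"
    by (simp only: comp_def funpow_zero)
  then show ?thesis
    using assms by (simp only: funpow_add[symmetric]) simp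
qed

text \<open>If q is the largest index with nonzero coefficient and m \<le> q, then D^q kills every
  \<open>v l\<close> with l < q and leaves \<open>a q * c q\<close>, although D^q factors through
  D^m. The case m = 0 is linear independence over the constants, general m bounds the kernel of
  D^m.\<close>

lemma coeff_eq_0:
  assumes const: "\<And>l. l < N \<Longrightarrow> D (a l) = 0"
    and ker: "(D ^^ m) (\<Sum>l<N. a l * v l) = 0"
    and "m \<le> l" "l < N"
  shows "a l = 0"
proof (rule ccontr)
  assume "a l \<noteq> 0"
  define q where "q = Max {l. l < N \<and> a l \<noteq> 0}"
  have q: "q \<in> {l. l < N \<and> a l \<noteq> 0}"
    unfolding q_def by (rule Max_in) (use \<open>l < N\<close> \<open>a l \<noteq> 0\<close> in auto)
  have max: "l' \<le> q" if "l' < N" "a l' \<noteq> 0" for l'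
    unfolding q_def by (rule Max_ge) (use that in auto)
  have "(D ^^ (q - m + m)) (\<Sum>l<N. a l * v l) = 0"
    using ker by (simp add: funpow_add)
  then have "0 = (D ^^ q) (\<Sum>l<N. a l * v l)"
    using max[OF \<open>l < N\<close> \<open>a l \<noteq> 0\<close>] \<open>m \<le> l\<close> by simp
  also have "\<dots> = (\<Sum>l<N. a l * (D ^^ q) (v l))"
    by (simp add: funpow_sum funpow_mult_const const)
  also have "\<dots> = (\<Sum>l\<in>{q}. a l * (D ^^ q) (v l))"
  proof (rule sum.mono_neutral_right)
    show "\<forall>i\<in>{..<N} - {q}. a i * (D ^^ q) (v i) = 0"
    proof
      fix i assume "i \<in> {..<N} - {q}"
      then show "a i * (D ^^ q) (v i) = 0"
        using max[of i] funpow_v_eq_0[of i q] by (cases "a i = 0") auto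
    qed
  qed (use q in auto)
  also have "\<dots> \<noteq> 0"
    using q c_nonzero by (simp add: funpow_v)
  finally show False
    by simp
qed

end

section \<open>The derivation of the rational function field\<close>

lemma zpoly_deriv_add: "zpoly_deriv (P + Q) = zpoly_deriv P + zpoly_deriv Q"
proof -
  define A where "A = (\<Union>\<alpha>\<in>keys P \<union> keys Q \<union> keys (P + Q). keys \<alpha>)"
  have A: "finite A" "(\<Union>\<alpha>\<in>keys P. keys \<alpha>) \<subseteq> A"
    "(\<Union>\<alpha>\<in>keys Q. keys \<alpha>) \<subseteq> A" "(\<Union>\<alpha>\<in>keys (P + Q). keys \<alpha>) \<subseteq> A"
    by (auto simp: A_def)
  show ?thesis
    unfolding A(2)[THEN zpoly_deriv_superset[OF A(1)]] A(3)[THEN zpoly_deriv_superset[OF A(1)]]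
      A(4)[THEN zpoly_deriv_superset[OF A(1)]]
    by (simp add: partial_zpoly_add algebra_simps sum.distrib)
qed

text \<open>The quotient rule cleared of denominators, so that the sum and product rules become
  identities over a common denominator.\<close>

lemma zderiv_eqI:
  assumes "b \<noteq> 0" "f * to_fract b = to_fract a"
  shows "zderiv f * to_fract b = zpoly_deriv a - f * zpoly_deriv b"
proof -
  have "f = Fract a b"
    using assms by (simp add: Fract_conv_to_fract field_simps)
  with assms show ?thesis
    by (simp add: zderiv_Fract assms(2)[symmetric] field_simps power2_eq_square)
qed

interpretation zderiv: derivation "zderiv :: 'k::field zfield \<Rightarrow> _"
proof
  fix f g :: "'k zfield"
  obtain a b where f: "b \<noteq> 0" "f * to_fract b = to_fract a"
    by (cases f) (auto simp: Fract_conv_to_fract)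
  obtain c d where g: "d \<noteq> 0" "g * to_fract d = to_fract c"
    by (cases g) (auto simp: Fract_conv_to_fract)
  note df = zderiv_eqI[OF f] and dg = zderiv_eqI[OF g]
  have nz: "b * d \<noteq> 0"
    using f g by simp
  have "(f + g) * to_fract (b * d) = to_fract (a * d + c * b)"
    using f(2)[symmetric] g(2)[symmetric] by (simp add: algebra_simps)
  from zderiv_eqI[OF nz this]
  have "zderiv (f + g) * (to_fract b * to_fract d) =
      (zpoly_deriv a - f * zpoly_deriv b) * to_fract d +
      (zpoly_deriv c - g * zpoly_deriv d) * to_fract b"
    by (simp add: zpoly_deriv_add zpoly_deriv_mult f(2)[symmetric] g(2)[symmetric] algebra_simps)
  also have "\<dots> = (zderiv f + zderiv g) * (to_fract b * to_fract d)"
    unfolding df[symmetric] dg[symmetric] by (simp add: algebra_simps)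
  finally show "zderiv (f + g) = zderiv f + zderiv g"
    using f(1) g(1) by simp
  have "(f * g) * to_fract (b * d) = to_fract (a * c)"
    using f(2)[symmetric] g(2)[symmetric] by (simp add: algebra_simps)
  from zderiv_eqI[OF nz this]
  have "zderiv (f * g) * (to_fract b * to_fract d) =
      (zpoly_deriv a - f * zpoly_deriv b) * g * to_fract d +
      (zpoly_deriv c - g * zpoly_deriv d) * f * to_fract b"
    by (simp add: zpoly_deriv_add zpoly_deriv_mult f(2)[symmetric] g(2)[symmetric] algebra_simps)
  also have "\<dots> = (zderiv f * g + f * zderiv g) * (to_fract b * to_fract d)"
    unfolding df[symmetric] dg[symmetric] by (simp add: algebra_simps)
  finally show "zderiv (f * g) = zderiv f * g + f * zderiv g"
    using f(1) g(1) by simp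
qed

lemma zconst_add: "zconst (a + b) = zconst a + zconst b"
  by (simp add: zconst_def single_add)

lemma zconst_mult: "zconst (a * b) = zconst a * zconst b"
  by (simp add: zconst_def mult_single flip: to_fract_mult)

lemma zconst_one [simp]: "zconst 1 = 1"
  by (simp add: zconst_def)

lemma zconst_uminus: "zconst (- a) = - zconst a"
  by (simp add: zconst_def single_uminus flip: to_fract_uminus)

lemma zconst_of_nat [simp]: "zconst (of_nat n) = of_nat n"
  by (induction n) (simp_all add: zconst_add)

lemma zconst_of_int [simp]: "zconst (of_int n) = of_int n"
  by (cases n rule: int_cases2) (simp_all add: zconst_uminus)

lemma zconst_eq_0_iff [simp]: "zconst a = 0 \<longleftrightarrow> a = 0"
  by (metis lookup_single_eq lookup_zero to_fract_eq_0_iff zconst_def zconst_zero)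

lemma zmonom_add: "zmonom (\<alpha> + \<beta>) = zmonom \<alpha> * zmonom \<beta>"
  by (simp add: zmonom_def mult_single flip: to_fract_mult)

lemma zmonom_0 [simp]: "zmonom 0 = 1"
  by (simp add: zmonom_def)

lemma zmonom_nonzero [simp]: "zmonom \<alpha> \<noteq> 0"
  by (metis zmonom_def lookup_single_eq lookup_zero to_fract_eq_0_iff zero_neq_one)

lemma zmonom_sum: "zmonom (sum f A) = (\<Prod>i\<in>A. zmonom (f i))"
  by (induction A rule: infinite_finite_induct) (auto simp: zmonom_add)

lemma zconst_times_zmonom: "zconst c * zmonom \<alpha> = to_fract (single \<alpha> c)"
  by (simp add: zconst_def zmonom_def mult_single flip: to_fract_mult)

lemma poly_mapping_sum_single:
  "(y :: 'b \<Rightarrow>\<^sub>0 'c::comm_monoid_add) = (\<Sum>\<rho>\<in>keys y. single \<rho> (lookup y \<rho>))"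
  by (rule poly_mapping_eqI) (auto simp: lookup_sum lookup_single when_def in_keys_iff)

lemma to_fract_zpoly: "to_fract P = (\<Sum>\<alpha>\<in>keys P. zconst (lookup P \<alpha>) * zmonom \<alpha>)"
  by (subst poly_mapping_sum_single) (simp add: zconst_times_zmonom)

lemma zderiv_zmonom:
  "zderiv (zmonom \<alpha>) = (\<Sum>j\<in>keys \<alpha>.
     of_nat (lookup \<alpha> j) * zmonom (\<alpha> - single j 1) * inverse (\<Prod>l<j. zvar l))"
proof -
  have "zderiv (zmonom \<alpha>) =
      (\<Sum>j\<in>keys \<alpha>. to_fract (partial_zpoly j (single \<alpha> 1)) * inverse (\<Prod>l<j. zvar l))"
    unfolding zmonom_def zderiv_to_fract by (rule zpoly_deriv_superset) auto
  then show ?thesis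
    by (simp add: partial_zpoly_single flip: zconst_times_zmonom)
qed

section \<open>Digits\<close>

text \<open>The exponent of z_0 ... z_j. Differentiating by variable j and multiplying by \<delta>
  z_j together divide a monomial by exactly this product.\<close>

definition ones :: "nat \<Rightarrow> nat \<Rightarrow>\<^sub>0 nat" where
  "ones j = (\<Sum>l\<le>j. single l 1)"

lemma lookup_ones: "lookup (ones j) l = (if l \<le> j then 1 else 0)"
  by (auto simp: ones_def lookup_sum lookup_single when_def)

text \<open>This is \<open>exponent_set\<close> with the count of local exponents replaced by a free
  bound, which \<delta> lowers and the inversion of the indicial operator raises.\<close>

definition div_chains :: "nat \<Rightarrow> nat \<Rightarrow> (nat \<Rightarrow>\<^sub>0 nat) set" where
  "div_chains p n = {\<alpha>. lookup \<alpha> 0 < n \<and> (\<forall>j. p * lookup \<alpha> (Suc j) \<le> lookup \<alpha> j)}"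

lemma digit_value_superset:
  assumes "keys \<alpha> \<subseteq> {..<M}"
  shows "digit_value p \<alpha> = (\<Sum>i<M. (lookup \<alpha> i mod p) * p ^ i)"
  unfolding digit_value_def
  by (rule sum.mono_neutral_left) (use assms in \<open>auto simp: in_keys_iff\<close>)

lemma obtain_bound:
  fixes \<alpha> :: "nat \<Rightarrow>\<^sub>0 nat"
  obtains M where "keys \<alpha> \<subseteq> {..<M}"
  using finite_nat_iff_bounded[of "keys \<alpha>"] by auto

lemma digit_sum_less:
  fixes p :: nat
  assumes "p > 0"
  shows "(\<Sum>i<n. (f i mod p) * p ^ i) < p ^ n"
proof (induction n)
  case (Suc n)
  have "f n mod p + 1 \<le> p"
    using assms by (simp add: Suc_leI)
  then have "(f n mod p + 1) * p ^ n \<le> p * p ^ n"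
    by (rule mult_right_mono) simp
  with Suc show ?case
    by simp
qed simp

lemma digit_sum_digit:
  fixes p :: nat
  assumes "p > 0" "j < n"
  shows "(\<Sum>i<n. (f i mod p) * p ^ i) div p ^ j mod p = f j mod p"
  using assms(2)
proof (induction n)
  case (Suc n)
  show ?case
  proof (cases "j = n")
    case True
    then show ?thesis
      using assms digit_sum_less[of p f n] by simp
  next
    case False
    then have "j < n"
      using Suc.prems by simp
    then obtain k where n: "n = j + Suc k"
      using less_imp_Suc_add by auto
    have "p ^ n = p ^ j * (p * p ^ k)"
      unfolding n by (simp add: power_add)
    then have "(\<Sum>i<Suc n. (f i mod p) * p ^ i) =
        (\<Sum>i<n. (f i mod p) * p ^ i) + p ^ j * (p * (f n mod p * p ^ k))"
      by (simp add: mult.left_commute)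
    then have "(\<Sum>i<Suc n. (f i mod p) * p ^ i) div p ^ j =
        (\<Sum>i<n. (f i mod p) * p ^ i) div p ^ j + p * (f n mod p * p ^ k)"
      using assms(1) by (simp only:) (simp add: div_mult_self2)
    then show ?thesis
      using Suc.IH[OF \<open>j < n\<close>] by simp
  qed
qed simp

text \<open>One number determines all residues: monomials of equal digit value have exponents
  congruent mod p, and digit value 0 means that p divides every exponent.\<close>

lemma digit_value_digit:
  assumes "p > 0"
  shows "digit_value p \<alpha> div p ^ j mod p = lookup \<alpha> j mod p"
proof -
  obtain M where M: "keys \<alpha> \<subseteq> {..<M}"
    by (rule obtain_bound)
  have "keys \<alpha> \<subseteq> {..<max M (Suc j)}"
    using M by auto
  from digit_value_superset[OF this] show ?thesis
    using digit_sum_digit[OF assms, of j "max M (Suc j)"] by simp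
qed

text \<open>Base p numbers compare lexicographically from the top: one unit at place j outweighs all
  places below j.\<close>

lemma digit_value_less:
  assumes "p > 0" and above: "\<And>l. l > j \<Longrightarrow> lookup \<alpha> l mod p = lookup \<beta> l mod p"
    and at: "lookup \<alpha> j mod p < lookup \<beta> j mod p"
  shows "digit_value p \<alpha> < digit_value p \<beta>"
proof -
  obtain M where M: "keys \<alpha> \<subseteq> {..<M}"
    by (rule obtain_bound)
  obtain M' where M': "keys \<beta> \<subseteq> {..<M'}"
    by (rule obtain_bound)
  define N where "N = max M M' + Suc j"
  have val: "digit_value p \<gamma> = (\<Sum>i<j. (lookup \<gamma> i mod p) * p ^ i) +
      (lookup \<gamma> j mod p) * p ^ j + (\<Sum>i\<in>{Suc j..<N}. (lookup \<gamma> i mod p) * p ^ i)"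
    if "keys \<gamma> \<subseteq> {..<max M M'}" for \<gamma>
  proof -
    have "digit_value p \<gamma> = (\<Sum>i<N. (lookup \<gamma> i mod p) * p ^ i)"
      by (rule digit_value_superset) (use that in \<open>auto simp: N_def\<close>)
    also have "\<dots> = (\<Sum>i<Suc j. (lookup \<gamma> i mod p) * p ^ i) +
        (\<Sum>i\<in>{Suc j..<N}. (lookup \<gamma> i mod p) * p ^ i)"
      unfolding lessThan_atLeast0 by (rule sum.atLeastLessThan_concat[symmetric]) (auto simp: N_def)
    finally show ?thesis
      by simp
  qed
  have "(\<Sum>i<j. (lookup \<alpha> i mod p) * p ^ i) + (lookup \<alpha> j mod p) * p ^ j <
      (1 + lookup \<alpha> j mod p) * p ^ j"
    using digit_sum_less[OF assms(1), of "lookup \<alpha>" j] by simp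
  also have "\<dots> \<le> (lookup \<beta> j mod p) * p ^ j"
    by (rule mult_right_mono) (use at in auto)
  also have "\<dots> \<le> (\<Sum>i<j. (lookup \<beta> i mod p) * p ^ i) + (lookup \<beta> j mod p) * p ^ j"
    by simp
  finally have "(\<Sum>i<j. (lookup \<alpha> i mod p) * p ^ i) + (lookup \<alpha> j mod p) * p ^ j < \<dots>" .
  moreover have "(\<Sum>i\<in>{Suc j..<N}. (lookup \<alpha> i mod p) * p ^ i) =
      (\<Sum>i\<in>{Suc j..<N}. (lookup \<beta> i mod p) * p ^ i)"
    by (rule sum.cong) (auto simp: above)
  ultimately show ?thesis
    using M M' by (simp add: val subset_iff less_max_iff_disj)
qed

section \<open>Increment of the digit value\<close>

definition carry :: "nat \<Rightarrow> (nat \<Rightarrow>\<^sub>0 nat) \<Rightarrow> nat" where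
  "carry p \<beta> = (LEAST i. lookup \<beta> i mod p \<noteq> p - 1)"

text \<open>Raising every entry up to the carry position has the effect of a base p increment on the
  residues: digits p - 1 become 0 and the next one grows. It also makes \<beta> reappear in the
  derivative, as the term of \<delta> at the carry position removes the same
  \<open>ones\<close>.\<close>

definition succ_exponent :: "nat \<Rightarrow> (nat \<Rightarrow>\<^sub>0 nat) \<Rightarrow> (nat \<Rightarrow>\<^sub>0 nat)" where
  "succ_exponent p \<beta> = \<beta> + ones (carry p \<beta>)"

lemma lookup_succ_exponent:
  "lookup (succ_exponent p \<beta>) l = lookup \<beta> l + (if l \<le> carry p \<beta> then 1 else 0)"
  by (simp add: succ_exponent_def lookup_add lookup_ones)

lemma carry:
  assumes "p > 1"
  shows "lookup \<beta> (carry p \<beta>) mod p \<noteq> p - 1"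
    and "l < carry p \<beta> \<Longrightarrow> lookup \<beta> l mod p = p - 1"
proof -
  obtain M where "keys \<beta> \<subseteq> {..<M}"
    by (rule obtain_bound)
  then have "M \<notin> keys \<beta>"
    by auto
  then have "lookup \<beta> M mod p \<noteq> p - 1"
    using assms by (simp add: in_keys_iff)
  then show "lookup \<beta> (carry p \<beta>) mod p \<noteq> p - 1"
    unfolding carry_def by (rule LeastI)
  show "lookup \<beta> l mod p = p - 1" if "l < carry p \<beta>"
    using not_less_Least[of l "\<lambda>i. lookup \<beta> i mod p \<noteq> p - 1"] that
    unfolding carry_def by blast
qed

lemma succ_exponent_mod:
  assumes "p > 1"
  shows "l < carry p \<beta> \<Longrightarrow> lookup (succ_exponent p \<beta>) l mod p = 0"
    and "lookup (succ_exponent p \<beta>) (carry p \<beta>) mod p = lookup \<beta> (carry p \<beta>) mod p + 1"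
    and "l > carry p \<beta> \<Longrightarrow> lookup (succ_exponent p \<beta>) l = lookup \<beta> l"
  using carry(1)[OF assms, of \<beta>] carry(2)[OF assms, where \<beta> = \<beta>] assms
  by (auto simp: lookup_succ_exponent mod_Suc)

text \<open>Before the carry position an entry is -1 mod p, so its successor is a multiple p * q. It
  strictly exceeds p times the next entry, and two multiples of p that differ leave room for one
  more p. At the carry position only the larger side grows.\<close>

lemma succ_exponent_chains:
  assumes p: "p > 1" and b: "\<beta> \<in> div_chains p n"
  shows "succ_exponent p \<beta> \<in> div_chains p (Suc n)"
proof -
  have ch: "p * lookup \<beta> (Suc j) \<le> lookup \<beta> j" for j
    using assms(2) by (simp add: div_chains_def)
  have "p * lookup (succ_exponent p \<beta>) (Suc j) \<le> lookup (succ_exponent p \<beta>) j" for j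
  proof (cases "Suc j \<le> carry p \<beta>")
    case True
    then have "lookup \<beta> j mod p = p - 1"
      using carry(2)[OF p] by simp
    then have eq: "Suc (lookup \<beta> j) mod p = 0"
      using p by (simp add: mod_Suc)
    then obtain q where q: "Suc (lookup \<beta> j) = p * q"
      by auto
    have "p * lookup \<beta> (Suc j) < p * q"
      using ch[of j] q by linarith
    then have "p * Suc (lookup \<beta> (Suc j)) \<le> p * q"
      by (intro mult_le_mono2) simp
    then show ?thesis
      using True q by (simp add: lookup_succ_exponent)
  next
    case False
    then show ?thesis
      using ch[of j] by (simp add: lookup_succ_exponent)
  qed
  then show ?thesis
    using assms by (auto simp: div_chains_def lookup_succ_exponent)
qed

text \<open>The digits p - 1 below the carry position i sum to p^i - 1, one less than the place
  value gained at i.\<close>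

lemma digit_value_succ:
  assumes p: "p > 1"
  shows "digit_value p (succ_exponent p \<beta>) = Suc (digit_value p \<beta>)"
proof -
  let ?i = "carry p \<beta>" and ?s = "succ_exponent p \<beta>"
  obtain M where M: "keys \<beta> \<subseteq> {..<M}"
    by (rule obtain_bound)
  define N where "N = M + Suc ?i"
  have kb: "keys \<beta> \<subseteq> {..<N}"
    using M by (auto simp: N_def)
  have ks: "keys ?s \<subseteq> {..<N}"
  proof
    fix l assume "l \<in> keys ?s"
    then show "l \<in> {..<N}"
      using kb by (cases "l \<le> ?i") (auto simp: in_keys_iff subset_iff N_def lookup_succ_exponent)
  qed
  have split: "(\<Sum>i<N. f i) = (\<Sum>i<?i. f i) + f ?i + (\<Sum>i\<in>{Suc ?i..<N}. f i)" for f :: "nat \<Rightarrow> nat"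
    using sum.atLeastLessThan_concat[of 0 "Suc ?i" N f] by (simp add: N_def lessThan_atLeast0)
  have geo: "Suc (\<Sum>i<k. (p - 1) * p ^ i) = p ^ k" for k
  proof (induction k)
    case (Suc k)
    then have "Suc (\<Sum>i<Suc k. (p - 1) * p ^ i) = p ^ k + (p - 1) * p ^ k"
      by simp
    also have "\<dots> = p ^ Suc k"
      using p by (cases p) auto
    finally show ?case .
  qed simp
  have "digit_value p ?s = (lookup \<beta> ?i mod p + 1) * p ^ ?i +
      (\<Sum>i\<in>{Suc ?i..<N}. (lookup \<beta> i mod p) * p ^ i)"
    unfolding digit_value_superset[OF ks] split
    by (simp add: succ_exponent_mod[OF p])
  moreover have "digit_value p \<beta> = (\<Sum>i<?i. (p - 1) * p ^ i) + (lookup \<beta> ?i mod p) * p ^ ?i +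
      (\<Sum>i\<in>{Suc ?i..<N}. (lookup \<beta> i mod p) * p ^ i)"
    unfolding digit_value_superset[OF kb] split
    by (simp add: carry(2)[OF p])
  ultimately show ?thesis
    using geo[of ?i] by simp
qed

lemma star_exponent_chains:
  assumes "p > 1" "i < n"
  shows "star_exponent p i \<in> div_chains p n"
proof -
  have "p * (i div (p * p ^ j)) \<le> i div p ^ j" for j
    by (metis div_mult2_eq mult.commute times_div_less_eq_dividend)
  then show ?thesis
    using assms by (simp add: div_chains_def lookup_star_exponent)
qed

lemma star_exponent_0: "p > 1 \<Longrightarrow> star_exponent p 0 = 0"
  by (rule poly_mapping_eqI) (simp add: lookup_star_exponent)

lemma digit_value_star:
  assumes "p > 1"
  shows "digit_value p (star_exponent p i) = i"
proof -
  have "(\<Sum>j<M. (i div p ^ j mod p) * p ^ j) = i mod p ^ M" for M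
  proof (induction M)
    case (Suc M)
    have "i mod p ^ Suc M = p ^ M * (i div p ^ M mod p) + i mod p ^ M"
      unfolding power_Suc2 by (rule mod_mult2_eq)
    with Suc show ?case
      by (simp del: power_Suc)
  qed simp
  moreover obtain M where "keys (star_exponent p i) \<subseteq> {..<M}"
    by (rule obtain_bound)
  \<comment> \<open>The bound \<open>max M i\<close> does two things: it covers the support, and its
    power of p exceeds i, so the remainder is i itself.\<close>
  moreover from this have "keys (star_exponent p i) \<subseteq> {..<max M i}"
    by auto
  moreover have "i < p ^ max M i"
    using assms power_gt_expt[of p "max M i"] by simp
  ultimately show ?thesis
    using assms digit_value_superset[of "star_exponent p i" "max M i" p]
    by (simp add: lookup_star_exponent)
qed

text \<open>Passing from i to i + 1 raises the quotient by p^l exactly when p^l divides i + 1, that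
  is, when the l lowest digits of i are all p - 1, and this says that l is at most the carry
  position.\<close>

lemma star_exponent_Suc:
  assumes p: "p > 1"
  shows "star_exponent p (Suc i) = succ_exponent p (star_exponent p i)"
proof -
  let ?c = "carry p (star_exponent p i)"
  have dvd: "p ^ l dvd Suc i \<longleftrightarrow> l \<le> ?c" for l
  proof (induction l)
    case (Suc l)
    show ?case
    proof (cases "l \<le> ?c")
      case True
      then obtain q where q: "Suc i = p ^ l * q"
        using Suc by blast
      have pos: "p ^ l > 0"
        using p by simp
      have qpos: "q > 0"
        using q by (cases q) auto
      have "i div p ^ l = q - 1"
      proof (rule div_nat_eqI)
        show "p ^ l * (q - 1) \<le> i"
        proof -
          have "p ^ l * (q - 1) < p ^ l * q"
            using pos qpos by simp
          then show ?thesis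
            using q by linarith
        qed
        show "i < p ^ l * Suc (q - 1)"
          using q qpos by simp
      qed
      then have *: "lookup (star_exponent p i) l = q - 1"
        using p by (simp add: lookup_star_exponent)
      have "p ^ Suc l dvd Suc i \<longleftrightarrow> p dvd q"
        using q pos by (simp add: mult.commute)
      also have "\<dots> \<longleftrightarrow> (q - 1) mod p = p - 1"
        using qpos p mod_Suc[of "q - 1" p] by (auto simp: dvd_eq_mod_eq_0 split: if_splits)
      also have "\<dots> \<longleftrightarrow> l \<noteq> ?c"
        using carry(1)[OF p, of "star_exponent p i"] carry(2)[OF p, of l "star_exponent p i"] True * by (cases "l = ?c") auto
      finally show ?thesis
        using True by auto
    next
      case False
      then have "\<not> p ^ Suc l dvd Suc i"
        using Suc power_le_dvd[of p "Suc l" "Suc i" l] by auto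
      then show ?thesis
        using False by simp
    qed
  qed simp
  show ?thesis
  proof (rule poly_mapping_eqI)
    fix l
    show "lookup (star_exponent p (Suc i)) l = lookup (succ_exponent p (star_exponent p i)) l"
      using p dvd[of l] by (simp add: lookup_succ_exponent lookup_star_exponent div_Suc dvd_eq_mod_eq_0)
  qed
qed

section \<open>The derivation on spans of monomials\<close>

definition zspan :: "(nat \<Rightarrow>\<^sub>0 nat) set \<Rightarrow> 'k::field zfield set" where
  "zspan A = {to_fract P | P. keys P \<subseteq> A}"

lemma zspan_zero [simp]: "0 \<in> zspan A"
  by (auto simp: zspan_def intro!: exI[of _ 0])

lemma zspan_add: "f \<in> zspan A \<Longrightarrow> g \<in> zspan A \<Longrightarrow> f + g \<in> zspan A"
  unfolding zspan_def using keys_add by (force simp flip: to_fract_add)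

lemma zspan_term: "\<alpha> \<in> A \<Longrightarrow> zconst c * zmonom \<alpha> \<in> zspan A"
  unfolding zspan_def zconst_times_zmonom by force

lemma zspan_sum: "(\<And>i. i \<in> I \<Longrightarrow> f i \<in> zspan A) \<Longrightarrow> sum f I \<in> zspan A"
  by (induction I rule: infinite_finite_induct) (auto intro: zspan_add)

lemma zspan_mono: "f \<in> zspan A \<Longrightarrow> A \<subseteq> B \<Longrightarrow> f \<in> zspan B"
  by (auto simp: zspan_def)

lemma zspanE:
  assumes "f \<in> zspan A"
  obtains S c where "finite S" "S \<subseteq> A" "f = (\<Sum>\<alpha>\<in>S. zconst (c \<alpha>) * zmonom \<alpha>)"
proof -
  obtain P where "f = to_fract P" "keys P \<subseteq> A"
    using assms by (auto simp: zspan_def)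
  with that[of "keys P" "lookup P"] show thesis
    by (simp add: to_fract_zpoly)
qed

lemma zspan_zconst_mult:
  assumes "f \<in> zspan A"
  shows "zconst c * f \<in> zspan A"
proof -
  obtain S d where S: "finite S" "S \<subseteq> A" and f: "f = (\<Sum>\<alpha>\<in>S. zconst (d \<alpha>) * zmonom \<alpha>)"
    using assms by (rule zspanE)
  have "zconst c * f = (\<Sum>\<alpha>\<in>S. zconst (c * d \<alpha>) * zmonom \<alpha>)"
    by (simp add: f sum_distrib_left zconst_mult mult.assoc)
  also have "\<dots> \<in> zspan A"
    using S by (intro zspan_sum zspan_term) auto
  finally show ?thesis .
qed

lemma zspan_uminus: "f \<in> zspan A \<Longrightarrow> - f \<in> zspan A"
  using zspan_zconst_mult[of f A "- 1"] by (simp add: zconst_uminus)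

lemma zspan_diff: "f \<in> zspan A \<Longrightarrow> g \<in> zspan A \<Longrightarrow> f - g \<in> zspan A"
  using zspan_add[of f A "- g"] zspan_uminus[of g A] by simp

text \<open>A double filtration, both of whose bounds \<delta> lowers by one. The digit bound drives
  the inductions, since bound 0 leaves only 0; the bound on the first exponent keeps results inside
  the function space.\<close>

definition chain_span :: "nat \<Rightarrow> nat \<Rightarrow> nat \<Rightarrow> 'k::field zfield set" where
  "chain_span p n q = zspan {\<alpha> \<in> div_chains p n. digit_value p \<alpha> < q}"

lemma chains_mono: "\<alpha> \<in> div_chains p n \<Longrightarrow> n \<le> n' \<Longrightarrow> \<alpha> \<in> div_chains p n'"
  by (auto simp: div_chains_def)

lemma chain_span_mono:
  "f \<in> chain_span p n q \<Longrightarrow> n \<le> n' \<Longrightarrow> q \<le> q' \<Longrightarrow> f \<in> chain_span p n' q'"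
  unfolding chain_span_def by (erule zspan_mono) (auto intro: chains_mono)

lemma chain_span_0 [simp]: "chain_span p n 0 = {0}"
  by (auto simp: chain_span_def zspan_def)

lemma exists_chain_span:
  assumes "f \<in> zspan (div_chains p n)"
  shows "\<exists>q. f \<in> chain_span p n q"
proof -
  obtain P where P: "f = to_fract P" "keys P \<subseteq> div_chains p n"
    using assms by (auto simp: zspan_def)
  have "digit_value p \<alpha> < Suc (Max (digit_value p ` keys P))" if "\<alpha> \<in> keys P" for \<alpha>
    using that by (simp add: le_imp_less_Suc)
  then have "f \<in> chain_span p n (Suc (Max (digit_value p ` keys P)))"
    using P by (auto simp: chain_span_def zspan_def)
  then show ?thesis ..
qed

lemma of_nat_eq_0_iff_mod: "of_nat n = (0::'a::semiring_1_cancel) \<longleftrightarrow> n mod CHAR('a) = 0"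
  by (simp add: of_nat_eq_0_iff_char_dvd dvd_eq_mod_eq_0)

lemma CHAR_gt_1:
  assumes "CHAR('k::field) > 0"
  shows "CHAR('k) > 1"
  using prime_CHAR_semidom[OF assms] prime_gt_1_nat by blast

lemma chains_antimono:
  assumes "\<alpha> \<in> div_chains p n" "p > 0" "l \<le> j"
  shows "lookup \<alpha> j \<le> lookup \<alpha> l"
  using \<open>l \<le> j\<close>
proof (induction j rule: dec_induct)
  case (step j)
  have "lookup \<alpha> (Suc j) \<le> p * lookup \<alpha> (Suc j)"
    using assms(2) by simp
  also have "\<dots> \<le> lookup \<alpha> j"
    using assms(1) by (simp add: div_chains_def)
  finally show ?case
    using step.IH by simp
qed simp

text \<open>Exponents decrease along a chain, so a positive entry at j forces positive entries
  before j; hence the denominator of \<delta> z_j cancels and no truncated subtraction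
  occurs.\<close>

lemma zderiv_zmonom_chain:
  assumes "\<alpha> \<in> div_chains p n" "p > 0"
  shows "zderiv (zmonom \<alpha> :: 'k::field zfield) =
    (\<Sum>j\<in>keys \<alpha>. zconst (of_nat (lookup \<alpha> j)) * zmonom (\<alpha> - ones j))"
  unfolding zderiv_zmonom
proof (rule sum.cong)
  fix j assume "j \<in> keys \<alpha>"
  then have pos: "lookup \<alpha> l > 0" if "l \<le> j" for l
    using chains_antimono[OF assms that] by (simp add: in_keys_iff)
  have "\<alpha> - single j 1 = (\<alpha> - ones j) + (\<Sum>l<j. single l 1)"
  proof (rule poly_mapping_eqI)
    fix l
    show "lookup (\<alpha> - single j 1) l = lookup (\<alpha> - ones j + (\<Sum>l<j. single l 1)) l"
      using pos[of l]
      by (auto simp: lookup_minus lookup_add lookup_ones lookup_single lookup_sum when_def)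
  qed
  then have "zmonom (\<alpha> - single j 1) = zmonom (\<alpha> - ones j) * (\<Prod>l<j. zvar l :: 'k zfield)"
    by (simp add: zmonom_add zmonom_sum zvar_def)
  moreover have "(\<Prod>l<j. zvar l :: 'k zfield) \<noteq> 0"
    by (simp add: zvar_def)
  ultimately show "of_nat (lookup \<alpha> j) * zmonom (\<alpha> - single j 1) * inverse (\<Prod>l<j. zvar l) =
      zconst (of_nat (lookup \<alpha> j)) * (zmonom (\<alpha> - ones j) :: 'k zfield)"
    by simp
qed simp

text \<open>If p does not divide the entry at j, it strictly exceeds p times the next one, and this
  slack absorbs the removed unit. Digit j drops by one and higher digits stay. Entries divisible by
  p give terms of \<delta> with coefficient 0, so every nonzero term is covered.\<close>

lemma minus_ones_chain:
  assumes "\<alpha> \<in> div_chains p n" "p > 0" "lookup \<alpha> j mod p \<noteq> 0"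
  shows "\<alpha> - ones j \<in> div_chains p (n - 1)"
    and "digit_value p (\<alpha> - ones j) < digit_value p \<alpha>"
proof -
  have ch: "p * lookup \<alpha> (Suc l) \<le> lookup \<alpha> l" for l
    using assms by (simp add: div_chains_def)
  have "lookup \<alpha> j > 0"
    using assms(3) by (cases "lookup \<alpha> j") auto
  then have pos: "lookup \<alpha> l > 0" if "l \<le> j" for l
    using chains_antimono[OF assms(1,2) that] by simp
  have "p * (lookup \<alpha> (Suc l) - (if Suc l \<le> j then 1 else 0)) \<le>
      lookup \<alpha> l - (if l \<le> j then 1 else 0)" for l
  proof -
    consider "Suc l \<le> j" | "l = j" | "l > j"
      by linarith
    then show ?thesis
    proof cases
      case 1
      have "p * (lookup \<alpha> (Suc l) - 1) \<le> lookup \<alpha> l - p"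
        using ch[of l] by (simp add: diff_mult_distrib2)
      also have "\<dots> \<le> lookup \<alpha> l - 1"
        using assms(2) by simp
      finally show ?thesis
        using 1 by simp
    next
      case 2
      have "p * lookup \<alpha> (Suc l) \<noteq> lookup \<alpha> l"
      proof
        assume "p * lookup \<alpha> (Suc l) = lookup \<alpha> l"
        then have "lookup \<alpha> l mod p = 0"
          by (metis mod_mult_self1_is_0)
        with assms(3) 2 show False
          by simp
      qed
      with ch[of l] show ?thesis
        using 2 by simp
    next
      case 3
      then show ?thesis
        using ch[of l] by simp
    qed
  qed
  then show "\<alpha> - ones j \<in> div_chains p (n - 1)"
    using assms(1) pos[of 0] by (auto simp: div_chains_def lookup_minus lookup_ones)
  have "lookup \<alpha> j mod p = Suc ((lookup \<alpha> j - 1) mod p)"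
    using \<open>lookup \<alpha> j > 0\<close> assms(3) mod_Suc[of "lookup \<alpha> j - 1" p] by (auto split: if_splits)
  then show "digit_value p (\<alpha> - ones j) < digit_value p \<alpha>"
    by (intro digit_value_less[OF assms(2), of j]) (auto simp: lookup_minus lookup_ones)
qed

lemma zderiv_chain_span:
  fixes f :: "'k::field zfield"
  assumes p: "CHAR('k) > 0" and "f \<in> chain_span CHAR('k) n q"
  shows "zderiv f \<in> chain_span CHAR('k) (n - 1) (q - 1)"
proof -
  let ?p = "CHAR('k)"
  obtain S c where S: "finite S" "S \<subseteq> {\<alpha> \<in> div_chains ?p n. digit_value ?p \<alpha> < q}"
    and f: "f = (\<Sum>\<alpha>\<in>S. zconst (c \<alpha>) * zmonom \<alpha>)"
    using assms(2) unfolding chain_span_def by (rule zspanE)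
  have "zderiv f = (\<Sum>\<alpha>\<in>S. zconst (c \<alpha>) * zderiv (zmonom \<alpha>))"
    by (simp add: f zderiv.sum zderiv.mult_const)
  also have "\<dots> \<in> chain_span ?p (n - 1) (q - 1)"
    unfolding chain_span_def
  proof (intro zspan_sum zspan_zconst_mult)
    fix \<alpha> assume "\<alpha> \<in> S"
    then have \<alpha>: "\<alpha> \<in> div_chains ?p n" "digit_value ?p \<alpha> < q"
      using S by auto
    show "zderiv (zmonom \<alpha> :: 'k zfield) \<in> zspan {\<alpha> \<in> div_chains ?p (n - 1). digit_value ?p \<alpha> < q - 1}"
      unfolding zderiv_zmonom_chain[OF \<alpha>(1) p]
    proof (rule zspan_sum)
      fix j assume "j \<in> keys \<alpha>"
      show "zconst (of_nat (lookup \<alpha> j) :: 'k) * zmonom (\<alpha> - ones j) \<in>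
          zspan {\<alpha> \<in> div_chains ?p (n - 1). digit_value ?p \<alpha> < q - 1}"
      proof (cases "lookup \<alpha> j mod ?p = 0")
        case True
        then have "of_nat (lookup \<alpha> j) = (0 :: 'k)"
          by (simp add: of_nat_eq_0_iff_mod)
        then show ?thesis
          by (simp del: zconst_of_nat)
      next
        case False
        with minus_ones_chain[OF \<alpha>(1) p False] \<alpha>(2) show ?thesis
          by (intro zspan_term) auto
      qed
    qed
  qed
  finally show ?thesis .
qed

lemma funpow_zderiv_chain_span:
  fixes f :: "'k::field zfield"
  assumes p: "CHAR('k) > 0" and "f \<in> chain_span CHAR('k) n q"
  shows "(zderiv ^^ m) f \<in> chain_span CHAR('k) (n - m) (q - m)"
proof (induction m)
  case (Suc m)
  from zderiv_chain_span[OF p Suc] show ?case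
    by simp
qed (use assms in simp)

text \<open>The terms of \<delta> are sorted by position. Below the carry the coefficient is 0 mod
  p; at the carry the result is \<beta>, with a nonzero digit as coefficient; above it a digit of
  \<beta> drops, so the digit value falls below that of \<beta>.\<close>

lemma zderiv_zmonom_succ:
  assumes p: "CHAR('k::field) > 0" and \<beta>: "\<beta> \<in> div_chains CHAR('k) n"
  shows "\<exists>c. c \<noteq> (0 :: 'k) \<and> zderiv (zmonom (succ_exponent CHAR('k) \<beta>)) - zconst c * zmonom \<beta> \<in>
    chain_span CHAR('k) n (digit_value CHAR('k) \<beta>)"
proof -
  let ?p = "CHAR('k)"
  let ?s = "succ_exponent ?p \<beta>" and ?i = "carry ?p \<beta>"
  have p1: "?p > 1"
    by (rule CHAR_gt_1[OF p])
  have s: "?s \<in> div_chains ?p (Suc n)"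
    by (rule succ_exponent_chains[OF p1 \<beta>])
  define c :: 'k where "c = of_nat (lookup ?s ?i)"
  have "lookup ?s ?i mod ?p \<noteq> 0"
    using succ_exponent_mod(2)[OF p1, of \<beta>] by simp
  then have c: "c \<noteq> 0"
    by (simp add: c_def of_nat_eq_0_iff_mod)
  have ki: "?i \<in> keys ?s"
    by (simp add: in_keys_iff lookup_succ_exponent)
  have "zderiv (zmonom ?s :: 'k zfield) =
      (\<Sum>j\<in>keys ?s. zconst (of_nat (lookup ?s j)) * zmonom (?s - ones j))"
    by (rule zderiv_zmonom_chain[OF s p])
  also have "\<dots> = zconst c * zmonom (?s - ones ?i) +
      (\<Sum>j\<in>keys ?s - {?i}. zconst (of_nat (lookup ?s j)) * zmonom (?s - ones j))"
    unfolding c_def by (rule sum.remove) (use ki in auto)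
  also have "?s - ones ?i = \<beta>"
    by (simp add: succ_exponent_def)
  finally have "zderiv (zmonom ?s) - zconst c * zmonom \<beta> =
      (\<Sum>j\<in>keys ?s - {?i}. zconst (of_nat (lookup ?s j)) * zmonom (?s - ones j))"
    by simp
  also have "\<dots> \<in> chain_span ?p n (digit_value ?p \<beta>)"
    unfolding chain_span_def
  proof (rule zspan_sum)
    fix j assume j: "j \<in> keys ?s - {?i}"
    show "zconst (of_nat (lookup ?s j) :: 'k) * zmonom (?s - ones j) \<in>
        zspan {\<alpha> \<in> div_chains ?p n. digit_value ?p \<alpha> < digit_value ?p \<beta>}"
    proof (cases "lookup ?s j mod ?p = 0")
      case True
      then have "of_nat (lookup ?s j) = (0 :: 'k)"
        by (simp add: of_nat_eq_0_iff_mod)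
      then show ?thesis
        by (simp del: zconst_of_nat)
    next
      case False
      then have ji: "j > ?i"
        using j succ_exponent_mod(1)[OF p1, of j \<beta>] by (cases j ?i rule: linorder_cases) auto
      then have nz: "lookup \<beta> j mod ?p \<noteq> 0"
        using False succ_exponent_mod(3)[OF p1 ji] by simp
      then have "lookup \<beta> j > 0"
        by (cases "lookup \<beta> j") auto
      then have "lookup \<beta> j mod ?p = Suc ((lookup \<beta> j - 1) mod ?p)"
        using nz mod_Suc[of "lookup \<beta> j - 1" ?p] by (auto split: if_splits)
      then have "digit_value ?p (?s - ones j) < digit_value ?p \<beta>"
        using ji
        by (intro digit_value_less[OF p, of j])
           (auto simp: lookup_minus lookup_ones lookup_succ_exponent)
      with minus_ones_chain(1)[OF s p False] show ?thesis
        by (intro zspan_term) auto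
    qed
  qed
  finally show ?thesis
    using c by blast
qed

text \<open>The exponent \<alpha> is the m-fold successor of \<beta>. The remainder made in the last
  step lies below digit value e(\<beta>) + m, and \<delta>^m carries it below e(\<beta>), so only
  the product of the leading coefficients survives.\<close>

lemma chain_lift:
  assumes p: "CHAR('k::field) > 0" and \<beta>: "\<beta> \<in> div_chains CHAR('k) n"
  shows "\<exists>\<alpha> c. \<alpha> \<in> div_chains CHAR('k) (n + m) \<and>
    digit_value CHAR('k) \<alpha> = digit_value CHAR('k) \<beta> + m \<and> c \<noteq> (0 :: 'k) \<and>
    (zderiv ^^ m) (zmonom \<alpha>) - zconst c * zmonom \<beta> \<in>
      chain_span CHAR('k) n (digit_value CHAR('k) \<beta>)"
proof (induction m)
  case 0
  show ?case
    using \<beta> by (intro exI[of _ \<beta>] exI[of _ 1]) (simp add: chain_span_def)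
next
  case (Suc m)
  let ?p = "CHAR('k)"
  have p1: "?p > 1"
    by (rule CHAR_gt_1[OF p])
  obtain \<alpha> c where \<alpha>: "\<alpha> \<in> div_chains ?p (n + m)" "digit_value ?p \<alpha> = digit_value ?p \<beta> + m"
    and c: "c \<noteq> (0 :: 'k)" and lead: "(zderiv ^^ m) (zmonom \<alpha>) - zconst c * zmonom \<beta> \<in>
      chain_span ?p n (digit_value ?p \<beta>)"
    using Suc by blast
  let ?s = "succ_exponent ?p \<alpha>"
  obtain d where d: "d \<noteq> (0 :: 'k)"
    and lead': "zderiv (zmonom ?s) - zconst d * zmonom \<alpha> \<in>
      chain_span ?p (n + m) (digit_value ?p \<alpha>)"
    using zderiv_zmonom_succ[OF p \<alpha>(1)] by blast
  define r where "r = zderiv (zmonom ?s) - zconst d * zmonom \<alpha>"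
  have "(zderiv ^^ m) r \<in> chain_span ?p (n + m - m) (digit_value ?p \<alpha> - m)"
    using funpow_zderiv_chain_span[OF p lead', of m] by (simp add: r_def)
  then have r: "(zderiv ^^ m) r \<in> chain_span ?p n (digit_value ?p \<beta>)"
    by (simp add: \<alpha>)
  have "(zderiv ^^ Suc m) (zmonom ?s) = (zderiv ^^ m) (zconst d * zmonom \<alpha> + r)"
    by (simp add: r_def funpow_swap1)
  also have "\<dots> = zconst d * (zderiv ^^ m) (zmonom \<alpha>) + (zderiv ^^ m) r"
    by (simp add: zderiv.funpow_plus zderiv.funpow_mult_const)
  finally have "(zderiv ^^ Suc m) (zmonom ?s) - zconst (d * c) * zmonom \<beta> =
      zconst d * ((zderiv ^^ m) (zmonom \<alpha>) - zconst c * zmonom \<beta>) + (zderiv ^^ m) r"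
    by (simp add: zconst_mult algebra_simps)
  also have "\<dots> \<in> chain_span ?p n (digit_value ?p \<beta>)"
    using lead r unfolding chain_span_def by (intro zspan_add zspan_zconst_mult)
  finally show ?case
    using succ_exponent_chains[OF p1 \<alpha>(1)] digit_value_succ[OF p1, of \<alpha>] \<alpha>(2) c d
    by (intro exI[of _ ?s] exI[of _ "d * c"]) auto
qed

abbreviation zstar :: "nat \<Rightarrow> 'k::field zfield" where
  "zstar i \<equiv> zmonom (star_exponent CHAR('k) i)"

text \<open>The remainder of \<delta> on the monomial of index i + 1 has digit values below i, so
  \<delta>^i annihilates it and the leading scalars multiply.\<close>

lemma funpow_zderiv_zstar:
  assumes p: "CHAR('k::field) > 0"
  shows "\<exists>c. c \<noteq> (0 :: 'k) \<and> (zderiv ^^ i) (zstar i) = zconst c"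
proof (induction i)
  case 0
  show ?case
    by (intro exI[of _ 1]) (simp add: star_exponent_0[OF CHAR_gt_1[OF p]])
next
  case (Suc i)
  let ?p = "CHAR('k)"
  have p1: "?p > 1"
    by (rule CHAR_gt_1[OF p])
  obtain c where c: "c \<noteq> (0 :: 'k)" "(zderiv ^^ i) (zstar i) = zconst c"
    using Suc by blast
  obtain d where d: "d \<noteq> (0 :: 'k)"
    and lead: "zderiv (zstar (Suc i)) - zconst d * zstar i \<in>
      chain_span ?p (Suc i) (digit_value ?p (star_exponent ?p i))"
    using zderiv_zmonom_succ[OF p star_exponent_chains[OF p1 lessI, of i]]
    unfolding star_exponent_Suc[OF p1] by blast
  define r where "r = zderiv (zstar (Suc i)) - zconst d * zstar i"
  have "(zderiv ^^ i) r \<in> chain_span ?p (Suc i - i) (i - i)"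
    using funpow_zderiv_chain_span[OF p lead, of i] by (simp add: r_def digit_value_star[OF p1])
  then have "(zderiv ^^ i) r = 0"
    by simp
  moreover have "(zderiv ^^ Suc i) (zstar (Suc i)) = (zderiv ^^ i) (zconst d * zstar i + r)"
    by (simp add: r_def funpow_swap1)
  ultimately have "(zderiv ^^ Suc i) (zstar (Suc i)) = zconst (d * c)"
    by (simp add: zderiv.funpow_plus zderiv.funpow_mult_const c zconst_mult)
  then show ?case
    using c d by (intro exI[of _ "d * c"]) simp
qed

lemma zstar_triangular_family:
  assumes p: "CHAR('k::field) > 0"
  shows "\<exists>c. triangular_family zderiv (zstar :: nat \<Rightarrow> 'k zfield) c"
proof -
  obtain c where "\<forall>i. c i \<noteq> (0 :: 'k) \<and> (zderiv ^^ i) (zstar i) = zconst (c i)"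
    using funpow_zderiv_zstar[OF p] by metis
  then have "triangular_family zderiv (zstar :: nat \<Rightarrow> 'k zfield) (\<lambda>i. zconst (c i))"
    by unfold_locales auto
  then show ?thesis
    by blast
qed

section \<open>The field of constants of the rational function field\<close>

lemma CHAR_zpoly: "CHAR('k::field zpoly) = CHAR('k)"
proof (rule CHAR_eqI)
  fix n assume "of_nat n = (0 :: 'k zpoly)"
  then have "lookup (of_nat n :: 'k zpoly) 0 = 0"
    by simp
  then have "of_nat n = (0 :: 'k)"
    by (simp add: lookup_of_nat)
  then show "CHAR('k) dvd n"
    by (simp add: of_nat_eq_0_iff_char_dvd)
next
  have "single 0 (of_nat (CHAR('k)) :: 'k) = (0 :: 'k zpoly)"
    by simp
  then show "of_nat (CHAR('k)) = (0 :: 'k zpoly)"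
    by (simp only: single_of_nat)
qed

lemma CHAR_zfield: "CHAR('k::field zfield) = CHAR('k)"
proof (rule CHAR_eqI)
  fix n assume "of_nat n = (0 :: 'k zfield)"
  then have "zconst (of_nat n :: 'k) = 0"
    by simp
  then have "of_nat n = (0 :: 'k)"
    by (simp only: zconst_eq_0_iff)
  then show "CHAR('k) dvd n"
    by (simp add: of_nat_eq_0_iff_char_dvd)
next
  have "zconst (of_nat (CHAR('k)) :: 'k) = 0"
    by (simp only: of_nat_CHAR zconst_zero)
  then show "of_nat (CHAR('k)) = (0 :: 'k zfield)"
    by (simp only: zconst_of_nat)
qed

lemma zderiv_power_CHAR:
  fixes f :: "'k::field zfield"
  assumes "CHAR('k) > 0"
  shows "zderiv (f ^ CHAR('k)) = 0"
  by (rule zderiv.char_power) (use assms in \<open>simp_all add: CHAR_zfield\<close>)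

lemma zderiv_zmonom_eq_0:
  assumes "\<And>i. CHAR('k::field) dvd lookup \<alpha> i"
  shows "zderiv (zmonom \<alpha> :: 'k zfield) = 0"
proof -
  have "of_nat (lookup \<alpha> j) = (0 :: 'k zfield)" for j
    using assms[of j] by (simp add: of_nat_eq_0_iff_char_dvd CHAR_zfield)
  then show ?thesis
    by (simp add: zderiv_zmonom)
qed

lemma single_power: "single (\<alpha> :: nat \<Rightarrow>\<^sub>0 nat) (c :: 'k::field) ^ n = single (\<Sum>i<n. \<alpha>) (c ^ n)"
  by (induction n) (simp_all add: mult_single add.commute del: sum_constant)

lemma zmonom_power: "zmonom \<alpha> ^ n = zmonom (\<Sum>i<n. \<alpha>)"
  by (induction n) (simp_all add: zmonom_add mult.commute del: sum_constant)

text \<open>Frobenius is additive and sends each term to one with exponents divisible by p; hence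
  b^p is an admissible denominator in \<open>zfield_p\<close>.\<close>

lemma keys_power_CHAR:
  fixes P :: "'k::field zpoly"
  assumes p: "CHAR('k) > 0"
  shows "\<forall>\<alpha>\<in>keys (P ^ CHAR('k)). \<forall>i. CHAR('k) dvd lookup \<alpha> i"
proof (induction P rule: zpoly_induct)
  case (1 \<alpha> c)
  show ?case
    by (simp add: single_power lookup_sum del: sum_constant) simp
next
  case (2 P Q)
  have "(P + Q) ^ CHAR('k) = P ^ CHAR('k) + Q ^ CHAR('k)"
    by (rule freshmans_dream) (simp_all add: CHAR_zpoly prime_CHAR_semidom[OF p])
  with 2 keys_add[of "P ^ CHAR('k)" "Q ^ CHAR('k)"] show ?case
    by auto
qed

text \<open>Numerator and denominator have congruent exponents mod p. Expanding the fraction by the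
  power p - 1 of the denominator keeps exponents natural: below stands a p-th power, above a
  monomial with all exponents divisible by p.\<close>

lemma zderiv_zmonom_div_zstar:
  assumes p: "CHAR('k::field) > 0"
  shows "zderiv (zmonom \<alpha> / zstar (digit_value CHAR('k) \<alpha>) :: 'k zfield) = 0"
proof -
  let ?p = "CHAR('k)"
  let ?v = "zstar (digit_value ?p \<alpha>) :: 'k zfield" and ?s = "star_exponent ?p (digit_value ?p \<alpha>)"
  have "?v ^ ?p = ?v ^ (?p - 1) * ?v"
    using p by (metis Suc_diff_1 power_Suc2)
  then have "zmonom \<alpha> / ?v = (zmonom \<alpha> * ?v ^ (?p - 1)) * inverse (?v ^ ?p)"
    by (simp add: field_simps)
  also have "zmonom \<alpha> * ?v ^ (?p - 1) = zmonom (\<alpha> + (\<Sum>i<?p - 1. ?s))"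
    by (simp add: zmonom_power zmonom_add del: sum_constant)
  finally have eq: "zmonom \<alpha> / ?v = zmonom (\<alpha> + (\<Sum>i<?p - 1. ?s)) * inverse (?v ^ ?p)" .
  have "?p dvd lookup (\<alpha> + (\<Sum>i<?p - 1. ?s)) j" for j
  proof -
    have "lookup ?s j mod ?p = lookup \<alpha> j mod ?p"
      using digit_value_digit[OF p, of \<alpha> j] by (simp add: lookup_star_exponent[OF CHAR_gt_1[OF p]])
    then have "(lookup \<alpha> j + (?p - 1) * lookup ?s j) mod ?p =
        (lookup ?s j + (?p - 1) * lookup ?s j) mod ?p"
      by (metis mod_add_left_eq)
    also have "lookup ?s j + (?p - 1) * lookup ?s j = ?p * lookup ?s j"
      using p by (cases ?p) auto
    finally show ?thesis
      by (simp only: lookup_add lookup_sum) (simp add: dvd_eq_mod_eq_0)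
  qed
  then have "zderiv (zmonom (\<alpha> + (\<Sum>i<?p - 1. ?s)) :: 'k zfield) = 0"
    by (rule zderiv_zmonom_eq_0)
  moreover have "zderiv (inverse (?v ^ ?p)) = 0"
    by (rule zderiv.inverse_const[of "?v ^ ?p"]) (use zderiv_power_CHAR[OF p] in auto)
  ultimately show ?thesis
    unfolding eq by (simp add: zderiv.mult)
qed

text \<open>The coordinate of P at \<open>zstar l\<close> over the field of constants: dividing the
  monomials of digit value l by \<open>zstar l\<close> leaves constants.\<close>

definition digit_coeff :: "'k::field zpoly \<Rightarrow> nat \<Rightarrow> 'k zfield" where
  "digit_coeff P l = (\<Sum>\<alpha> | \<alpha> \<in> keys P \<and> digit_value CHAR('k) \<alpha> = l.
     zconst (lookup P \<alpha>) * (zmonom \<alpha> / zstar l))"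

lemma zderiv_digit_coeff:
  fixes P :: "'k::field zpoly"
  assumes p: "CHAR('k) > 0"
  shows "zderiv (digit_coeff P l) = 0"
  unfolding digit_coeff_def zderiv.sum
proof (rule sum.neutral, safe)
  fix \<alpha>
  show "zderiv (zconst (lookup P \<alpha>) * (zmonom \<alpha> / zstar (digit_value CHAR('k) \<alpha>))) = 0"
    by (subst zderiv.mult_const) (simp_all add: zderiv_zmonom_div_zstar[OF p])
qed

lemma to_fract_eq_digit_sum:
  fixes P :: "'k::field zpoly"
  shows "\<exists>M. \<forall>N\<ge>M. to_fract P = (\<Sum>l<N. digit_coeff P l * zstar l)"
proof (intro exI allI impI)
  let ?e = "digit_value CHAR('k)"
  fix N assume "Suc (Max (?e ` keys P)) \<le> N"
  then have N: "?e \<alpha> < N" if "\<alpha> \<in> keys P" for \<alpha>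
    using that Max_ge[of "?e ` keys P" "?e \<alpha>"] by (meson Suc_le_eq finite_imageI finite_keys imageI le_less_trans)
  have "to_fract P = (\<Sum>\<alpha>\<in>keys P. zconst (lookup P \<alpha>) * zmonom \<alpha>)"
    by (rule to_fract_zpoly)
  also have "\<dots> = (\<Sum>l\<in>{..<N}. \<Sum>\<alpha> | \<alpha> \<in> keys P \<and> ?e \<alpha> = l. zconst (lookup P \<alpha>) * zmonom \<alpha>)"
    by (rule sum.group[symmetric]) (use N in auto)
  also have "\<dots> = (\<Sum>l<N. digit_coeff P l * zstar l)"
    by (simp add: digit_coeff_def sum_distrib_right)
  finally show "to_fract P = (\<Sum>l<N. digit_coeff P l * zstar l)" .
qed

text \<open>The membership of \<open>a 0\<close> in \<open>zfield_p\<close> is recorded separately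
  because the description of all constants is deduced from it. The range \<open>Suc N\<close>
  guarantees that the term at 0 is present.\<close>

lemma zfield_decomposition:
  fixes f :: "'k::field zfield"
  assumes p: "CHAR('k) > 0"
  obtains N a where "\<And>l. zderiv (a l) = 0" "a 0 \<in> zfield_p" "f = (\<Sum>l<Suc N. a l * zstar l)"
proof -
  let ?p = "CHAR('k)" and ?e = "digit_value CHAR('k)"
  obtain P0 b where b: "b \<noteq> 0" and f: "f = Fract P0 b"
    by (cases f) auto
  \<comment> \<open>Expanding by b^(p-1) makes the denominator b^p a constant, so only the
    polynomial numerator has to be decomposed.\<close>
  define P where "P = P0 * b ^ (?p - 1)"
  have "b ^ ?p = b ^ (?p - 1) * b"
    using p by (metis Suc_diff_1 power_Suc2)
  then have fP: "f = Fract P (b ^ ?p)"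
    using b by (simp add: f P_def eq_fract)
  obtain M where M: "\<forall>N\<ge>M. to_fract P = (\<Sum>l<N. digit_coeff P l * zstar l)"
    using to_fract_eq_digit_sum by blast
  define a where "a l = digit_coeff P l / to_fract (b ^ ?p)" for l
  have db: "zderiv (inverse (to_fract (b ^ ?p))) = 0"
  proof (rule zderiv.inverse_const)
    have "to_fract (b ^ n) = to_fract b ^ n" for n
      by (induction n) auto
    then show "zderiv (to_fract (b ^ ?p)) = 0"
      by (simp add: zderiv_power_CHAR[OF p])
  qed (use b in simp)
  have "zderiv (a l) = 0" for l
    unfolding a_def divide_inverse
    by (simp add: zderiv.mult db zderiv_digit_coeff[OF p])
  moreover have "a 0 \<in> zfield_p"
  proof -
    define Q where "Q = (\<Sum>\<alpha> | \<alpha> \<in> keys P \<and> ?e \<alpha> = 0. single \<alpha> (lookup P \<alpha>))"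
    have "digit_coeff P 0 = to_fract Q"
      by (simp add: digit_coeff_def Q_def star_exponent_0[OF CHAR_gt_1[OF p]] zconst_times_zmonom)
    then have "a 0 = Fract Q (b ^ ?p)"
      by (simp add: a_def Fract_conv_to_fract)
    moreover have "?p dvd lookup \<alpha> i" if "\<alpha> \<in> keys Q" for \<alpha> i
    proof -
      have "keys Q \<subseteq> {\<alpha> \<in> keys P. ?e \<alpha> = 0}"
        unfolding Q_def by (auto simp: in_keys_iff lookup_sum lookup_single when_def split: if_splits)
      then have "?e \<alpha> = 0"
        using that by auto
      then show ?thesis
        using digit_value_digit[OF p, of \<alpha> i] by (simp add: dvd_eq_mod_eq_0)
    qed
    ultimately show ?thesis
      unfolding zfield_p_def using b keys_power_CHAR[OF p, of b] by fastforce
  qed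
  moreover have "f = (\<Sum>l<Suc M. a l * zstar l)"
  proof -
    have "f = to_fract P / to_fract (b ^ ?p)"
      by (simp add: fP Fract_conv_to_fract)
    also have "to_fract P = (\<Sum>l<Suc M. digit_coeff P l * zstar l)"
      using M by (meson le_Suc_eq order_refl)
    finally show ?thesis
      by (simp add: a_def sum_divide_distrib add_divide_distrib)
  qed
  ultimately show thesis
    using that by blast
qed

text \<open>For a constant f, \<open>coeff_eq_0\<close> with m = 1 removes every coordinate except
  the one at \<open>zstar 0\<close>, which is 1; so f is \<open>a 0\<close>.\<close>

lemma zfield_p_eq_ker:
  assumes p: "CHAR('k::field) > 0"
  shows "zfield_p = {f :: 'k zfield. zderiv f = 0}"
proof (intro equalityI subsetI CollectI)
  fix f :: "'k zfield" assume "f \<in> zfield_p"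
  then obtain a b where b: "b \<noteq> 0" and f: "f = Fract a b"
    and dvd: "\<forall>\<alpha>\<in>keys a \<union> keys b. \<forall>i. CHAR('k) dvd lookup \<alpha> i"
    by (auto simp: zfield_p_def)
  have poly: "zderiv (to_fract P) = 0" if "\<forall>\<alpha>\<in>keys P. \<forall>i. CHAR('k) dvd lookup \<alpha> i" for P :: "'k zpoly"
    unfolding to_fract_zpoly zderiv.sum
    by (rule sum.neutral) (use that in \<open>auto simp: zderiv.mult zderiv_zmonom_eq_0\<close>)
  have "zderiv (inverse (to_fract b)) = 0"
    by (rule zderiv.inverse_const[of "to_fract b"]) (use b dvd in \<open>auto intro: poly\<close>)
  then show "zderiv f = 0"
    using poly[of a] dvd by (simp add: f Fract_conv_to_fract divide_inverse zderiv.mult)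
next
  fix f :: "'k zfield" assume "f \<in> {f. zderiv f = 0}"
  then have df: "zderiv f = 0"
    by simp
  obtain c where "triangular_family zderiv (zstar :: nat \<Rightarrow> 'k zfield) c"
    using zstar_triangular_family[OF p] by blast
  then interpret triangular_family zderiv "zstar :: nat \<Rightarrow> 'k zfield" c .
  obtain N a where a: "\<And>l. zderiv (a l) = 0" "a 0 \<in> zfield_p"
    and f: "f = (\<Sum>l<Suc N. a l * zstar l)"
    by (rule zfield_decomposition[OF p, of f]) blast
  have "a (Suc l) = 0" if "l < N" for l
    by (rule coeff_eq_0[of "Suc N" a 1]) (use a df f that in auto)
  then have "f = a 0"
    unfolding f sum.lessThan_Suc_shift by (simp add: star_exponent_0[OF CHAR_gt_1[OF p]])
  then show "f \<in> zfield_p"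
    using a by simp
qed

lemma ker_funpow_zderiv:
  fixes f :: "'k::field zfield"
  assumes p: "CHAR('k) > 0" and "(zderiv ^^ m) f = 0"
  obtains a where "\<And>l. zderiv (a l) = 0" "f = (\<Sum>l<m. a l * zstar l)"
proof -
  obtain c where "triangular_family zderiv (zstar :: nat \<Rightarrow> 'k zfield) c"
    using zstar_triangular_family[OF p] by blast
  then interpret triangular_family zderiv "zstar :: nat \<Rightarrow> 'k zfield" c .
  obtain N a where a: "\<And>l. zderiv (a l) = 0" and f: "f = (\<Sum>l<Suc N. a l * zstar l)"
    by (rule zfield_decomposition[OF p, of f]) blast
  \<comment> \<open>N and m are unrelated, so the coefficients are padded by zeros to be compared
    over a common range.\<close>
  define a' where "a' l = (if l < Suc N then a l else 0)" for l
  have "a' l = 0" if "m \<le> l" for l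
    using coeff_eq_0[of "Suc N" a m l] a that assms(2) f by (auto simp: a'_def)
  then have "(\<Sum>l<m. a' l * zstar l) = (\<Sum>l<m + Suc N. a' l * zstar l)"
    by (intro sum.mono_neutral_left) auto
  also have "\<dots> = (\<Sum>l<Suc N. a' l * zstar l)"
    by (intro sum.mono_neutral_right) (auto simp: a'_def)
  also have "\<dots> = f"
    by (simp add: f a'_def)
  finally show thesis
    using that[of a'] a by (simp add: a'_def)
qed

lemma zstar_independent:
  fixes a :: "nat \<Rightarrow> 'k::field zfield"
  assumes p: "CHAR('k) > 0" and "\<And>l. l < m \<Longrightarrow> zderiv (a l) = 0"
    and "(\<Sum>l<m. a l * zstar l) = 0" "l < m"
  shows "a l = 0"
proof -
  obtain c where "triangular_family zderiv (zstar :: nat \<Rightarrow> 'k zfield) c"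
    using zstar_triangular_family[OF p] by blast
  then interpret triangular_family zderiv "zstar :: nat \<Rightarrow> 'k zfield" c .
  show ?thesis
    by (rule coeff_eq_0[of m a 0]) (use assms in auto)
qed

lemma zderiv_locally_nilpotent:
  fixes f :: "'k::field zfield"
  assumes p: "CHAR('k) > 0"
  shows "\<exists>N. (zderiv ^^ N) f = 0"
proof -
  obtain c where "triangular_family zderiv (zstar :: nat \<Rightarrow> 'k zfield) c"
    using zstar_triangular_family[OF p] by blast
  then interpret triangular_family zderiv "zstar :: nat \<Rightarrow> 'k zfield" c .
  obtain N a where a: "\<And>l. zderiv (a l) = 0" and f: "f = (\<Sum>l<Suc N. a l * zstar l)"
    by (rule zfield_decomposition[OF p, of f]) blast
  have "(zderiv ^^ Suc N) f = (\<Sum>l<Suc N. a l * (zderiv ^^ Suc N) (zstar l))"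
    unfolding f zderiv.funpow_sum by (intro sum.cong refl zderiv.funpow_mult_const a)
  also have "\<dots> = 0"
    by (intro sum.neutral) (use funpow_v_eq_0[of _ "Suc N"] in \<open>auto simp del: funpow.simps\<close>)
  finally show ?thesis ..
qed

section \<open>Polynomials in the derivation\<close>

text \<open>Evaluation of q at \<delta>, making the rational functions a module over polynomials
  with X acting as \<delta>. Composing q with c + X gives the action of q(c + \<delta>).\<close>

definition act :: "'k::field poly \<Rightarrow> 'k zfield \<Rightarrow> 'k zfield" where
  "act q f = (\<Sum>i\<le>Polynomial.degree q. zconst (Polynomial.coeff q i) * (zderiv ^^ i) f)"

lemma act_superset:
  assumes "Polynomial.degree q \<le> N"
  shows "act q f = (\<Sum>i\<le>N. zconst (Polynomial.coeff q i) * (zderiv ^^ i) f)"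
  unfolding act_def
  by (rule sum.mono_neutral_left) (use assms in \<open>auto simp: coeff_eq_0\<close>)

lemma act_poly_0 [simp]: "act 0 f = 0"
  by (simp add: act_def)

lemma act_add: "act (q + r) f = act q f + act r f"
proof -
  let ?N = "max (Polynomial.degree q) (Polynomial.degree r)"
  show ?thesis
    using degree_add_le_max[of q r]
    by (simp add: act_superset[of _ ?N] zconst_add algebra_simps sum.distrib)
qed

lemma act_smult: "act (Polynomial.smult c q) f = zconst c * act q f"
  by (simp add: act_superset[OF degree_smult_le] act_def zconst_mult sum_distrib_left mult.assoc)

lemma act_pCons: "act (pCons a q) f = zconst a * f + zderiv (act q f)"
proof -
  have "act (pCons a q) f = (\<Sum>i\<le>Suc (Polynomial.degree q).
      zconst (Polynomial.coeff (pCons a q) i) * (zderiv ^^ i) f)"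
    by (rule act_superset[OF degree_pCons_le])
  also have "\<dots> = zconst a * f + zderiv (act q f)"
    unfolding sum.atMost_Suc_shift by (simp add: act_def zderiv.sum zderiv.mult_const)
  finally show ?thesis .
qed

lemma act_mult: "act (q * r) f = act q (act r f)"
  by (induction q) (simp_all add: act_add act_smult act_pCons)

lemma act_X_power: "act ([:0, 1:] ^ m) f = (zderiv ^^ m) f"
proof (induction m)
  case 0
  show ?case
    by (simp add: act_def)
qed (simp add: act_mult act_pCons del: mult_pCons_left)

lemma act_arg_add: "act q (f + g) = act q f + act q g"
  by (simp add: act_def zderiv.funpow_plus algebra_simps sum.distrib)

lemma act_arg_0 [simp]: "act q 0 = 0"
  by (simp add: act_def)

lemma act_arg_uminus: "act q (- f) = - act q f"
  using act_arg_add[of q f "- f"] by (simp add: add_eq_0_iff)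

lemma act_arg_diff: "act q (f - g) = act q f - act q g"
  using act_arg_add[of q f "- g"] by (simp add: act_arg_uminus)

lemma act_arg_sum: "act q (sum f A) = (\<Sum>i\<in>A. act q (f i))"
  by (induction A rule: infinite_finite_induct) (auto simp: act_arg_add)

lemma act_arg_mult_const: "zderiv a = 0 \<Longrightarrow> act q (a * f) = a * act q f"
  by (simp add: act_def zderiv.funpow_mult_const sum_distrib_left algebra_simps)

lemma act_funpow: "act q ((zderiv ^^ m) f) = (zderiv ^^ m) (act q f)"
  by (simp add: act_def zderiv.funpow_sum zderiv.funpow_mult_const funpow_add[symmetric, THEN fun_cong, unfolded comp_def] add.commute)

lemma act_const:
  assumes "zderiv f = 0"
  shows "act q f = zconst (poly q 0) * f"
  using assms by (induction q) (simp_all add: act_pCons zderiv.mult)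

lemma act_chain_span:
  fixes f :: "'k::field zfield"
  assumes p: "CHAR('k) > 0" and "f \<in> chain_span CHAR('k) n r"
  shows "act q f \<in> chain_span CHAR('k) n r"
proof -
  have "(zderiv ^^ i) f \<in> chain_span CHAR('k) n r" for i
    using funpow_zderiv_chain_span[OF assms, of i] by (rule chain_span_mono) auto
  then show ?thesis
    unfolding act_def chain_span_def by (intro zspan_sum zspan_zconst_mult)
qed

lemma act_zspan_chains:
  fixes f :: "'k::field zfield"
  assumes p: "CHAR('k) > 0" and "f \<in> zspan (div_chains CHAR('k) n)"
  shows "act q f \<in> zspan (div_chains CHAR('k) n)"
proof -
  obtain r where "f \<in> chain_span CHAR('k) n r"
    using exists_chain_span[OF assms(2)] by blast
  from act_chain_span[OF p this] show ?thesis
    unfolding chain_span_def by (rule zspan_mono) auto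
qed

text \<open>If h = \<delta>^m f were nonzero, its last nonzero iterate under \<delta> would be a
  constant, on which g(\<delta>) is multiplication by g(0) \<noteq> 0; yet g(\<delta>) kills h and
  commutes with \<delta>.\<close>

lemma act_eq_0_imp_funpow:
  fixes f :: "'k::field zfield"
  assumes p: "CHAR('k) > 0" and "act ([:0, 1:] ^ m * g) f = 0" "poly g 0 \<noteq> 0"
  shows "(zderiv ^^ m) f = 0"
proof (rule ccontr)
  define h where "h = (zderiv ^^ m) f"
  assume "(zderiv ^^ m) f \<noteq> 0"
  then have h: "h \<noteq> 0"
    by (simp add: h_def)
  have gh: "act g h = 0"
    using assms(2) by (simp add: act_mult act_X_power act_funpow h_def)
  define N where "N = (LEAST N. (zderiv ^^ N) h = 0)"
  have N: "(zderiv ^^ N) h = 0"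
    unfolding N_def using zderiv_locally_nilpotent[OF p, of h] by (rule LeastI_ex)
  obtain M where M: "N = Suc M"
    using N h by (cases N) auto
  have "(zderiv ^^ M) h \<noteq> 0"
    using not_less_Least[of M "\<lambda>N. (zderiv ^^ N) h = 0"] M by (simp add: N_def)
  moreover have "act g ((zderiv ^^ M) h) = zconst (poly g 0) * (zderiv ^^ M) h"
    by (rule act_const) (use N M in simp)
  moreover have "act g ((zderiv ^^ M) h) = 0"
    by (simp add: act_funpow gh)
  ultimately show False
    using assms(3) by simp
qed

text \<open>
  Up to a nonzero scalar, the operator maps a monomial of digit value at least m to its m-fold
  predecessor plus monomials of smaller digit value, so the induction is on the digit value.
\<close>

lemma act_surj_chain_span:
  assumes p: "CHAR('k::field) > 0" and g: "poly g (0 :: 'k) \<noteq> 0"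
    and "f \<in> chain_span CHAR('k) n q"
  shows "\<exists>h \<in> zspan {\<alpha> \<in> div_chains CHAR('k) (n + m). m \<le> digit_value CHAR('k) \<alpha>}.
    act ([:0, 1:] ^ m * g) h = f"
  using assms(3)
proof (induction q arbitrary: f)
  case 0
  then show ?case
    by (intro bexI[of _ 0]) simp_all
next
  case (Suc q)
  let ?p = "CHAR('k)"
  let ?H = "{\<alpha> \<in> div_chains ?p (n + m). m \<le> digit_value ?p \<alpha>}" and ?P = "[:0, 1:] ^ m * g"
  have mono: "\<exists>h \<in> zspan ?H. act ?P h = zmonom \<beta>"
    if \<beta>: "\<beta> \<in> div_chains ?p n" "digit_value ?p \<beta> < Suc q" for \<beta>
  proof -
    obtain \<alpha> c where \<alpha>: "\<alpha> \<in> div_chains ?p (n + m)" "digit_value ?p \<alpha> = digit_value ?p \<beta> + m"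
      and c: "c \<noteq> (0 :: 'k)" and lead: "(zderiv ^^ m) (zmonom \<alpha>) - zconst c * zmonom \<beta> \<in>
        chain_span ?p n (digit_value ?p \<beta>)"
      using chain_lift[OF p \<beta>(1)] by blast
    define r where "r = (zderiv ^^ m) (zmonom \<alpha>) - zconst c * zmonom \<beta>"
    \<comment> \<open>Splitting off the constant term: g(\<delta>) is the scalar g(0) plus \<delta>
      g'(\<delta>), and the second part lowers the digit value.\<close>
    obtain g' where g': "g = pCons (poly g 0) g'"
      by (cases g) auto
    have bspan: "zmonom \<beta> \<in> (chain_span ?p n (Suc (digit_value ?p \<beta>)) :: 'k zfield set)"
      using zspan_term[of \<beta> "{\<alpha> \<in> div_chains ?p n. digit_value ?p \<alpha> < Suc (digit_value ?p \<beta>)}" "1 :: 'k"] \<beta>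
      by (simp add: chain_span_def)
    have "act g r \<in> chain_span ?p n (digit_value ?p \<beta>)"
      using lead by (intro act_chain_span[OF p]) (simp add: r_def)
    moreover have "zderiv (act g' (zmonom \<beta>)) \<in> (chain_span ?p n (digit_value ?p \<beta>) :: 'k zfield set)"
      using zderiv_chain_span[OF p act_chain_span[OF p bspan]]
      by (rule chain_span_mono) auto
    ultimately have "zconst c * zderiv (act g' (zmonom \<beta>)) + act g r \<in> chain_span ?p n (digit_value ?p \<beta>)"
      unfolding chain_span_def by (intro zspan_add zspan_zconst_mult)
    then have "zconst c * zderiv (act g' (zmonom \<beta>)) + act g r \<in> chain_span ?p n q"
      by (rule chain_span_mono) (use \<beta> in auto)
    \<comment> \<open>Both error terms have digit values below that of \<beta>, so the induction
      hypothesis gives them a preimage h, to be subtracted from z^\<alpha>.\<close>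
    from Suc.IH[OF this] obtain h where h: "h \<in> zspan ?H"
      "act ?P h = zconst c * zderiv (act g' (zmonom \<beta>)) + act g r"
      by blast
    have "act ?P (zmonom \<alpha>) = act g (zconst c * zmonom \<beta> + r)"
      by (simp add: act_mult act_X_power act_funpow[symmetric] r_def)
    also have "\<dots> = zconst c * act g (zmonom \<beta>) + act g r"
      by (simp add: act_arg_add act_arg_mult_const)
    also have "act g (zmonom \<beta>) = zconst (poly g 0) * zmonom \<beta> + zderiv (act g' (zmonom \<beta>))"
      by (subst g') (rule act_pCons)
    finally have "act ?P (zmonom \<alpha> - h) = zconst (c * poly g 0) * zmonom \<beta>"
      unfolding act_arg_diff h(2) by (simp add: zconst_mult algebra_simps)
    then have "act ?P (zconst (inverse (c * poly g 0)) * (zmonom \<alpha> - h)) =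
        zconst (inverse (c * poly g 0) * (c * poly g 0)) * zmonom \<beta>"
      by (simp only: act_arg_mult_const[OF zderiv_zconst] zconst_mult mult.assoc)
    also have "inverse (c * poly g 0) * (c * poly g 0) = 1"
      by (rule left_inverse) (use c g in simp)
    finally have "act ?P (zconst (inverse (c * poly g 0)) * (zmonom \<alpha> - h)) = zmonom \<beta>"
      by simp
    moreover have "zconst (inverse (c * poly g 0)) * (zmonom \<alpha> - h) \<in> zspan ?H"
      using h zspan_term[of \<alpha> ?H 1] \<alpha> by (intro zspan_zconst_mult zspan_diff) auto
    ultimately show ?thesis
      by blast
  qed
  obtain S c where S: "finite S" "S \<subseteq> {\<alpha> \<in> div_chains ?p n. digit_value ?p \<alpha> < Suc q}"
    and f: "f = (\<Sum>\<alpha>\<in>S. zconst (c \<alpha>) * zmonom \<alpha>)"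
    using Suc.prems unfolding chain_span_def by (rule zspanE)
  obtain h where h: "\<And>\<beta>. \<beta> \<in> S \<Longrightarrow> h \<beta> \<in> zspan ?H \<and> act ?P (h \<beta>) = zmonom \<beta>"
    using mono S(2) by (metis (no_types, lifting) mem_Collect_eq subsetD)
  show ?case
  proof
    show "(\<Sum>\<alpha>\<in>S. zconst (c \<alpha>) * h \<alpha>) \<in> zspan ?H"
      using h by (intro zspan_sum zspan_zconst_mult) auto
    show "act ?P (\<Sum>\<alpha>\<in>S. zconst (c \<alpha>) * h \<alpha>) = f"
      unfolding act_arg_sum f by (intro sum.cong) (auto simp: act_arg_mult_const h)
  qed
qed

lemma act_surj:
  assumes p: "CHAR('k::field) > 0" and g: "poly g (0 :: 'k) \<noteq> 0"
    and "f \<in> zspan (div_chains CHAR('k) n)"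
  shows "\<exists>h \<in> zspan {\<alpha> \<in> div_chains CHAR('k) (n + m). m \<le> digit_value CHAR('k) \<alpha>}.
    act ([:0, 1:] ^ m * g) h = f"
  using exists_chain_span[OF assms(3)] act_surj_chain_span[OF p g] by blast

text \<open>The coordinates of h at digit values below m vanish by the choice of its monomials,
  those from m on because \<delta>^m kills h.\<close>

lemma act_inj:
  fixes h :: "'k::field zfield"
  assumes p: "CHAR('k) > 0" and g: "poly g (0 :: 'k) \<noteq> 0"
    and h: "h \<in> zspan {\<alpha> \<in> A. m \<le> digit_value CHAR('k) \<alpha>}"
    and eq: "act ([:0, 1:] ^ m * g) h = 0"
  shows "h = 0"
proof -
  obtain c where "triangular_family zderiv (zstar :: nat \<Rightarrow> 'k zfield) c"
    using zstar_triangular_family[OF p] by blast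
  then interpret triangular_family zderiv "zstar :: nat \<Rightarrow> 'k zfield" c .
  obtain P where P: "h = to_fract P" "keys P \<subseteq> {\<alpha> \<in> A. m \<le> digit_value CHAR('k) \<alpha>}"
    using h by (auto simp: zspan_def)
  obtain N where N: "to_fract P = (\<Sum>l<N. digit_coeff P l * zstar l)"
    using to_fract_eq_digit_sum by blast
  have "digit_coeff P l = 0" if "l < N" for l
  proof (cases "m \<le> l")
    case True
    have "(zderiv ^^ m) (\<Sum>l<N. digit_coeff P l * zstar l) = 0"
      using act_eq_0_imp_funpow[OF p eq g] by (simp add: P N)
    from coeff_eq_0[OF _ this True that] show ?thesis
      using zderiv_digit_coeff[OF p] by blast
  next
    case False
    then have "{\<alpha> \<in> keys P. digit_value CHAR('k) \<alpha> = l} = {}"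
      using P(2) by auto
    then show ?thesis
      unfolding digit_coeff_def by (simp only: sum.empty)
  qed
  then show ?thesis
    using P N by simp
qed

section \<open>The derivation of R and its constants\<close>

unbundle fps_syntax

lemma fls_sum_nth: "sum f A $$ n = (\<Sum>i\<in>A. f i $$ n)"
  by (induction A rule: infinite_finite_induct) auto

text \<open>Arbitrary lower bounds replace subdegrees, since derivatives and sums give control of
  bounds only.\<close>

lemma fls_times_nth_bounds:
  fixes f g :: "'a::comm_ring_1 fls"
  assumes "\<And>i. i < N \<Longrightarrow> f $$ i = 0" "\<And>i. i < M \<Longrightarrow> g $$ i = 0"
  shows "(f * g) $$ n = (\<Sum>i=N..n - M. f $$ i * g $$ (n - i))"
proof -
  let ?A = "{min N (fls_subdegree f)..n - min M (fls_subdegree g)}"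
  have "(f * g) $$ n = (\<Sum>i=fls_subdegree f..n - fls_subdegree g. f $$ i * g $$ (n - i))"
    by (rule fls_times_nth)
  also have "\<dots> = (\<Sum>i\<in>?A. f $$ i * g $$ (n - i))"
  proof (rule sum.mono_neutral_left)
    show "\<forall>i\<in>?A - {fls_subdegree f..n - fls_subdegree g}. f $$ i * g $$ (n - i) = 0"
    proof
      fix i assume "i \<in> ?A - {fls_subdegree f..n - fls_subdegree g}"
      then have "i < fls_subdegree f \<or> n - i < fls_subdegree g"
        by auto
      then show "f $$ i * g $$ (n - i) = 0"
        by auto
    qed
  qed auto
  also have "\<dots> = (\<Sum>i=N..n - M. f $$ i * g $$ (n - i))"
  proof (rule sum.mono_neutral_right)
    show "\<forall>i\<in>?A - {N..n - M}. f $$ i * g $$ (n - i) = 0"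
    proof
      fix i assume "i \<in> ?A - {N..n - M}"
      then have "i < N \<or> n - i < M"
        by auto
      then show "f $$ i * g $$ (n - i) = 0"
        using assms by auto
    qed
  qed auto
  finally show ?thesis .
qed

lemma laurent_deriv_add: "laurent_deriv (f + g) = laurent_deriv f + laurent_deriv g"
  by (rule fls_eqI) (simp add: laurent_deriv_nth zderiv.add algebra_simps)

text \<open>Derivation moves the lower bound of a factor down by one. Reindexing brings all three
  convolutions to the range \<open>{N..n + 1 - M}\<close>, where the identity holds term by
  term.\<close>

lemma laurent_deriv_mult: "laurent_deriv (f * g) = laurent_deriv f * g + f * laurent_deriv g"
proof (rule fls_eqI)
  fix n
  obtain N where N: "\<And>i. i < N \<Longrightarrow> f $$ i = 0"
    using fls_nth_vanishes_belowE by metis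
  obtain M where M: "\<And>i. i < M \<Longrightarrow> g $$ i = 0"
    using fls_nth_vanishes_belowE by metis
  have lf: "laurent_deriv f $$ i = 0" if "i < N - 1" for i
    using that by (simp add: laurent_deriv_nth N)
  have lg: "laurent_deriv g $$ i = 0" if "i < M - 1" for i
    using that by (simp add: laurent_deriv_nth M)
  let ?A = "{N..n + 1 - M}"
  have "(laurent_deriv f * g) $$ n = (\<Sum>i=N - 1..n - M. laurent_deriv f $$ i * g $$ (n - i))"
    by (rule fls_times_nth_bounds[OF lf M])
  also have "\<dots> = (\<Sum>i\<in>?A. laurent_deriv f $$ (i - 1) * g $$ (n + 1 - i))"
    by (rule sum.reindex_bij_witness[of _ "\<lambda>i. i - 1" "\<lambda>i. i + 1"]) auto
  finally have 1: "(laurent_deriv f * g) $$ n =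
      (\<Sum>i\<in>?A. laurent_deriv f $$ (i - 1) * g $$ (n + 1 - i))" .
  have "(f * laurent_deriv g) $$ n = (\<Sum>i=N..n - (M - 1). f $$ i * laurent_deriv g $$ (n - i))"
    by (rule fls_times_nth_bounds[OF N lg])
  also have "n - (M - 1) = n + 1 - M"
    by simp
  finally have 2: "(f * laurent_deriv g) $$ n = (\<Sum>i\<in>?A. f $$ i * laurent_deriv g $$ (n - i))" .
  have "(f * g) $$ (n + 1) = (\<Sum>i\<in>?A. f $$ i * g $$ (n + 1 - i))"
    by (rule fls_times_nth_bounds[OF N M])
  then have "laurent_deriv (f * g) $$ n = (\<Sum>i\<in>?A. of_int (n + 1) * (f $$ i * g $$ (n + 1 - i)) +
      (zderiv (f $$ i) * g $$ (n + 1 - i) + f $$ i * zderiv (g $$ (n + 1 - i))))"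
    by (simp add: laurent_deriv_nth zderiv.sum zderiv.mult sum.distrib sum_distrib_left)
  also have "\<dots> = (\<Sum>i\<in>?A. laurent_deriv f $$ (i - 1) * g $$ (n + 1 - i) +
      f $$ i * laurent_deriv g $$ (n - i))"
    by (rule sum.cong) (simp_all add: laurent_deriv_nth algebra_simps)
  also have "\<dots> = (laurent_deriv f * g + f * laurent_deriv g) $$ n"
    by (simp add: 1 2 sum.distrib)
  finally show "laurent_deriv (f * g) $$ n = (laurent_deriv f * g + f * laurent_deriv g) $$ n" .
qed

lemma poly_mapping_single_induct:
  fixes y :: "'b \<Rightarrow>\<^sub>0 'c::comm_monoid_add"
  assumes "\<And>\<rho> f. S (single \<rho> f)" "\<And>y z. S y \<Longrightarrow> S z \<Longrightarrow> S (y + z)"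
  shows "S y"
proof -
  have "S (\<Sum>\<rho>\<in>A. single \<rho> (lookup y \<rho>))" if "finite A" for A
    using that
  proof (induction A)
    case empty
    show ?case using assms(1)[of undefined 0] by simp
  qed (simp add: assms)
  then show ?thesis
    by (subst poly_mapping_sum_single) simp
qed

lemma lookup_single_mult:
  fixes y :: "'b::ab_group_add \<Rightarrow>\<^sub>0 'c::comm_ring_1"
  shows "lookup (single \<sigma> f * y) \<rho> = f * lookup y (\<rho> - \<sigma>)"
proof (induction y rule: poly_mapping_single_induct)
  case (1 \<tau> g)
  show ?case
    by (auto simp: mult_single lookup_single when_def algebra_simps)
qed (simp add: lookup_add algebra_simps)

lemma lookup_single_0_mult:
  fixes y :: "'b::ab_group_add \<Rightarrow>\<^sub>0 'c::comm_ring_1"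
  shows "lookup (single 0 f * y) \<rho> = f * lookup y \<rho>"
  by (simp add: lookup_single_mult)

interpretation log_deriv: derivation "log_deriv :: 'k::field logring \<Rightarrow> _"
proof
  have add: "log_deriv (y + z) = log_deriv y + log_deriv z" for y z :: "'k logring"
    by (rule poly_mapping_eqI) (simp add: lookup_log_deriv lookup_add laurent_deriv_add algebra_simps)
  then show "log_deriv (y + z) = log_deriv y + log_deriv z" for y z :: "'k logring" .
  show "log_deriv (y * z) = log_deriv y * z + y * log_deriv z" for y z :: "'k logring"
  proof (induction y rule: poly_mapping_single_induct)
    case (1 \<rho> f)
    show ?case
    proof (induction z rule: poly_mapping_single_induct)
      case (1 \<sigma> g)
      have "laurent_deriv (f * g) + fls_const (zconst (\<rho> + \<sigma>)) * fls_X_inv * (f * g) =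
          (laurent_deriv f + fls_const (zconst \<rho>) * fls_X_inv * f) * g +
          f * (laurent_deriv g + fls_const (zconst \<sigma>) * fls_X_inv * g)"
        by (simp add: laurent_deriv_mult zconst_add fls_plus_const[symmetric] algebra_simps del: fls_plus_const)
      then show ?case
        by (simp add: mult_single log_deriv_single single_add[symmetric])
    qed (simp add: add algebra_simps)
  qed (simp add: add algebra_simps)
qed

text \<open>Here c = \<rho> + n + 1 belongs to the coefficient of x^(n+1), and dividing x d/dx by x
  moves it to index n.\<close>

lemma log_deriv_nth:
  "lookup (log_deriv y) \<rho> $$ n = act [:\<rho> + of_int (n + 1), 1:] (lookup y \<rho> $$ (n + 1))"
proof -
  have "(fls_const (zconst \<rho>) * fls_X_inv * lookup y \<rho>) $$ n = zconst \<rho> * lookup y \<rho> $$ (n + 1)"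
    unfolding mult.assoc fls_X_inv_times_conv_shift(1) by simp
  then show ?thesis
    by (simp add: lookup_log_deriv laurent_deriv_nth act_pCons zconst_add algebra_simps)
qed

text \<open>For c \<noteq> 0 the operator c + \<delta> is injective: this is
  \<open>act_eq_0_imp_funpow\<close> with m = 0. For c = 0 its kernel is
  \<open>zfield_p\<close>.\<close>

lemma log_deriv_eq_0_iff_nth:
  fixes y :: "'k::field logring"
  assumes p: "CHAR('k) > 0"
  shows "log_deriv y = 0 \<longleftrightarrow> (\<forall>\<rho> n. lookup y \<rho> $$ n \<in> zfield_p \<and>
    (lookup y \<rho> $$ n \<noteq> 0 \<longrightarrow> \<rho> = - of_int n))"
proof -
  have act: "act [:c, 1:] f = 0 \<longleftrightarrow> zderiv f = 0 \<and> (f \<noteq> 0 \<longrightarrow> c = 0)" for c and f :: "'k zfield"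
  proof (cases "c = 0")
    case False
    have "f = 0" if "act [:c, 1:] f = 0"
      using act_eq_0_imp_funpow[OF p, of 0 "[:c, 1:]" f] that False by simp
    then show ?thesis
      using False by auto
  qed (simp add: act_pCons)
  have "log_deriv y = 0 \<longleftrightarrow> (\<forall>\<rho> n. act [:\<rho> + of_int (n + 1), 1:] (lookup y \<rho> $$ (n + 1)) = 0)"
    by (simp add: poly_mapping_eq_iff fun_eq_iff fls_eq_iff log_deriv_nth)
  also have "\<dots> \<longleftrightarrow> (\<forall>\<rho> n. act [:\<rho> + of_int n, 1:] (lookup y \<rho> $$ n) = 0)"
    by (metis diff_add_cancel)
  finally show ?thesis
    by (simp add: act zfield_p_eq_ker[OF p] add_eq_0_iff2)
qed

text \<open>The condition \<rho> = -n in the ground field says that \<rho> is the image of some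
  \<sigma> < p and n is -\<sigma> mod p, so x^n is x^(p-\<sigma>) times a power of x^p.\<close>

lemma constants_eq_ker:
  assumes p: "CHAR('k::field) > 0"
  shows "constants = {y :: 'k logring. log_deriv y = 0}"
proof (intro equalityI subsetI CollectI)
  let ?p = "CHAR('k)"
  fix y :: "'k logring" assume y: "y \<in> constants"
  show "log_deriv y = 0"
    unfolding log_deriv_eq_0_iff_nth[OF p]
  proof (intro allI)
    fix \<rho> n
    show "lookup y \<rho> $$ n \<in> zfield_p \<and> (lookup y \<rho> $$ n \<noteq> 0 \<longrightarrow> \<rho> = - of_int n)"
    proof (cases "\<rho> \<in> keys y")
      case True
      then obtain \<sigma> g where \<sigma>: "\<sigma> < ?p" "\<rho> = of_nat \<sigma>" "g \<in> laurent_p"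
        "lookup y \<rho> = fls_X ^ (?p - \<sigma>) * g"
        using y by (auto simp: constants_def)
      have nth: "lookup y \<rho> $$ n = g $$ (n - int (?p - \<sigma>))"
        by (simp add: \<sigma>(4) fls_X_power_times_conv_shift)
      have "\<rho> = - of_int n" if "g $$ (n - int (?p - \<sigma>)) \<noteq> 0"
      proof -
        have "int ?p dvd n - int (?p - \<sigma>)"
          using \<sigma>(3) that by (auto simp: laurent_p_def)
        then have "of_int (n - int (?p - \<sigma>)) = (0 :: 'k)"
          by (simp add: of_int_eq_0_iff_char_dvd del: of_int_diff)
        then show ?thesis
          using \<sigma>(1,2) by (simp add: of_nat_diff eq_neg_iff_add_eq_0 add.commute)
      qed
      then show ?thesis
        using \<sigma>(3) nth by (auto simp: laurent_p_def)
    next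
      case False
      then show ?thesis
        by (simp add: zfield_p_eq_ker[OF p] in_keys_iff)
    qed
  qed
next
  let ?p = "CHAR('k)"
  fix y :: "'k logring" assume "y \<in> {y. log_deriv y = 0}"
  then have y: "lookup y \<rho> $$ n \<in> zfield_p" "lookup y \<rho> $$ n \<noteq> 0 \<Longrightarrow> \<rho> = - of_int n" for \<rho> n
    using log_deriv_eq_0_iff_nth[OF p, of y] by auto
  show "y \<in> constants"
    unfolding constants_def
  proof (intro CollectI ballI)
    fix \<rho> assume "\<rho> \<in> keys y"
    then obtain N where "lookup y \<rho> $$ N \<noteq> 0"
      by (auto simp: in_keys_iff fls_eq_iff)
    then have N: "\<rho> = - of_int N"
      by (rule y)
    \<comment> \<open>The representative of -N mod p; any index N with nonzero coefficient gives the
      same one.\<close>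
    define \<sigma> where "\<sigma> = nat ((- N) mod int ?p)"
    have \<sigma>: "\<sigma> < ?p"
      using p by (simp add: \<sigma>_def nat_less_iff)
    have "int ?p dvd (- N) - int \<sigma>"
      using p by (simp add: \<sigma>_def)
    then have "of_int (- N - int \<sigma>) = (0 :: 'k)"
      by (simp add: of_int_eq_0_iff_char_dvd del: of_int_diff)
    then have \<rho>: "\<rho> = of_nat \<sigma>"
      by (simp add: N)
    define g where "g = fls_shift (int (?p - \<sigma>)) (lookup y \<rho>)"
    have "g \<in> laurent_p"
      unfolding laurent_p_def
    proof (intro CollectI allI conjI impI)
      fix n
      show "g $$ n \<in> zfield_p"
        by (simp add: g_def y)
      assume "g $$ n \<noteq> 0"
      then have "\<rho> = - of_int (n + int (?p - \<sigma>))"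
        unfolding g_def fls_shift_nth by (rule y)
      then have "of_int n = (0 :: 'k)"
        using \<sigma> \<rho> by (simp add: of_nat_diff)
      then show "int ?p dvd n"
        by (simp add: of_int_eq_0_iff_char_dvd)
    qed
    moreover have "lookup y \<rho> = fls_X ^ (?p - \<sigma>) * g"
      by (rule fls_eqI) (simp add: g_def fls_X_power_times_conv_shift)
    ultimately show "\<exists>\<sigma><?p. \<rho> = of_nat \<sigma> \<and> (\<exists>g\<in>laurent_p. lookup y \<rho> = fls_X ^ (?p - \<sigma>) * g)"
      using \<sigma> \<rho> by blast
  qed
qed

lemma constants_nth:
  assumes p: "CHAR('k::field) > 0"
  shows "y \<in> constants \<longleftrightarrow> (\<forall>\<rho> n. zderiv (lookup y \<rho> $$ n) = 0 \<and>
    (lookup (y :: 'k logring) \<rho> $$ n \<noteq> 0 \<longrightarrow> \<rho> = - of_int n))"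
  using log_deriv_eq_0_iff_nth[OF p, of y]
  by (simp add: constants_eq_ker[OF p] zfield_p_eq_ker[OF p])

lemma CHAR_logring: "CHAR('k::field logring) = CHAR('k)"
proof (rule CHAR_eqI)
  fix n assume "of_nat n = (0 :: 'k logring)"
  then have "lookup (of_nat n :: 'k logring) 0 $$ 0 = 0"
    by simp
  then have "of_nat n = (0 :: 'k zfield)"
    by (simp add: lookup_of_nat fls_of_nat)
  then show "CHAR('k) dvd n"
    by (simp add: of_nat_eq_0_iff_char_dvd CHAR_zfield)
next
  have "of_nat (CHAR('k)) = (0 :: 'k zfield)"
    using of_nat_CHAR[where 'a = "'k zfield"] by (simp add: CHAR_zfield)
  then have "of_nat (CHAR('k)) = (0 :: 'k zfield fls)"
    by (simp add: fls_of_nat)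
  then have "single 0 (of_nat (CHAR('k)) :: 'k zfield fls) = (0 :: 'k logring)"
    by simp
  then show "of_nat (CHAR('k)) = (0 :: 'k logring)"
    by (simp only: single_of_nat)
qed

text \<open>
  The p-th power of an element is the p-th power of its image under the augmentation that sends
  every power of t to 1, and on constants the augmentation is injective because a monomial
  in x determines the exponent of t.
\<close>

lemma constants_inverse:
  fixes y :: "'k::field logring"
  assumes p: "CHAR('k) > 0" and y: "y \<in> constants" "y \<noteq> 0"
  shows "\<exists>z\<in>constants. y * z = 1"
proof -
  let ?p = "CHAR('k)"
  define a where "a = (\<Sum>\<rho>\<in>keys y. lookup y \<rho>)"
  have single_pow: "single \<rho> f ^ n = single (of_nat n * \<rho>) (f ^ n)" for \<rho> :: 'k and f :: "'k zfield fls" and n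
    by (induction n) (simp_all add: mult_single algebra_simps)
  have "y ^ ?p = (\<Sum>\<rho>\<in>keys y. single \<rho> (lookup y \<rho>)) ^ ?p"
    by (subst poly_mapping_sum_single) simp
  also have "\<dots> = (\<Sum>\<rho>\<in>keys y. single \<rho> (lookup y \<rho>) ^ ?p)"
    by (rule freshmans_dream_sum) (simp_all add: CHAR_logring prime_CHAR_semidom[OF p])
  \<comment> \<open>All exponents of t collapse to 0, since p * \<rho> = 0 in the ground
    field.\<close>
  also have "\<dots> = single 0 (\<Sum>\<rho>\<in>keys y. lookup y \<rho> ^ ?p)"
    by (rule poly_mapping_eqI) (simp add: single_pow lookup_sum lookup_single when_def)
  finally have pow: "y ^ ?p = single 0 (\<Sum>\<rho>\<in>keys y. lookup y \<rho> ^ ?p)" .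
  have "CHAR('k zfield fls) = ?p"
    by (rule CHAR_eqI) (auto simp: fls_of_nat CHAR_zfield of_nat_eq_0_iff_char_dvd)
  then have "(\<Sum>\<rho>\<in>keys y. lookup y \<rho> ^ ?p) = a ^ ?p"
    unfolding a_def by (intro freshmans_dream_sum[symmetric]) (simp_all add: prime_CHAR_semidom[OF p])
  with pow have pow: "y ^ ?p = single 0 (a ^ ?p)"
    by simp
  have "a \<noteq> 0"
  proof
    assume a0: "a = 0"
    obtain \<rho> n where nz: "lookup y \<rho> $$ n \<noteq> 0"
      using y(2) by (auto simp: poly_mapping_eq_iff fun_eq_iff fls_eq_iff)
    have uniq: "\<sigma> = - of_int n" if "lookup y \<sigma> $$ n \<noteq> 0" for \<sigma>
      using y(1) that constants_nth[OF p, of y] by blast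
    have "a $$ n = (\<Sum>\<sigma>\<in>keys y. lookup y \<sigma> $$ n)"
      by (simp add: a_def fls_sum_nth)
    also have "\<dots> = (\<Sum>\<sigma>\<in>{\<rho>}. lookup y \<sigma> $$ n)"
    proof (rule sum.mono_neutral_right)
      show "\<forall>\<sigma>\<in>keys y - {\<rho>}. lookup y \<sigma> $$ n = 0"
        using uniq uniq[OF nz] by blast
    qed (use nz in \<open>auto simp: in_keys_iff\<close>)
    finally show False
      using nz a0 by simp
  qed
  \<comment> \<open>As y^p equals a^p in exponent 0 of t, the inverse of y is y^(p-1) / a^p.\<close>
  define z where "z = y ^ (?p - 1) * single 0 (inverse (a ^ ?p))"
  have "y * z = y ^ ?p * single 0 (inverse (a ^ ?p))"
    using p by (simp add: z_def power_eq_if mult.assoc)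
  also have "\<dots> = 1"
    using \<open>a \<noteq> 0\<close> by (simp add: pow mult_single)
  finally have yz: "y * z = 1" .
  moreover have "z \<in> constants"
    using log_deriv.inverse_const[of y z] y(1) yz by (simp add: constants_eq_ker[OF p])
  ultimately show ?thesis
    by blast
qed

section \<open>The subfield of constants and bases over it\<close>

lemma ring_of_type_algebra_sel [simp]:
  "carrier ring_of_type_algebra = UNIV"
  "x \<otimes>\<^bsub>ring_of_type_algebra\<^esub> y = x * y"
  "x \<oplus>\<^bsub>ring_of_type_algebra\<^esub> y = x + y"
  "\<one>\<^bsub>ring_of_type_algebra\<^esub> = 1"
  "\<zero>\<^bsub>ring_of_type_algebra\<^esub> = 0"
  for x y :: "'a::comm_ring_1"
  by (simp_all add: ring_of_type_algebra_def)

lemma a_inv_ring_of_type_algebra: "\<ominus>\<^bsub>ring_of_type_algebra\<^esub> (x :: 'a::comm_ring_1) = - x"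
proof -
  interpret cring "ring_of_type_algebra :: 'a ring"
    by (rule cring_from_type_algebra)
  show ?thesis
    by (rule minus_equality) simp_all
qed

lemma subfield_constants:
  assumes p: "CHAR('k::field) > 0"
  shows "subfield constants (ring_of_type_algebra :: 'k logring ring)"
proof -
  interpret cring "ring_of_type_algebra :: 'k logring ring"
    by (rule cring_from_type_algebra)
  note ker = constants_eq_ker[OF p]
  show ?thesis
  proof (rule subfieldI)
    show "subcring constants (ring_of_type_algebra :: 'k logring ring)"
    proof (rule subcringI'[OF subringI])
      show "\<ominus>\<^bsub>ring_of_type_algebra\<^esub> h \<in> constants" if "h \<in> constants" for h :: "'k logring"
        using that by (simp add: ker a_inv_ring_of_type_algebra log_deriv.uminus)
    qed (auto simp: ker log_deriv.add log_deriv.mult)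
    show "Units (ring_of_type_algebra \<lparr>carrier := constants\<rparr>) =
        constants - {\<zero>\<^bsub>ring_of_type_algebra :: 'k logring ring\<^esub>}"
    proof (intro equalityI subsetI)
      fix y :: "'k logring"
      assume "y \<in> Units (ring_of_type_algebra \<lparr>carrier := constants\<rparr>)"
      then show "y \<in> constants - {\<zero>\<^bsub>ring_of_type_algebra\<^esub>}"
        by (auto simp: Units_def)
    next
      fix y :: "'k logring"
      assume "y \<in> constants - {\<zero>\<^bsub>ring_of_type_algebra\<^esub>}"
      then show "y \<in> Units (ring_of_type_algebra \<lparr>carrier := constants\<rparr>)"
        using constants_inverse[OF p, of y] by (auto simp: Units_def mult.commute)
    qed
  qed
qed

lemma combine_ring_of_type_algebra:
  fixes y :: "'i \<Rightarrow> 'a::comm_ring_1"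
  assumes "distinct ps"
  shows "ring.combine (ring_of_type_algebra :: 'a ring) (map c ps) (map y ps) =
    (\<Sum>i\<in>set ps. c i * y i)"
proof -
  interpret cring "ring_of_type_algebra :: 'a ring"
    by (rule cring_from_type_algebra)
  show ?thesis
    using assms by (induction ps) auto
qed

lemma basis_familyI:
  fixes y :: "'i \<Rightarrow> 'a::comm_ring_1"
  assumes K: "subfield K (ring_of_type_algebra :: 'a ring)"
    and fin: "finite I"
    and indep: "\<And>c. (\<And>i. i \<in> I \<Longrightarrow> c i \<in> K) \<Longrightarrow> (\<Sum>i\<in>I. c i * y i) = 0 \<Longrightarrow> \<forall>i\<in>I. c i = 0"
    and sub: "\<And>c. (\<And>i. i \<in> I \<Longrightarrow> c i \<in> K) \<Longrightarrow> (\<Sum>i\<in>I. c i * y i) \<in> E"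
    and span: "\<And>z. z \<in> E \<Longrightarrow> \<exists>c. (\<forall>i\<in>I. c i \<in> K) \<and> z = (\<Sum>i\<in>I. c i * y i)"
  shows "basis_family (ring_of_type_algebra :: 'a ring) K I y E"
    and "ring.dimension (ring_of_type_algebra :: 'a ring) (card I) K E"
proof -
  interpret cring "ring_of_type_algebra :: 'a ring"
    by (rule cring_from_type_algebra)
  obtain ps where ps: "set ps = I" "distinct ps"
    using finite_distinct_list[OF fin] by blast
  \<comment> \<open>Distinctness of \<open>ps\<close> lets a list of coefficients be read as a
    function on the index set.\<close>
  have coeffs: "\<exists>c. Ks = map c ps \<and> (\<forall>i\<in>I. c i \<in> K)"
    if Ks: "length Ks = length ps" "set Ks \<subseteq> K" for Ks
  proof -
    define c where "c i = the (map_of (zip ps Ks) i)" for i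
    have "map c ps = Ks"
    proof (rule nth_equalityI)
      fix j assume "j < length (map c ps)"
      then show "map c ps ! j = Ks ! j"
        using ps Ks by (simp add: c_def map_of_zip_nth)
    qed (use Ks in simp)
    moreover from this have "\<forall>i\<in>I. c i \<in> K"
      using Ks ps by auto
    ultimately show ?thesis
      by metis
  qed
  have ind: "independent K (map y ps)"
  proof (rule ccontr)
    assume "\<not> independent K (map y ps)"
    then obtain Ks where Ks: "length Ks = length (map y ps)"
      "combine Ks (map y ps) = \<zero>\<^bsub>ring_of_type_algebra\<^esub>" "set Ks \<subseteq> K" "set Ks \<noteq> {\<zero>\<^bsub>ring_of_type_algebra\<^esub>}"
      using dependent_imp_non_trivial_combine[OF K, of "map y ps"] by auto
    then obtain c where c: "Ks = map c ps" "\<forall>i\<in>I. c i \<in> K"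
      using coeffs[of Ks] by auto
    have "(\<Sum>i\<in>I. c i * y i) = 0"
      using Ks(2) combine_ring_of_type_algebra[OF ps(2), of c y] by (simp add: c ps)
    then have "\<forall>i\<in>I. c i = 0"
      using indep c by blast
    then have "set Ks \<subseteq> {0}"
      using c ps by auto
    \<comment> \<open>The nontriviality condition \<open>set Ks \<noteq> {0}\<close> also holds for
      the empty list, so this case remains; the empty family is independent.\<close>
    then have "Ks = []"
      using Ks(4) by (cases Ks) auto
    then have "ps = []"
      using Ks(1) by simp
    with \<open>\<not> independent K (map y ps)\<close> show False
      by simp
  qed
  have "Span K (map y ps) = E"
  proof (intro equalityI subsetI)
    fix z assume "z \<in> Span K (map y ps)"
    then obtain Ks where Ks: "set Ks \<subseteq> K" "length Ks = length (map y ps)" "z = combine Ks (map y ps)"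
      using Span_mem_iff_length_version[OF K, of "map y ps" z] Span_eq_combine_set_length_version[OF K, of "map y ps"] by auto
    then obtain c where c: "Ks = map c ps" "\<forall>i\<in>I. c i \<in> K"
      using coeffs[of Ks] by auto
    then show "z \<in> E"
      using sub[of c] Ks(3) combine_ring_of_type_algebra[OF ps(2), of c y] ps by simp
  next
    fix z assume "z \<in> E"
    then obtain c where c: "\<forall>i\<in>I. c i \<in> K" "z = (\<Sum>i\<in>I. c i * y i)"
      using span by blast
    then have "z = combine (map c ps) (map y ps)"
      using combine_ring_of_type_algebra[OF ps(2), of c y] ps by simp
    moreover have "set (map c ps) \<subseteq> K"
      using c ps by auto
    ultimately show "z \<in> Span K (map y ps)"
      using Span_eq_combine_set[OF K, of "map y ps"] by (auto simp del: set_map)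
  qed
  with ind ps show "basis_family (ring_of_type_algebra :: 'a ring) K I y E"
    unfolding basis_family_def by blast
  have "card I = length (map y ps)"
    using ps distinct_card by fastforce
  then show "dimension (card I) K E"
    using dimensionI[OF K ind] \<open>Span K (map y ps) = E\<close> by simp
qed

section \<open>Differential operators on coefficients\<close>

text \<open>This is the identity of x^j \<partial>^j with the falling factorial of length j in x
  d/dx, read at the coefficient of index n + j.\<close>

lemma log_deriv_funpow_nth:
  "lookup ((log_deriv ^^ j) y) \<rho> $$ n =
     act (\<Prod>i<j. [:\<rho> + of_int (n + int j) - of_nat i, 1:]) (lookup y \<rho> $$ (n + int j))"
proof (induction j arbitrary: n)
  case 0
  show ?case
    by (simp add: act_def)
next
  case (Suc j)
  have "lookup ((log_deriv ^^ Suc j) y) \<rho> $$ n =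
      act [:\<rho> + of_int (n + 1), 1:] (act (\<Prod>i<j. [:\<rho> + of_int (n + 1 + int j) - of_nat i, 1:])
        (lookup y \<rho> $$ (n + 1 + int j)))"
    by (simp add: log_deriv_nth Suc)
  also have "n + 1 + int j = n + int (Suc j)"
    by simp
  finally show ?case
    by (simp add: act_mult[symmetric] mult.commute del: mult_pCons_left mult_pCons_right)
qed

lemma emb_series_mult_nth:
  assumes "\<And>m. m < N \<Longrightarrow> lookup y \<rho> $$ m = 0" "n - N \<le> int K"
  shows "lookup (emb_series a * y) \<rho> $$ n =
    (\<Sum>i\<le>K. zconst (fps_nth a i) * lookup y \<rho> $$ (n - int i))"
proof -
  let ?F = "fps_to_fls (Abs_fps (\<lambda>i. zconst (fps_nth a i)))"
  have "lookup (emb_series a * y) \<rho> $$ n = (?F * lookup y \<rho>) $$ n"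
    by (simp add: emb_series_def lookup_single_0_mult)
  also have "\<dots> = (\<Sum>i=0..n - N. ?F $$ i * lookup y \<rho> $$ (n - i))"
    by (rule fls_times_nth_bounds) (use assms in auto)
  also have "\<dots> = (\<Sum>i=0..int K. ?F $$ i * lookup y \<rho> $$ (n - i))"
    by (rule sum.mono_neutral_left) (use assms in auto)
  also have "\<dots> = (\<Sum>i\<le>K. zconst (fps_nth a i) * lookup y \<rho> $$ (n - int i))"
    by (rule sum.reindex_bij_witness[of _ int nat]) auto
  finally show ?thesis .
qed

text \<open>In the expansion of L as the sum over l of x^l q_l(x d/dx), this is q_l, the part of L
  that raises the order in x by l.\<close>

definition shifted_poly :: "'k::field diffop \<Rightarrow> nat \<Rightarrow> 'k poly" where
  "shifted_poly L l = (\<Sum>j\<le>Polynomial.degree L.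
     Polynomial.smult (op_coeff L (j + l) j) (\<Prod>i<j. [:- of_nat i, 1:]))"

lemma shifted_poly_0: "shifted_poly L 0 = indicial_poly L"
  by (simp add: shifted_poly_def indicial_poly_def)

lemma act_sum: "act (sum q A) f = (\<Sum>i\<in>A. act (q i) f)"
  by (induction A rule: infinite_finite_induct) (auto simp: act_add)

lemma pcompose_falling:
  "pcompose (\<Prod>i<j. [:- of_nat i, 1:]) [:c, 1:] = (\<Prod>i<j. [:c - of_nat i, 1 :: 'k::field:])"
  by (simp add: pcompose_prod pcompose_pCons)

text \<open>The part x^l q_l(x d/dx) carries coefficient n - l to n through q_l(c + \<delta>), with
  c taken at the source index n - l; K must reach down to the lowest term.\<close>

lemma apply_op_nth:
  assumes shift: "\<And>i j. op_coeff L i j \<noteq> 0 \<Longrightarrow> j \<le> i"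
    and N: "\<And>m. m < N \<Longrightarrow> lookup y \<rho> $$ m = 0" "n - N \<le> int K"
  shows "lookup (apply_op L y) \<rho> $$ n = (\<Sum>l\<le>K.
    act (pcompose (shifted_poly L l) [:\<rho> + of_int (n - int l), 1:]) (lookup y \<rho> $$ (n - int l)))"
proof -
  let ?d = "Polynomial.degree L"
  let ?F = "\<lambda>j c. \<Prod>i<j. [:c - of_nat i, 1:]"
  have summand: "lookup (emb_series (Polynomial.coeff L j) * (log_deriv ^^ j) y) \<rho> $$ n =
      (\<Sum>l\<le>K. zconst (op_coeff L (j + l) j) *
        act (?F j (\<rho> + of_int (n - int l))) (lookup y \<rho> $$ (n - int l)))" for j
  proof -
    have "lookup (emb_series (Polynomial.coeff L j) * (log_deriv ^^ j) y) \<rho> $$ n =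
        (\<Sum>i\<le>j + K. zconst (op_coeff L i j) * lookup ((log_deriv ^^ j) y) \<rho> $$ (n - int i))"
      unfolding op_coeff_def
      by (rule emb_series_mult_nth[of "N - int j"]) (use N in \<open>auto simp: log_deriv_funpow_nth\<close>)
    also have "\<dots> = (\<Sum>i=j..j + K. zconst (op_coeff L i j) *
        lookup ((log_deriv ^^ j) y) \<rho> $$ (n - int i))"
    proof (rule sum.mono_neutral_right)
      show "\<forall>i\<in>{..j + K} - {j..j + K}. zconst (op_coeff L i j) *
          lookup ((log_deriv ^^ j) y) \<rho> $$ (n - int i) = 0"
        using shift[of _ j] by (force simp: not_le)
    qed auto
    also have "\<dots> = (\<Sum>l\<le>K. zconst (op_coeff L (j + l) j) *
        lookup ((log_deriv ^^ j) y) \<rho> $$ (n - int (j + l)))"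
      by (rule sum.reindex_bij_witness[of _ "\<lambda>l. j + l" "\<lambda>i. i - j"]) auto
    finally show ?thesis
      by (simp add: log_deriv_funpow_nth)
  qed
  have "lookup (apply_op L y) \<rho> $$ n =
      (\<Sum>j\<le>?d. lookup (emb_series (Polynomial.coeff L j) * (log_deriv ^^ j) y) \<rho> $$ n)"
    by (simp add: apply_op_def lookup_sum fls_sum_nth)
  also have "\<dots> = (\<Sum>l\<le>K. \<Sum>j\<le>?d. zconst (op_coeff L (j + l) j) *
        act (?F j (\<rho> + of_int (n - int l))) (lookup y \<rho> $$ (n - int l)))"
    unfolding summand by (rule sum.swap)
  also have "\<dots> = (\<Sum>l\<le>K.
    act (pcompose (shifted_poly L l) [:\<rho> + of_int (n - int l), 1:]) (lookup y \<rho> $$ (n - int l)))"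
    by (simp add: shifted_poly_def pcompose_sum pcompose_smult pcompose_falling act_sum act_smult)
  finally show ?thesis .
qed

lemma has_shift_0_le:
  assumes "has_shift L 0" "op_coeff L i j \<noteq> 0"
  shows "j \<le> i"
  using assms unfolding has_shift_def by fastforce

lemma apply_op_nth_split:
  assumes "has_shift L 0"
    and "\<And>m. m < 0 \<Longrightarrow> lookup y \<rho> $$ m = 0"
  shows "lookup (apply_op L y) \<rho> $$ int n =
    act (pcompose (indicial_poly L) [:\<rho> + of_nat n, 1:]) (lookup y \<rho> $$ int n) +
    (\<Sum>l=1..n. act (pcompose (shifted_poly L l) [:\<rho> + of_nat (n - l), 1:])
      (lookup y \<rho> $$ int (n - l)))"
proof -
  have "lookup (apply_op L y) \<rho> $$ int n = (\<Sum>l\<le>n.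
      act (pcompose (shifted_poly L l) [:\<rho> + of_int (int n - int l), 1:])
        (lookup y \<rho> $$ (int n - int l)))"
    by (rule apply_op_nth[where N = 0]) (use assms has_shift_0_le in auto)
  also have "\<dots> = (\<Sum>l\<le>n. act (pcompose (shifted_poly L l) [:\<rho> + of_nat (n - l), 1:])
        (lookup y \<rho> $$ int (n - l)))"
    by (rule sum.cong) (auto simp: of_nat_diff)
  also have "{..n} = insert 0 {1..n}"
    by auto
  finally show ?thesis
    by (simp add: shifted_poly_0)
qed

lemma apply_op_nth_lowest:
  assumes "has_shift L 0" "\<And>m. m < n \<Longrightarrow> lookup y \<rho> $$ m = 0"
  shows "lookup (apply_op L y) \<rho> $$ n =
    act (pcompose (indicial_poly L) [:\<rho> + of_int n, 1:]) (lookup y \<rho> $$ n)"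
  using apply_op_nth[OF has_shift_0_le[OF assms(1)] assms(2), where n = n and K = 0] by (simp add: shifted_poly_0)

lemma op_coeff_initial_form:
  "op_coeff (initial_form L) i j = (if i = j then op_coeff L i i else 0)"
proof -
  have zero: "op_coeff L i j = 0" if "Polynomial.degree L < j" for i
    using that by (simp add: op_coeff_def coeff_eq_0)
  have "Polynomial.coeff (initial_form L) j =
      (if j \<le> Polynomial.degree L then fps_const (op_coeff L j j) * fps_X ^ j else 0)"
    by (simp add: initial_form_def coeff_sum)
  then show ?thesis
    using zero by (auto simp: op_coeff_def)
qed

lemma has_shift_0_diag:
  assumes "has_shift L 0"
  shows "\<exists>i. op_coeff L i i \<noteq> 0"
  using assms unfolding has_shift_def by fastforce

lemma initial_form_shift:
  assumes "has_shift L 0"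
  shows "has_shift (initial_form L) 0"
  using has_shift_0_diag[OF assms] by (auto simp: has_shift_def op_coeff_initial_form)

lemma shifted_poly_initial_form:
  assumes "regular_singular L"
  shows "shifted_poly (initial_form L) l = (if l = 0 then indicial_poly L else 0)"
  using assms
  by (auto simp: shifted_poly_def indicial_poly_def regular_singular_def op_coeff_initial_form)

lemma apply_initial_form_nth:
  assumes "has_shift L 0" "regular_singular L"
  shows "lookup (apply_op (initial_form L) y) \<rho> $$ n =
    act (pcompose (indicial_poly L) [:\<rho> + of_int n, 1:]) (lookup y \<rho> $$ n)"
proof -
  obtain N where N: "\<And>i. i < N \<Longrightarrow> lookup y \<rho> $$ i = 0"
    using fls_nth_vanishes_belowE by metis
  let ?G = "\<lambda>l. act (pcompose (shifted_poly (initial_form L) l) [:\<rho> + of_int (n - int l), 1:])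
      (lookup y \<rho> $$ (n - int l))"
  have "lookup (apply_op (initial_form L) y) \<rho> $$ n = (\<Sum>l\<le>nat (n - N). ?G l)"
    by (rule apply_op_nth[OF has_shift_0_le[OF initial_form_shift[OF assms(1)]] N]) auto
  also have "\<dots> = (\<Sum>l\<in>{0}. ?G l)"
    by (rule sum.mono_neutral_right) (auto simp: shifted_poly_initial_form[OF assms(2)])
  finally show ?thesis
    by (simp add: shifted_poly_initial_form[OF assms(2)])
qed

lemma apply_op_add: "apply_op L (y + z) = apply_op L y + apply_op L z"
  by (simp add: apply_op_def log_deriv.funpow_plus algebra_simps sum.distrib)

lemma apply_op_mult_const: "log_deriv c = 0 \<Longrightarrow> apply_op L (c * y) = c * apply_op L y"
  by (simp add: apply_op_def log_deriv.funpow_mult_const sum_distrib_left algebra_simps)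

lemma apply_op_0 [simp]: "apply_op L 0 = 0"
  by (simp add: apply_op_def)

lemma apply_op_diff: "apply_op L (y - z) = apply_op L y - apply_op L z"
  using apply_op_add[of L "y - z" z] by simp

lemma apply_op_sum: "apply_op L (sum f A) = (\<Sum>i\<in>A. apply_op L (f i))"
  by (induction A rule: infinite_finite_induct) (auto simp: apply_op_add)

text \<open>L respects the grading by exponents of t, so a solution can be treated one exponent at a
  time.\<close>

lemma apply_op_single:
  assumes "has_shift L 0"
  shows "apply_op L (single \<rho> (lookup y \<rho>)) = single \<rho> (lookup (apply_op L y) \<rho>)"
proof (rule poly_mapping_eqI, rule fls_eqI)
  fix \<tau> n
  obtain N where N: "\<And>i. i < N \<Longrightarrow> lookup y \<rho> $$ i = 0"
    using fls_nth_vanishes_belowE by metis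
  have K: "n - N \<le> int (nat (n - N))"
    by simp
  have "lookup (single \<rho> (lookup y \<rho>)) \<tau> $$ i = 0" if "i < N" for i
    using N[OF that] by (auto simp: lookup_single when_def)
  from apply_op_nth[OF has_shift_0_le[OF assms] this K] apply_op_nth[OF has_shift_0_le[OF assms] N K]
  show "lookup (apply_op L (single \<rho> (lookup y \<rho>))) \<tau> $$ n =
      lookup (single \<rho> (lookup (apply_op L y) \<rho>)) \<tau> $$ n"
    by (auto simp: lookup_single when_def)
qed

section \<open>Local exponents\<close>

lemma degree_falling_prod:
  "Polynomial.degree (\<Prod>i<j. [:- of_nat i, 1 :: 'k::field:]) = j"
  by (subst degree_prod_eq_sum_degree) auto

lemma degree_indicial_poly:
  assumes "has_shift L 0" "regular_singular L"
  shows "indicial_poly L \<noteq> 0" and "Polynomial.degree (indicial_poly L) = Polynomial.degree L"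
proof -
  let ?n = "Polynomial.degree L"
  have lead: "op_coeff L ?n ?n \<noteq> 0"
  \<comment> \<open>In order 0, equality of degrees does not exclude a vanishing initial form; there
    shift 0 supplies the nonzero diagonal coefficient.\<close>
  proof (cases "?n = 0")
    case True
    obtain i where "op_coeff L i i \<noteq> 0"
      using has_shift_0_diag[OF assms(1)] by blast
    moreover from this have "i \<le> ?n"
      by (metis coeff_eq_0 fps_zero_nth leI op_coeff_def)
    ultimately show ?thesis
      using True by simp
  next
    case False
    have "initial_form L \<noteq> 0"
      using False assms(2) unfolding regular_singular_def by auto
    then have "Polynomial.coeff (initial_form L) ?n \<noteq> 0"
      using assms(2) unfolding regular_singular_def by (metis leading_coeff_0_iff)
    then show ?thesis
      by (auto simp: initial_form_def coeff_sum)
  qed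
  have "Polynomial.coeff (\<Prod>j<i. [:- of_nat j, 1 :: 'a:]) ?n = (if i = ?n then 1 else 0)" if "i \<le> ?n" for i
  proof (cases "i = ?n")
    case True
    have "lead_coeff (\<Prod>j<i. [:- of_nat j, 1 :: 'a:]) = 1"
      by (simp add: lead_coeff_prod)
    then show ?thesis
      using True by (simp add: degree_falling_prod)
  next
    case False
    then show ?thesis
      using that by (simp add: coeff_eq_0 degree_falling_prod)
  qed
  then have "Polynomial.coeff (indicial_poly L) ?n =
      (\<Sum>i\<le>?n. op_coeff L i i * (if i = ?n then 1 else 0))"
    unfolding indicial_poly_def coeff_sum by (intro sum.cong) auto
  then have co: "Polynomial.coeff (indicial_poly L) ?n \<noteq> 0"
    using lead by (simp add: if_distrib[of "(*) _"] cong: if_cong)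
  then show "indicial_poly L \<noteq> 0"
    by auto
  have "Polynomial.degree (indicial_poly L) \<le> ?n"
    unfolding indicial_poly_def
    by (rule degree_sum_le)
       (auto intro: order_trans[OF degree_smult_le] simp: degree_falling_prod)
  with co show "Polynomial.degree (indicial_poly L) = ?n"
    by (simp add: le_antisym le_degree)
qed

text \<open>Algebraic closedness enters here, to make the number of pairs of a local exponent and an
  index below its multiplicity equal to the order of L.\<close>

lemma sum_order_alg_closed:
  fixes q :: "'k::alg_closed_field poly"
  assumes "q \<noteq> 0"
  shows "(\<Sum>x | poly q x = 0. Polynomial.order x q) = Polynomial.degree q"
proof -
  obtain A where A: "size A = Polynomial.degree q"
    "q = Polynomial.smult (lead_coeff q) (\<Prod>x\<in>#A. [:-x, 1:])"
    using alg_closed_imp_factorization[OF assms] by blast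
  have nz: "(\<Prod>x\<in>#B. [:-x, 1 :: 'k:]) \<noteq> 0" for B
    by (induction B) (simp_all del: mult_pCons_left)
  have "proots (\<Prod>x\<in>#A. [:-x, 1:]) = A"
  proof (induction A)
    case (add x A)
    have "proots ([:- x, 1:] * (\<Prod>x\<in>#A. [:-x, 1:])) =
        proots [:- x, 1:] + proots (\<Prod>x\<in>#A. [:-x, 1:])"
      by (rule proots_mult) (use nz[of A] in auto)
    with add show ?case
      by (simp del: mult_pCons_left)
  qed simp
  then have "proots q = A"
    by (subst A(2)) (use assms in simp)
  then have "size (proots q) = Polynomial.degree q"
    using A by simp
  then show ?thesis
    using assms by (simp add: size_multiset_overloaded_eq)
qed

text \<open>Translation by c moves the root c to 0, so its multiplicity becomes the power of X
  required for inverting or annihilating through \<delta>.\<close>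

lemma indicial_factor:
  assumes "indicial_poly L \<noteq> 0"
  obtains g where "pcompose (indicial_poly L) [:c, 1:] = [:0, 1:] ^ exp_mult L c * g" "poly g 0 \<noteq> 0"
proof -
  obtain q where q: "indicial_poly L = [:- c, 1:] ^ exp_mult L c * q" "\<not> [:- c, 1:] dvd q"
    using order_decomp[OF assms, of c] by (auto simp: exp_mult_def)
  have pow: "pcompose ([:- c, 1:] ^ n) [:c, 1:] = [:0, 1:] ^ n" for n
    by (induction n) (simp_all add: pcompose_mult pcompose_pCons pcompose_1 del: mult_pCons_left)
  have "pcompose (indicial_poly L) [:c, 1:] = [:0, 1:] ^ exp_mult L c * pcompose q [:c, 1:]"
    by (subst q(1)) (simp add: pcompose_mult pow)
  moreover have "poly (pcompose q [:c, 1:]) 0 \<noteq> 0"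
    using q(2) by (simp add: poly_pcompose poly_eq_0_iff_dvd)
  ultimately show thesis
    by (rule that)
qed

lemma exp_mult_pos_imp_exponent:
  assumes "indicial_poly L \<noteq> 0" "0 < exp_mult L \<rho>"
  shows "\<rho> \<in> local_exponents L"
  using assms order_root[of "indicial_poly L" \<rho>] by (simp add: local_exponents_def exp_mult_def)

section \<open>The solutions of a regular singular equation\<close>

lemma logring_eqI:
  fixes y z :: "'k::field logring"
  assumes "\<And>\<tau> n. lookup y \<tau> $$ n = lookup z \<tau> $$ n"
  shows "y = z"
  by (rule poly_mapping_eqI, rule fls_eqI) (rule assms)

locale regular_operator =
  fixes L :: "'k::alg_closed_field diffop"
  assumes char_pos: "CHAR('k) > 0"
    and shift: "has_shift L 0"
    and regular: "regular_singular L"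
begin

abbreviation "M \<rho> k \<equiv> exp_mult L (\<rho> + of_nat k)"
abbreviation "ind \<rho> k \<equiv> pcompose (indicial_poly L) [:\<rho> + of_nat k, 1:]"

definition lower_terms :: "'k \<Rightarrow> nat \<Rightarrow> (nat \<Rightarrow> 'k zfield) \<Rightarrow> 'k zfield" where
  "lower_terms \<rho> n f =
     (\<Sum>l=1..n. act (pcompose (shifted_poly L l) [:\<rho> + of_nat (n - l), 1:]) (f (n - l)))"

definition H :: "'k \<Rightarrow> nat \<Rightarrow> (nat \<Rightarrow>\<^sub>0 nat) set" where
  "H \<rho> k = {\<alpha> \<in> exponent_set L \<rho> k. M \<rho> k \<le> digit_value CHAR('k) \<alpha>}"

definition series :: "'k \<Rightarrow> (nat \<Rightarrow> 'k zfield) \<Rightarrow> 'k logring" where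
  "series \<rho> f = single \<rho> (fps_to_fls (Abs_fps f))"

lemma indicial_nonzero: "indicial_poly L \<noteq> 0"
  by (rule degree_indicial_poly[OF shift regular])

lemma exponent_set_eq_chains: "exponent_set L \<rho> k = div_chains CHAR('k) (exp_count L \<rho> k)"
  by (simp add: exponent_set_def div_chains_def)

lemma exp_count_split: "exp_count L \<rho> k = (\<Sum>i<k. M \<rho> i) + M \<rho> k"
  by (simp add: exp_count_def lessThan_Suc_atMost[symmetric])

lemma formal_sums_iff:
  "y \<in> formal_sums \<rho> A \<longleftrightarrow> (\<exists>f. y = series \<rho> f \<and> (\<forall>k. f k \<in> zspan (A k)))"
proof
  assume "y \<in> formal_sums \<rho> A"
  then obtain f where "y = single \<rho> (fps_to_fls f)" "\<forall>k. \<exists>P. keys P \<subseteq> A k \<and> fps_nth f k = to_fract P"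
    by (auto simp: formal_sums_def)
  then show "\<exists>f. y = series \<rho> f \<and> (\<forall>k. f k \<in> zspan (A k))"
    by (intro exI[of _ "fps_nth f"]) (auto simp: series_def zspan_def fps_nth_inverse)
next
  assume "\<exists>f. y = series \<rho> f \<and> (\<forall>k. f k \<in> zspan (A k))"
  then obtain f where "y = series \<rho> f" "\<forall>k. f k \<in> zspan (A k)"
    by blast
  then show "y \<in> formal_sums \<rho> A"
    unfolding formal_sums_def series_def zspan_def
    by (intro CollectI exI[of _ "Abs_fps f"]) (auto simp: conj_commute)
qed

lemma function_space_iff:
  "y \<in> function_space L \<rho> \<longleftrightarrow> (\<exists>f. y = series \<rho> f \<and> (\<forall>k. f k \<in> zspan (exponent_set L \<rho> k)))"
  by (simp add: function_space_def formal_sums_iff)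

lemma complement_space_iff:
  "y \<in> complement_space L \<rho> \<longleftrightarrow> (\<exists>f. y = series \<rho> f \<and> (\<forall>k. f k \<in> zspan (H \<rho> k)))"
  by (simp add: complement_space_def formal_sums_iff H_def)

lemma series_nth:
  "lookup (series \<rho> f) \<tau> $$ n = (if \<tau> = \<rho> \<and> 0 \<le> n then f (nat n) else 0)"
  by (simp add: series_def lookup_single when_def)

lemma series_eq_iff: "series \<rho> f = series \<rho> g \<longleftrightarrow> f = g"
proof
  assume eq: "series \<rho> f = series \<rho> g"
  show "f = g"
  proof
    fix k
    have "lookup (series \<rho> f) \<rho> $$ int k = lookup (series \<rho> g) \<rho> $$ int k"
      by (simp only: eq)
    then show "f k = g k"
      by (simp add: series_nth)
  qed
qed simp

lemma series_add: "series \<rho> f + series \<rho> g = series \<rho> (\<lambda>k. f k + g k)"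
  by (rule logring_eqI) (simp add: series_nth lookup_add)

lemma series_diff: "series \<rho> f - series \<rho> g = series \<rho> (\<lambda>k. f k - g k)"
  by (rule logring_eqI) (simp add: series_nth lookup_minus)

lemma apply_initial_series:
  "apply_op (initial_form L) (series \<rho> f) = series \<rho> (\<lambda>k. act (ind \<rho> k) (f k))"
  by (rule logring_eqI) (simp add: apply_initial_form_nth[OF shift regular] series_nth)

lemma apply_op_series:
  "apply_op L (series \<rho> f) = series \<rho> (\<lambda>k. act (ind \<rho> k) (f k) + lower_terms \<rho> k f)"
proof (rule logring_eqI)
  fix \<tau> n
  have neg: "lookup (series \<rho> f) \<tau> $$ m = 0" if "m < 0" for m
    using that by (simp add: series_nth)
  show "lookup (apply_op L (series \<rho> f)) \<tau> $$ n =
      lookup (series \<rho> (\<lambda>k. act (ind \<rho> k) (f k) + lower_terms \<rho> k f)) \<tau> $$ n"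
  proof (cases "0 \<le> n")
    case True
    then obtain k where n: "n = int k"
      using nonneg_int_cases by blast
    have "lookup (apply_op L (series \<rho> f)) \<tau> $$ int k =
        act (ind \<tau> k) (lookup (series \<rho> f) \<tau> $$ int k) +
        (\<Sum>l=1..k. act (pcompose (shifted_poly L l) [:\<tau> + of_nat (k - l), 1:])
          (lookup (series \<rho> f) \<tau> $$ int (k - l)))"
      by (rule apply_op_nth_split[OF shift neg])
    moreover have "nat (int k - int l) = k - l" for l
      by simp
    ultimately show ?thesis
      by (cases "\<tau> = \<rho>") (simp_all add: n series_nth lower_terms_def)
  next
    case False
    then show ?thesis
      using apply_op_nth_lowest[OF shift, of n "series \<rho> f" \<tau>] by (simp add: series_nth)
  qed
qed

lemma T_map_series: "T_map L (series \<rho> f) = series \<rho> (\<lambda>k. - lower_terms \<rho> k f)"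
  by (simp add: T_map_def apply_initial_series apply_op_series series_diff)

text \<open>Only coefficients of order below k enter, so the bound omits the multiplicity at k. This
  is the room needed next: inverting \<open>ind \<rho> k\<close> may raise the first exponent by
  \<open>M \<rho> k\<close>, which fills \<open>exponent_set L \<rho> k\<close>.\<close>

lemma lower_terms_zspan:
  assumes "\<And>j. j < k \<Longrightarrow> f j \<in> zspan (exponent_set L \<rho> j)"
  shows "lower_terms \<rho> k f \<in> zspan (div_chains CHAR('k) (\<Sum>i<k. M \<rho> i))"
  unfolding lower_terms_def
proof (rule zspan_sum)
  fix l assume "l \<in> {1..k}"
  then have kl: "k - l < k"
    by simp
  have "exp_count L \<rho> (k - l) \<le> (\<Sum>i<k. M \<rho> i)"
    unfolding exp_count_def by (rule sum_mono2) (use kl in auto)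
  then have "f (k - l) \<in> zspan (div_chains CHAR('k) (\<Sum>i<k. M \<rho> i))"
    using assms[OF kl] unfolding exponent_set_eq_chains
    by (elim zspan_mono) (auto intro: chains_mono)
  then show "act (pcompose (shifted_poly L l) [:\<rho> + of_nat (k - l), 1:]) (f (k - l)) \<in>
      zspan (div_chains CHAR('k) (\<Sum>i<k. M \<rho> i))"
    by (rule act_zspan_chains[OF char_pos])
qed

lemma ind_surj:
  assumes "f \<in> zspan (div_chains CHAR('k) (\<Sum>i<k. M \<rho> i))"
  shows "\<exists>h\<in>zspan (H \<rho> k). act (ind \<rho> k) h = f"
proof -
  obtain g where "ind \<rho> k = [:0, 1:] ^ M \<rho> k * g" "poly g 0 \<noteq> 0"
    by (rule indicial_factor[OF indicial_nonzero])
  then show ?thesis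
    using act_surj[OF char_pos _ assms, of g "M \<rho> k"]
    by (simp add: H_def exponent_set_eq_chains exp_count_split)
qed

lemma ind_inj:
  assumes "h \<in> zspan (H \<rho> k)" "act (ind \<rho> k) h = 0"
  shows "h = 0"
proof -
  obtain g where "ind \<rho> k = [:0, 1:] ^ M \<rho> k * g" "poly g 0 \<noteq> 0"
    by (rule indicial_factor[OF indicial_nonzero])
  then show ?thesis
    using act_inj[OF char_pos, of g h "exponent_set L \<rho> k" "M \<rho> k"] assms by (simp add: H_def)
qed

text \<open>\<open>S_map\<close> is an \<open>inv_into\<close>; this injectivity and
  \<open>T_map_in_image\<close> make it a genuine inverse on the elements \<open>T_map L y\<close>
  with y in the function space.\<close>

lemma initial_inj_on: "inj_on (apply_op (initial_form L)) (complement_space L \<rho>)"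
proof (rule inj_onI)
  fix y z
  assume "y \<in> complement_space L \<rho>" "z \<in> complement_space L \<rho>"
  then obtain f g where f: "y = series \<rho> f" "\<And>k. f k \<in> zspan (H \<rho> k)"
    and g: "z = series \<rho> g" "\<And>k. g k \<in> zspan (H \<rho> k)"
    by (auto simp: complement_space_iff)
  assume "apply_op (initial_form L) y = apply_op (initial_form L) z"
  then have "series \<rho> (\<lambda>k. act (ind \<rho> k) (f k)) = series \<rho> (\<lambda>k. act (ind \<rho> k) (g k))"
    by (simp add: f g apply_initial_series)
  then have eq: "act (ind \<rho> k) (f k) = act (ind \<rho> k) (g k)" for k
    unfolding series_eq_iff by (rule fun_cong)
  have "f k - g k = 0" for k
    by (rule ind_inj[of _ \<rho> k]) (use f g eq in \<open>auto intro: zspan_diff simp: act_arg_diff\<close>)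
  then have "f = g"
    by (simp add: fun_eq_iff)
  then show "y = z"
    by (simp add: f g)
qed

lemma T_map_in_image:
  assumes "y \<in> function_space L \<rho>"
  shows "T_map L y \<in> apply_op (initial_form L) ` complement_space L \<rho>"
proof -
  obtain f where f: "y = series \<rho> f" "\<And>k. f k \<in> zspan (exponent_set L \<rho> k)"
    using assms by (auto simp: function_space_iff)
  have "\<forall>k. \<exists>h\<in>zspan (H \<rho> k). act (ind \<rho> k) h = - lower_terms \<rho> k f"
    by (intro allI ind_surj zspan_uminus lower_terms_zspan f)
  then obtain h where h: "\<And>k. h k \<in> zspan (H \<rho> k)" "\<And>k. act (ind \<rho> k) (h k) = - lower_terms \<rho> k f"
    by metis
  have "apply_op (initial_form L) (series \<rho> h) = T_map L y"
    by (simp add: f T_map_series apply_initial_series h)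
  moreover have "series \<rho> h \<in> complement_space L \<rho>"
    using h by (auto simp: complement_space_iff)
  ultimately show ?thesis
    by (metis imageI)
qed

section \<open>Construction of the basis solutions\<close>

abbreviation start :: "'k \<Rightarrow> nat \<Rightarrow> 'k logring" where
  "start \<rho> i \<equiv> single \<rho> (fls_const (zstar i))"

lemma start_series: "start \<rho> i = series \<rho> (\<lambda>k. if k = 0 then zstar i else 0)"
  by (rule logring_eqI) (auto simp: series_nth lookup_single when_def)

lemma initial_zstar:
  assumes "i < exp_mult L \<rho>"
  shows "act (ind \<rho> 0) (zstar i) = 0"
proof -
  obtain g where g: "ind \<rho> 0 = [:0, 1:] ^ exp_mult L \<rho> * g"
    by (rule indicial_factor[OF indicial_nonzero, of \<rho>]) simp
  obtain c where "triangular_family zderiv (zstar :: nat \<Rightarrow> 'k zfield) c"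
    using zstar_triangular_family[OF char_pos] by blast
  then interpret triangular_family zderiv "zstar :: nat \<Rightarrow> 'k zfield" c .
  have "(zderiv ^^ exp_mult L \<rho>) (zstar i :: 'k zfield) = 0"
    by (rule funpow_v_eq_0[OF assms])
  \<comment> \<open>With the power of X on the right, the power of \<delta> acts first and already
    gives 0.\<close>
  moreover have "ind \<rho> 0 = g * [:0, 1:] ^ exp_mult L \<rho>"
    unfolding g by (rule mult.commute)
  ultimately show ?thesis
    by (simp only: act_mult act_X_power act_arg_0)
qed

lemma initial_start:
  assumes "i < exp_mult L \<rho>"
  shows "apply_op (initial_form L) (start \<rho> i) = 0"
  unfolding start_series apply_initial_series
  by (rule logring_eqI) (use initial_zstar[OF assms] in \<open>auto simp: series_nth\<close>)

text \<open>A preimage is found order by order in x, in place of summing the powers of S T: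
  coefficient 0 is prescribed, and each later one is chosen in \<open>H \<rho> k\<close> to cancel
  the contribution of its predecessors.\<close>

lemma start_in_image:
  assumes i: "i < exp_mult L \<rho>"
  shows "start \<rho> i \<in> u_map L \<rho> ` function_space L \<rho>"
proof -
  \<comment> \<open>The recursion principle asks for a choice after every function f, sensible or
    not. Hence the implication, with default 0 when an earlier value leaves its span; for k > 0 the
    unconditional clause gives \<open>span\<close> without induction.\<close>
  define P where "P f k r \<longleftrightarrow> (if k = 0 then r = zstar i
    else r \<in> zspan (exponent_set L \<rho> k) \<and> ((\<forall>j<k. f j \<in> zspan (exponent_set L \<rho> j)) \<longrightarrow>
      r \<in> zspan (H \<rho> k) \<and> act (ind \<rho> k) r = - lower_terms \<rho> k f))"
    for f and k :: nat and r
  have low_cong: "lower_terms \<rho> k f = lower_terms \<rho> k g" if "\<And>j. j < k \<Longrightarrow> f j = g j" for k f g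
    unfolding lower_terms_def by (rule sum.cong) (use that in auto)
  have Hsub: "zspan (H \<rho> k) \<subseteq> zspan (exponent_set L \<rho> k)" for k
    by (auto simp: H_def intro: zspan_mono)
  have "\<exists>f. \<forall>k. P f k (f k)"
  proof (rule dependent_wf_choice[OF wf_less])
    fix f g :: "nat \<Rightarrow> 'k zfield" and k r
    assume eq: "\<And>j. (j, k) \<in> {(x, y). x < y} \<Longrightarrow> f j = g j"
    then have "lower_terms \<rho> k f = lower_terms \<rho> k g"
      by (intro low_cong) simp
    then show "P f k r = P g k r"
      using eq by (simp add: P_def)
  next
    fix k and f :: "nat \<Rightarrow> 'k zfield"
    show "\<exists>r. P f k r"
    proof (cases "\<forall>j<k. f j \<in> zspan (exponent_set L \<rho> j)")
      case True
      then have "\<exists>h\<in>zspan (H \<rho> k). act (ind \<rho> k) h = - lower_terms \<rho> k f"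
        by (intro ind_surj zspan_uminus lower_terms_zspan) auto
      then show ?thesis
        using Hsub[of k] by (cases "k = 0") (auto simp: P_def)
    next
      case False
      then show ?thesis
        by (auto simp: P_def intro: exI[of _ 0])
    qed
  qed
  then obtain f where f: "\<And>k. P f k (f k)"
    by blast
  have f0: "f 0 = zstar i"
    using f[of 0] by (simp add: P_def)
  have "star_exponent CHAR('k) i \<in> exponent_set L \<rho> 0"
    unfolding exponent_set_eq_chains
    by (rule star_exponent_chains) (use i CHAR_gt_1[OF char_pos] in \<open>auto simp: exp_count_def\<close>)
  then have "(zstar i :: 'k zfield) \<in> zspan (exponent_set L \<rho> 0)"
    using zspan_term[of _ "exponent_set L \<rho> 0" "1 :: 'k"] by simp
  then have span: "f k \<in> zspan (exponent_set L \<rho> k)" for k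
    using f[of k] f0 by (cases "k = 0") (auto simp: P_def)
  have step: "f k \<in> zspan (H \<rho> k)" "act (ind \<rho> k) (f k) = - lower_terms \<rho> k f" if "k > 0" for k
    using f[of k] span that by (auto simp: P_def)
  have "lower_terms \<rho> 0 f = 0"
    by (simp add: lower_terms_def)
  then have "act (ind \<rho> k) (f k) = - lower_terms \<rho> k f" for k
    using step(2)[of k] initial_zstar[OF i] f0 by (cases "k = 0") auto
  then have T: "T_map L (series \<rho> f) = apply_op (initial_form L) (series \<rho> f)"
    by (simp add: T_map_series apply_initial_series)
  \<comment> \<open>Removing the prescribed coefficient at order 0 leaves an element of the
    complement space, which \<open>S_map\<close> recovers from its image.\<close>
  define h where "h k = (if k = 0 then 0 else f k)" for k
  have h: "series \<rho> h \<in> complement_space L \<rho>"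
    using step(1) by (auto simp: complement_space_iff h_def)
  have "series \<rho> f = start \<rho> i + series \<rho> h"
    unfolding start_series series_add by (rule arg_cong[of _ _ "series \<rho>"]) (auto simp: h_def f0)
  moreover from this have "T_map L (series \<rho> f) = apply_op (initial_form L) (series \<rho> h)"
    unfolding T by (simp add: apply_op_add initial_start[OF i])
  then have "S_map L \<rho> (T_map L (series \<rho> f)) = series \<rho> h"
    unfolding S_map_def using inv_into_f_f[OF initial_inj_on h] by simp
  ultimately have "u_map L \<rho> (series \<rho> f) = start \<rho> i"
    by (simp add: u_map_def)
  moreover have "series \<rho> f \<in> function_space L \<rho>"
    using span by (auto simp: function_space_iff)
  ultimately show ?thesis
    by (metis imageI)
qed

text \<open>With s = S (T b) the equation u b = start reads b = start + s. Since L_0 kills the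
  start, L_0 b = L_0 s = T b, that is L b = 0. At order 0 there are no lower terms, so
  \<open>ind_inj\<close> makes s start at order 1, and b keeps the prescribed initial
  coefficient.\<close>

lemma basis_solution_properties:
  assumes i: "i < exp_mult L \<rho>"
  shows "\<exists>g. basis_solution L \<rho> i = single \<rho> g \<and> (\<forall>n<0. g $$ n = 0) \<and> g $$ 0 = zstar i"
    and "apply_op L (basis_solution L \<rho> i) = 0"
proof -
  let ?b = "basis_solution L \<rho> i" and ?L0 = "apply_op (initial_form L)"
  have b: "?b \<in> function_space L \<rho>" and u: "u_map L \<rho> ?b = start \<rho> i"
    unfolding basis_solution_def
    using inv_into_into[OF start_in_image[OF i]] f_inv_into_f[OF start_in_image[OF i]] by auto
  define s where "s = S_map L \<rho> (T_map L ?b)"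
  have s: "s \<in> complement_space L \<rho>" and L0s: "?L0 s = T_map L ?b"
    unfolding s_def S_map_def
    using inv_into_into[OF T_map_in_image[OF b]] f_inv_into_f[OF T_map_in_image[OF b]] by auto
  have bs: "?b = start \<rho> i + s"
    using u by (simp add: u_map_def s_def algebra_simps)
  have "?L0 ?b = T_map L ?b"
    by (subst bs) (simp add: apply_op_add initial_start[OF i] L0s)
  then show "apply_op L ?b = 0"
    by (simp add: T_map_def)
  obtain h where h: "s = series \<rho> h" "\<And>k. h k \<in> zspan (H \<rho> k)"
    using s by (auto simp: complement_space_iff)
  obtain f where f: "?b = series \<rho> f"
    using b by (auto simp: function_space_iff)
  have "series \<rho> (\<lambda>k. act (ind \<rho> k) (h k)) = series \<rho> (\<lambda>k. - lower_terms \<rho> k f)"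
    using L0s by (simp add: f h T_map_series apply_initial_series)
  then have "act (ind \<rho> 0) (h 0) = - lower_terms \<rho> 0 f"
    unfolding series_eq_iff by (rule fun_cong)
  also have "\<dots> = 0"
    by (simp add: lower_terms_def)
  finally have "h 0 = 0"
    by (rule ind_inj[OF h(2)])
  then have "f 0 = zstar i"
    using arg_cong[OF bs, of "\<lambda>y. lookup y \<rho> $$ 0"] unfolding f h(1) by (simp add: lookup_add series_nth)
  then show "\<exists>g. ?b = single \<rho> g \<and> (\<forall>n<0. g $$ n = 0) \<and> g $$ 0 = zstar i"
    unfolding f series_def by (intro exI[of _ "fps_to_fls (Abs_fps f)"]) simp
qed

section \<open>Counting and independence of the basis solutions\<close>

definition index_set :: "('k \<times> nat) set" where
  "index_set = {(\<rho>, i). \<rho> \<in> local_exponents L \<and> i < exp_mult L \<rho>}"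

definition basis_series :: "'k \<times> nat \<Rightarrow> 'k zfield fls" where
  "basis_series q = lookup (basis_solution L (fst q) (snd q)) (fst q)"

lemma finite_local_exponents: "finite (local_exponents L)"
  unfolding local_exponents_def by (rule poly_roots_finite[OF indicial_nonzero])

lemma index_set_Sigma: "index_set = (SIGMA \<rho>:local_exponents L. {..<exp_mult L \<rho>})"
  by (auto simp: index_set_def)

lemma finite_index_set: "finite index_set"
  unfolding index_set_Sigma by (intro finite_SigmaI finite_local_exponents) simp

lemma card_index_set: "card index_set = Polynomial.degree L"
proof -
  have "card index_set = (\<Sum>\<rho>\<in>local_exponents L. exp_mult L \<rho>)"
    unfolding index_set_Sigma by (subst card_SigmaI) (auto simp: finite_local_exponents)
  then show ?thesis
    by (simp add: local_exponents_def exp_mult_def sum_order_alg_closed[OF indicial_nonzero]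
        degree_indicial_poly[OF shift regular])
qed

lemma index_setI: "i < exp_mult L \<rho> \<Longrightarrow> (\<rho>, i) \<in> index_set"
  using exp_mult_pos_imp_exponent[OF indicial_nonzero, of \<rho>] by (simp add: index_set_def)

text \<open>Also valid when \<rho> is not a local exponent: its multiplicity is then 0 and both
  sides vanish.\<close>

lemma sum_index_set_fiber:
  assumes "\<And>q. q \<in> index_set \<Longrightarrow> fst q \<noteq> \<rho> \<Longrightarrow> F q = 0"
  shows "(\<Sum>q\<in>index_set. F q) = (\<Sum>i<exp_mult L \<rho>. F (\<rho>, i))"
proof -
  have "(\<Sum>q\<in>index_set. F q) = (\<Sum>q\<in>Pair \<rho> ` {..<exp_mult L \<rho>}. F q)"
  proof (rule sum.mono_neutral_right[OF finite_index_set])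
    show "Pair \<rho> ` {..<exp_mult L \<rho>} \<subseteq> index_set"
      by (auto intro: index_setI)
    show "\<forall>q\<in>index_set - Pair \<rho> ` {..<exp_mult L \<rho>}. F q = 0"
      using assms by (force simp: index_set_def)
  qed
  also have "\<dots> = (\<Sum>i<exp_mult L \<rho>. F (\<rho>, i))"
    by (subst sum.reindex) (auto simp: inj_on_def)
  finally show ?thesis .
qed

lemma basis_series:
  assumes "q \<in> index_set"
  shows "basis_solution L (fst q) (snd q) = single (fst q) (basis_series q)"
    and "n < 0 \<Longrightarrow> basis_series q $$ n = 0"
    and "basis_series q $$ 0 = zstar (snd q)"
    and "apply_op L (single (fst q) (basis_series q)) = 0"
proof -
  have i: "snd q < exp_mult L (fst q)"
    using assms by (auto simp: index_set_def)
  obtain g where g: "basis_solution L (fst q) (snd q) = single (fst q) g"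
    "\<forall>n<0. g $$ n = 0" "g $$ 0 = zstar (snd q)"
    using basis_solution_properties(1)[OF i] by blast
  then have "basis_series q = g"
    by (simp add: basis_series_def)
  then show "basis_solution L (fst q) (snd q) = single (fst q) (basis_series q)"
    "n < 0 \<Longrightarrow> basis_series q $$ n = 0" "basis_series q $$ 0 = zstar (snd q)"
    "apply_op L (single (fst q) (basis_series q)) = 0"
    using g basis_solution_properties(2)[OF i] by auto
qed

lemma lookup_mult_single:
  fixes y :: "'k logring"
  shows "lookup (y * single \<sigma> f) \<rho> = lookup y (\<rho> - \<sigma>) * f"
  using lookup_single_mult[of \<sigma> f y \<rho>] by (simp only: mult.commute)

lemma lookup_combination:
  "lookup (\<Sum>q\<in>index_set. c q * single (fst q) (basis_series q)) \<tau> =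
    (\<Sum>q\<in>index_set. lookup (c q) (\<tau> - fst q) * basis_series q)"
  by (simp add: lookup_sum lookup_mult_single)

lemma combination_nth_lowest:
  assumes "\<And>q n. q \<in> index_set \<Longrightarrow> n < N \<Longrightarrow> h q $$ n = 0"
  shows "n < N \<Longrightarrow> (\<Sum>q\<in>index_set. h q * basis_series q) $$ n = 0"
    and "(\<Sum>q\<in>index_set. h q * basis_series q) $$ N = (\<Sum>q\<in>index_set. h q $$ N * zstar (snd q))"
proof -
  have nth: "(h q * basis_series q) $$ n = (\<Sum>i=N..n. h q $$ i * basis_series q $$ (n - i))"
    if "q \<in> index_set" for q n
    using fls_times_nth_bounds[of N "h q" 0 "basis_series q" n] assms that basis_series(2) by simp
  show "n < N \<Longrightarrow> (\<Sum>q\<in>index_set. h q * basis_series q) $$ n = 0"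
    by (simp add: fls_sum_nth nth)
  show "(\<Sum>q\<in>index_set. h q * basis_series q) $$ N = (\<Sum>q\<in>index_set. h q $$ N * zstar (snd q))"
    by (simp add: fls_sum_nth nth basis_series(3))
qed

lemma basis_independent:
  assumes c: "\<And>q. q \<in> index_set \<Longrightarrow> c q \<in> constants"
    and zero: "(\<Sum>q\<in>index_set. c q * single (fst q) (basis_series q)) = 0"
    and q0: "q0 \<in> index_set"
  shows "c q0 = 0"
proof (rule ccontr)
  assume "c q0 \<noteq> 0"
  then obtain \<sigma> where \<sigma>: "lookup (c q0) \<sigma> \<noteq> 0"
    by (auto simp: poly_mapping_eq_iff fun_eq_iff)
  \<comment> \<open>All terms are compared in one exponent of t, chosen so that q0 contributes to
    it.\<close>
  define \<tau> where "\<tau> = \<sigma> + fst q0"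
  define h where "h q = lookup (c q) (\<tau> - fst q)" for q
  define J where "J = {q \<in> index_set. h q \<noteq> 0}"
  have J: "finite J" "q0 \<in> J"
    using finite_index_set q0 \<sigma> by (auto simp: J_def h_def \<tau>_def)
  define N where "N = Min ((\<lambda>q. fls_subdegree (h q)) ` J)"
  have "N \<in> (\<lambda>q. fls_subdegree (h q)) ` J"
    unfolding N_def by (rule Min_in) (use J in auto)
  then obtain q1 where q1: "q1 \<in> J" "N = fls_subdegree (h q1)"
    by blast
  have low: "h q $$ n = 0" if "q \<in> index_set" "n < N" for q n
  proof (cases "h q = 0")
    case False
    then have "N \<le> fls_subdegree (h q)"
      unfolding N_def by (intro Min_le) (use that J in \<open>auto simp: J_def\<close>)
    then show ?thesis
      using that by simp
  qed simp
  have const: "zderiv (h q $$ n) = 0" "h q $$ n \<noteq> 0 \<Longrightarrow> \<tau> - fst q = - of_int n"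
    if "q \<in> index_set" for q n
    using c[OF that] constants_nth[OF char_pos, of "c q"] by (auto simp: h_def)
  \<comment> \<open>A constant has an x^N coefficient only at t^(-N); in t^\<tau> x^N therefore only
    the basis solutions with this \<rho> can meet, and \<open>zstar_independent\<close> applies to
    them.\<close>
  define \<rho> where "\<rho> = \<tau> + of_int N"
  have fib: "fst q = \<rho>" if "q \<in> index_set" "h q $$ N \<noteq> 0" for q
    using const(2)[OF that] by (simp add: \<rho>_def algebra_simps)
  have "(\<Sum>q\<in>index_set. h q * basis_series q) = 0"
    using lookup_combination[of c \<tau>] zero by (simp add: h_def)
  then have "0 = (\<Sum>q\<in>index_set. h q $$ N * zstar (snd q))"
    using combination_nth_lowest(2)[of N h] low by simp
  also have "\<dots> = (\<Sum>i<exp_mult L \<rho>. h (\<rho>, i) $$ N * zstar i)"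
    using fib by (subst sum_index_set_fiber[of \<rho>]) auto
  finally have "h (\<rho>, i) $$ N = 0" if "i < exp_mult L \<rho>" for i
    using zstar_independent[OF char_pos, of "exp_mult L \<rho>" "\<lambda>i. h (\<rho>, i) $$ N" i] that
      const(1) index_setI by simp
  moreover have "h q1 $$ N \<noteq> 0" "q1 \<in> index_set"
    using q1 by (auto simp: J_def)
  moreover from this have "fst q1 = \<rho>"
    by (intro fib)
  moreover from this have "snd q1 < exp_mult L \<rho>"
    using \<open>q1 \<in> index_set\<close> by (auto simp: index_set_def)
  ultimately show False
    by (metis prod.collapse)
qed

lemma solutions_combination:
  assumes "\<And>q. q \<in> index_set \<Longrightarrow> c q \<in> constants"
  shows "apply_op L (\<Sum>q\<in>index_set. c q * single (fst q) (basis_series q)) = 0"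
  unfolding apply_op_sum
proof (rule sum.neutral, rule ballI)
  fix q assume "q \<in> index_set"
  then show "apply_op L (c q * single (fst q) (basis_series q)) = 0"
    using assms[of q] basis_series(4)[of q]
    by (simp add: apply_op_mult_const constants_eq_ker[OF char_pos])
qed

section \<open>Solutions as combinations of the basis solutions\<close>

definition residual :: "'k zfield fls \<Rightarrow> ('k \<times> nat \<Rightarrow> 'k zfield fls) \<Rightarrow> 'k zfield fls" where
  "residual f h = f - (\<Sum>q\<in>index_set. h q * basis_series q)"

text \<open>
  The lowest coefficient of a solution is killed by the indicial polynomial in the derivation, so
  it is a combination of the lowest coefficients of those basis solutions whose exponent has the
  right value.
\<close>

lemma residual_step:
  assumes sol: "apply_op L (single \<tau> f) = 0"
    and h: "\<And>q. q \<in> index_set \<Longrightarrow> single (\<tau> - fst q) (h q) \<in> constants"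
    and low: "\<And>n. n < N \<Longrightarrow> residual f h $$ n = 0"
  obtains h' where "\<And>q. q \<in> index_set \<Longrightarrow> single (\<tau> - fst q) (h' q) \<in> constants"
    and "\<And>n. n < N + 1 \<Longrightarrow> residual f h' $$ n = 0"
    and "\<And>q n. n \<noteq> N \<Longrightarrow> h' q $$ n = h q $$ n"
proof -
  let ?r = "residual f h" and ?\<rho> = "\<tau> + of_int N"
  have "single \<tau> ?r = single \<tau> f - (\<Sum>q\<in>index_set. single (\<tau> - fst q) (h q) *
      single (fst q) (basis_series q))"
    by (rule poly_mapping_eqI)
       (auto simp: residual_def mult_single lookup_minus lookup_sum lookup_single when_def)
  then have "apply_op L (single \<tau> ?r) = 0"
    using solutions_combination[of "\<lambda>q. single (\<tau> - fst q) (h q)"] h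
    by (simp add: apply_op_diff sol)
  then have "0 = lookup (apply_op L (single \<tau> ?r)) \<tau> $$ N"
    by simp
  also have "\<dots> = act (pcompose (indicial_poly L) [:?\<rho>, 1:]) (?r $$ N)"
    using apply_op_nth_lowest[OF shift, of N "single \<tau> ?r" \<tau>] low by simp
  finally have act0: "act (pcompose (indicial_poly L) [:?\<rho>, 1:]) (?r $$ N) = 0"
    by simp
  obtain g where "pcompose (indicial_poly L) [:?\<rho>, 1:] = [:0, 1:] ^ exp_mult L ?\<rho> * g" "poly g 0 \<noteq> 0"
    by (rule indicial_factor[OF indicial_nonzero])
  with act0 have "(zderiv ^^ exp_mult L ?\<rho>) (?r $$ N) = 0"
    using act_eq_0_imp_funpow[OF char_pos] by simp
  then obtain a where a: "\<And>l. zderiv (a l) = 0" "?r $$ N = (\<Sum>l<exp_mult L ?\<rho>. a l * zstar l)"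
    by (rule ker_funpow_zderiv[OF char_pos]) blast
  \<comment> \<open>The correction is a_l x^N on the indices over \<rho> = \<tau> + N; it is a
    constant of R because its exponent of t is \<tau> - \<rho> = -N.\<close>
  define d where "d q = (if fst q = ?\<rho> then fls_shift (- N) (fls_const (a (snd q))) else 0)" for q
  have d_nth: "d q $$ n = (if n = N \<and> fst q = ?\<rho> then a (snd q) else 0)" for q n
    by (simp add: d_def)
  define h' where "h' q = h q + d q" for q
  have "single (\<tau> - fst q) (d q) \<in> constants" for q
    unfolding constants_nth[OF char_pos] using a(1) by (simp add: lookup_single when_def d_nth)
  then have "single (\<tau> - fst q) (h' q) \<in> constants" if "q \<in> index_set" for q
    using h[OF that] by (simp add: h'_def single_add constants_eq_ker[OF char_pos] log_deriv.add)
  moreover have "residual f h' $$ n = 0" if "n < N + 1" for n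
  proof -
    have res: "residual f h' = ?r - (\<Sum>q\<in>index_set. d q * basis_series q)"
      by (simp add: residual_def h'_def algebra_simps sum.distrib)
    note cl = combination_nth_lowest[of N d]
    show ?thesis
    proof (cases "n = N")
      case True
      have "(\<Sum>q\<in>index_set. d q * basis_series q) $$ N = (\<Sum>q\<in>index_set. d q $$ N * zstar (snd q))"
        by (rule cl(2)) (simp add: d_nth)
      also have "\<dots> = (\<Sum>l<exp_mult L ?\<rho>. a l * zstar l)"
        by (subst sum_index_set_fiber[of ?\<rho>]) (auto simp: d_nth)
      finally show ?thesis
        using True by (simp add: res a(2))
    next
      case False
      then show ?thesis
        using that low[of n] cl(1)[of n] by (simp add: res d_nth)
    qed
  qed
  moreover have "h' q $$ n = h q $$ n" if "n \<noteq> N" for q n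
    using that by (simp add: h'_def d_nth)
  ultimately show thesis
    by (rule that)
qed

text \<open>Each stage changes the coefficient functions only at one order, so they stabilize from
  below and have a limit in Laurent series.\<close>

lemma single_solution_span:
  assumes sol: "apply_op L (single \<tau> f) = 0"
  shows "\<exists>c. (\<forall>q\<in>index_set. c q \<in> constants) \<and>
    single \<tau> f = (\<Sum>q\<in>index_set. c q * single (fst q) (basis_series q))"
proof -
  obtain N where N: "\<And>n. n < N \<Longrightarrow> f $$ n = 0"
    using fls_nth_vanishes_belowE by metis
  \<comment> \<open>The last clause, a common lower bound N on the orders at all stages, makes the
    limit a Laurent series.\<close>
  define P where "P k h \<longleftrightarrow> (\<forall>q\<in>index_set. single (\<tau> - fst q) (h q) \<in> constants) \<and>
    (\<forall>n<N + int k. residual f h $$ n = 0) \<and> (\<forall>q. \<forall>n<N. h q $$ n = 0)" for k h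
  have "\<exists>h. \<forall>k. P k (h k) \<and> (\<forall>q n. n \<noteq> N + int k \<longrightarrow> h (Suc k) q $$ n = h k q $$ n)"
  proof (rule dependent_nat_choice)
    have "P 0 (\<lambda>_. 0)"
      by (simp add: P_def residual_def N constants_eq_ker[OF char_pos])
    then show "\<exists>h. P 0 h"
      by (rule exI[of _ "\<lambda>_. 0"])
  next
    fix h and k :: nat
    assume "P k h"
    then have h: "\<And>q. q \<in> index_set \<Longrightarrow> single (\<tau> - fst q) (h q) \<in> constants"
      "\<And>n. n < N + int k \<Longrightarrow> residual f h $$ n = 0" "\<And>q n. n < N \<Longrightarrow> h q $$ n = 0"
      by (auto simp: P_def)
    obtain h' where "\<And>q. q \<in> index_set \<Longrightarrow> single (\<tau> - fst q) (h' q) \<in> constants"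
      "\<And>n. n < N + int k + 1 \<Longrightarrow> residual f h' $$ n = 0"
      "\<And>q n. n \<noteq> N + int k \<Longrightarrow> h' q $$ n = h q $$ n"
      using residual_step[OF sol h(1,2)] by blast
    then show "\<exists>h'. P (Suc k) h' \<and> (\<forall>q n. n \<noteq> N + int k \<longrightarrow> h' q $$ n = h q $$ n)"
      using h(3) by (intro exI[of _ h']) (auto simp: P_def)
  qed
  then obtain H where H: "\<And>k. P k (H k)"
    and H_Suc: "\<And>k q n. n \<noteq> N + int k \<Longrightarrow> H (Suc k) q $$ n = H k q $$ n"
    by blast
  have H_low: "H k q $$ n = 0" if "n < N" for k q n
    using H[of k] that unfolding P_def by blast
  have H_stable: "H k q $$ n = H k' q $$ n" if "n < N + int k" "k \<le> k'" for k k' q n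
    using that(2,1)
  proof (induction k' rule: dec_induct)
    case (step m)
    then show ?case
      using H_Suc[of n m q] by simp
  qed simp
  \<comment> \<open>The stage \<open>nat (n - N + 1)\<close> is the first k with n < N + k, from
    which on coefficient n no longer changes.\<close>
  define h where "h q = Abs_fls (\<lambda>n. H (nat (n - N + 1)) q $$ n)" for q
  have h_nth': "h q $$ n = H (nat (n - N + 1)) q $$ n" for q n
    unfolding h_def
  proof (rule nth_Abs_fls_ex_lower_bound, intro exI[of _ N] allI impI)
    fix n assume "n < N"
    then show "H (nat (n - N + 1)) q $$ n = 0"
      by (rule H_low)
  qed
  have h_nth: "h q $$ n = H k q $$ n" if "n < N + int k" for q n k
  proof (cases "n < N")
    case True
    then show ?thesis
      by (simp add: h_nth' H_low)
  next
    case False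
    then show ?thesis
      unfolding h_nth' by (intro H_stable) (use that in auto)
  qed
  have h_low: "h q $$ n = 0" if "n < N" for q n
    using that by (simp add: h_nth' H_low)
  have const: "single (\<tau> - fst q) (h q) \<in> constants" if "q \<in> index_set" for q
    unfolding constants_nth[OF char_pos]
  proof (intro allI)
    fix \<rho> n
    have "single (\<tau> - fst q) (H (nat (n - N + 1)) q) \<in> constants"
      using H that by (simp add: P_def)
    then have "zderiv (lookup (single (\<tau> - fst q) (H (nat (n - N + 1)) q)) \<rho> $$ n) = 0 \<and>
        (lookup (single (\<tau> - fst q) (H (nat (n - N + 1)) q)) \<rho> $$ n \<noteq> 0 \<longrightarrow> \<rho> = - of_int n)"
      unfolding constants_nth[OF char_pos] by blast
    then show "zderiv (lookup (single (\<tau> - fst q) (h q)) \<rho> $$ n) = 0 \<and>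
        (lookup (single (\<tau> - fst q) (h q)) \<rho> $$ n \<noteq> 0 \<longrightarrow> \<rho> = - of_int n)"
      by (auto simp: lookup_single when_def h_nth')
  qed
  have "f = (\<Sum>q\<in>index_set. h q * basis_series q)"
  proof (rule fls_eqI)
    fix n
    define k where "k = nat (n - N + 1)"
    have nk: "n < N + int k"
      by (simp add: k_def)
    \<comment> \<open>Basis series have no negative powers of x, so coefficient n of the product
      involves only coefficients of h up to n, all final at stage k.\<close>
    have "(h q * basis_series q) $$ n = (H k q * basis_series q) $$ n" if "q \<in> index_set" for q
    proof -
      have "(h q * basis_series q) $$ n = (\<Sum>i=N..n - 0. h q $$ i * basis_series q $$ (n - i))"
        by (rule fls_times_nth_bounds) (use h_low basis_series(2)[OF that] in auto)
      also have "\<dots> = (\<Sum>i=N..n - 0. H k q $$ i * basis_series q $$ (n - i))"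
        using nk by (intro sum.cong) (simp_all add: h_nth[where k = k])
      also have "\<dots> = (H k q * basis_series q) $$ n"
        by (rule fls_times_nth_bounds[symmetric])
           (use H_low basis_series(2)[OF that] in auto)
      finally show ?thesis .
    qed
    then have "(\<Sum>q\<in>index_set. h q * basis_series q) $$ n =
        (\<Sum>q\<in>index_set. H k q * basis_series q) $$ n"
      by (simp add: fls_sum_nth)
    also have "\<dots> = f $$ n"
      using H[of k] nk by (simp add: P_def residual_def)
    finally show "f $$ n = (\<Sum>q\<in>index_set. h q * basis_series q) $$ n"
      by simp
  qed
  then have "single \<tau> f = single \<tau> (\<Sum>q\<in>index_set. h q * basis_series q)"
    by simp
  also have "\<dots> = (\<Sum>q\<in>index_set. single (\<tau> - fst q) (h q) * single (fst q) (basis_series q))"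
    by (rule poly_mapping_eqI) (auto simp: mult_single lookup_sum lookup_single when_def)
  finally have "single \<tau> f = (\<Sum>q\<in>index_set. single (\<tau> - fst q) (h q) * single (fst q) (basis_series q))" .
  with const show ?thesis
    by (intro exI[of _ "\<lambda>q. single (\<tau> - fst q) (h q)"]) auto
qed

lemma solution_span:
  assumes sol: "apply_op L y = 0"
  shows "\<exists>c. (\<forall>q\<in>index_set. c q \<in> constants) \<and>
    y = (\<Sum>q\<in>index_set. c q * single (fst q) (basis_series q))"
proof -
  have "\<forall>\<tau>. \<exists>c. (\<forall>q\<in>index_set. c q \<in> constants) \<and>
    single \<tau> (lookup y \<tau>) = (\<Sum>q\<in>index_set. c q * single (fst q) (basis_series q))"
    by (intro allI single_solution_span) (simp add: apply_op_single[OF shift] sol)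
  from choice[OF this] obtain c where c: "\<And>\<tau> q. q \<in> index_set \<Longrightarrow> c \<tau> q \<in> constants"
    "\<And>\<tau>. single \<tau> (lookup y \<tau>) = (\<Sum>q\<in>index_set. c \<tau> q * single (fst q) (basis_series q))"
    by blast
  have "y = (\<Sum>\<tau>\<in>keys y. single \<tau> (lookup y \<tau>))"
    by (rule poly_mapping_sum_single)
  also have "\<dots> = (\<Sum>q\<in>index_set. \<Sum>\<tau>\<in>keys y. c \<tau> q * single (fst q) (basis_series q))"
    unfolding c(2) by (rule sum.swap)
  also have "\<dots> = (\<Sum>q\<in>index_set. (\<Sum>\<tau>\<in>keys y. c \<tau> q) * single (fst q) (basis_series q))"
    by (simp add: sum_distrib_right)
  finally have "y = \<dots>" .
  moreover have "(\<Sum>\<tau>\<in>keys y. c \<tau> q) \<in> constants" if "q \<in> index_set" for q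
    using c(1)[OF that] by (simp add: constants_eq_ker[OF char_pos] log_deriv.sum)
  ultimately show ?thesis
    by (intro exI[of _ "\<lambda>q. \<Sum>\<tau>\<in>keys y. c \<tau> q"]) auto
qed

lemma solutions_basis:
  shows "basis_family (ring_of_type_algebra :: 'k logring ring) constants index_set
      (\<lambda>(\<rho>, i). basis_solution L \<rho> i) (solutions L)"
    and "ring.dimension (ring_of_type_algebra :: 'k logring ring) (Polynomial.degree L)
      constants (solutions L)"
proof -
  have y: "(\<Sum>q\<in>index_set. c q * (\<lambda>(\<rho>, i). basis_solution L \<rho> i) q) =
      (\<Sum>q\<in>index_set. c q * single (fst q) (basis_series q))" for c
    by (rule sum.cong) (auto simp: basis_series(1)[symmetric])
  note basis = basis_familyI[OF subfield_constants[OF char_pos] finite_index_set,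
      of "\<lambda>(\<rho>, i). basis_solution L \<rho> i" "solutions L", unfolded y solutions_def mem_Collect_eq]
  show "basis_family (ring_of_type_algebra :: 'k logring ring) constants index_set
      (\<lambda>(\<rho>, i). basis_solution L \<rho> i) (solutions L)"
    unfolding solutions_def
    by (rule basis(1)) (use basis_independent solutions_combination solution_span in blast)+
  show "ring.dimension (ring_of_type_algebra :: 'k logring ring) (Polynomial.degree L)
      constants (solutions L)"
    unfolding solutions_def card_index_set[symmetric]
    by (rule basis(2)) (use basis_independent solutions_combination solution_span in blast)+
qed

lemma solutions_subalgebra:
  "subalgebra constants (solutions L) (ring_of_type_algebra :: 'k logring ring)"
proof -
  interpret R: cring "ring_of_type_algebra :: 'k logring ring"
    by (rule cring_from_type_algebra)
  have "subgroup (solutions L) (add_monoid (ring_of_type_algebra :: 'k logring ring))"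
  proof (rule R.add.subgroupI)
    show "solutions L \<noteq> {}"
      by (auto simp: solutions_def intro: exI[of _ 0])
    show "\<ominus>\<^bsub>ring_of_type_algebra\<^esub> y \<in> solutions L" if "y \<in> solutions L" for y
      using that apply_op_diff[of L 0 y] by (simp add: a_inv_ring_of_type_algebra solutions_def)
  qed (auto simp: solutions_def apply_op_add)
  then show ?thesis
    by (rule subalgebra.intro)
       (auto simp: subalgebra_axioms_def solutions_def apply_op_mult_const constants_eq_ker[OF char_pos])
qed

end

theorem theorem3p17:
  fixes L :: "'k::alg_closed_field diffop" and n :: nat
  assumes "CHAR('k) > 0"
    and "Polynomial.degree L = n"
    and "has_shift L 0"
    and "regular_singular L"
  shows "subfield constants (ring_of_type_algebra :: 'k logring ring) \<and>
    subalgebra constants (solutions L) (ring_of_type_algebra :: 'k logring ring) \<and>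
    ring.dimension (ring_of_type_algebra :: 'k logring ring) n constants (solutions L) \<and>
    basis_family (ring_of_type_algebra :: 'k logring ring) constants
      {(\<rho>, i). \<rho> \<in> local_exponents L \<and> i < exp_mult L \<rho>}
      (\<lambda>(\<rho>, i). basis_solution L \<rho> i) (solutions L)"
proof -
  interpret regular_operator L
    by unfold_locales (use assms in auto)
  show ?thesis
    using subfield_constants[OF assms(1)] solutions_subalgebra solutions_basis assms(2)
    unfolding index_set_def by blast
qed

end
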